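(* There exist constants $c_0\in(0,1)$ and $C>0$ (absolute, i.e. depending only on the fixed constant $M$ in the definition of $\dot K^{\pm}_{N,L}$) such that the following holds. Let $N_1,N_2,L_1,L_2>0$, let $\pm_1,\pm_2$ be any signs, let $\omega\in\mathbb S^1$, let $I\subset\mathbb R$ be a compact interval of length $|I|$, and let $0<\alpha\le c_0$. Let $u_1,u_2\in L^2(\mathbb R^{1+2})$ satisfy $\operatorname{supp}\widehat{u_j}\subset\dot K^{\pm_j}_{N_j,L_j}$ for $j=1,2$, and assume also that $$\operatorname{supp}\widehat{u_1}\subset\{(\tau,\xi):\theta(\xi,\omega^\perp)\ge\alpha\}.$$ Then $$\left\|\mathbf P_{\xi_0\cdot\omega\in I}(u_1u_2)\right\|\le C\left[\frac{|I|\,(N_{\min}^{12})^{1/2}(L_1L_2)^{3/4}}{\alpha}\right]^{1/2}\|u_1\|\,\|u_2\|.$$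
   Context: Points of $\mathbb R^{1+2}$ are written $(\tau,\xi)$ with $\tau\in\mathbb R$, $\xi\in\mathbb R^2$. $\|\cdot\|$ is the norm on $L^2(\mathbb R^{1+2})$, $\widehat u$ is the space-time Fourier transform $\widehat u(\tau,\xi)=\iint e^{-i(t\tau+x\cdot\xi)}u(t,x)\,dt\,dx$. The multiplier $\mathbf P_A$ is defined by $\widehat{\mathbf P_Au}=\chi_A\widehat u$; in particular $\mathbf P_{\xi_0\cdot\omega\in I}$ restricts the Fourier transform of its argument (whose Fourier variable is denoted $(\tau_0,\xi_0)$) to the set $\{(\tau_0,\xi_0):\xi_0\cdot\omega\in I\}$. Thickened truncated null cones: for $N,L>0$ and a sign $\pm$, $$\dot K^{\pm}_{N,L}=\{(\tau,\xi)\in\mathbb R^{1+2}:|\xi|\sim N,\ \tau=\pm|\xi|+O(L)\},$$ i.e. $M^{-1}N\le|\xi|\le MN$ and $|\tau\mp|\xi||\le ML$, for a fixed absolute constant $M\ge1$. $\omega^\perp$ is the line through the origin orthogonal to $\omega$, and $\theta(\xi,\omega^\perp)\in[0,\pi/2]$ is the angle between the nonzero vector $\xi$ and this line. $N_{\min}^{12}=\min(N_1,N_2)$. *)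

theory Defs
  imports "HOL-Analysis.Analysis"
begin

definition L2 :: "('a::euclidean_space \<Rightarrow> complex) set" where
  "L2 = {u \<in> borel_measurable lborel. integrable lborel (\<lambda>z. (norm (u z))\<^sup>2)}"

definition L2_norm :: "('a::euclidean_space \<Rightarrow> complex) \<Rightarrow> real" where
  "L2_norm u = sqrt (\<integral>z. (norm (u z))\<^sup>2 \<partial>lborel)"

text \<open>The integral formula for the Fourier transform, meaningful for integrable functions.\<close>

definition fourier_integral :: "('a::euclidean_space \<Rightarrow> complex) \<Rightarrow> 'a \<Rightarrow> complex" where
  "fourier_integral u \<zeta> = (\<integral>z. exp (- \<i> * complex_of_real (z \<bullet> \<zeta>)) * u z \<partial>lborel)"

text \<open>
  The Fourier transform on $L^2$ is the limit in mean of the integral formula applied to the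
  truncations of \<open>u\<close> to balls; these truncations lie in $L^1 \cap L^2$. The nonnegative integral below
  equals infinity if the difference is not square integrable.
\<close>

definition has_fourier_L2 ::
  "('a::euclidean_space \<Rightarrow> complex) \<Rightarrow> ('a \<Rightarrow> complex) \<Rightarrow> bool" where
  "has_fourier_L2 u v \<longleftrightarrow> u \<in> L2 \<and> v \<in> L2 \<and>
     (\<lambda>n. \<integral>\<^sup>+\<zeta>. ennreal ((norm
          (fourier_integral (\<lambda>z. indicator (cball 0 (real n)) z * u z) \<zeta> - v \<zeta>))\<^sup>2) \<partial>lborel)
       \<longlonglongrightarrow> 0"

text \<open>By Plancherel such a \<open>v\<close> exists for every \<open>u \<in> L2\<close>, uniquely up to null sets.\<close>

definition fourier_L2 :: "('a::euclidean_space \<Rightarrow> complex) \<Rightarrow> 'a \<Rightarrow> complex" where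
  "fourier_L2 u = (SOME v. has_fourier_L2 u v)"

text \<open>
  The support of a measurable function considered up to null sets, i.e. its support as a
  distribution: the complement of the largest open set on which it vanishes almost everywhere.
\<close>

definition ess_support :: "('a::euclidean_space \<Rightarrow> complex) \<Rightarrow> 'a set" where
  "ess_support f = - \<Union>{U. open U \<and> (AE z in lborel. z \<in> U \<longrightarrow> f z = 0)}"

text \<open>
  \<open>fourier_proj A u\<close> is $\mathbf P_A u$ for \<open>u \<in> L2\<close>; again determined up to null sets, for
  measurable \<open>A\<close>.
\<close>

definition fourier_proj ::
  "'a::euclidean_space set \<Rightarrow> ('a \<Rightarrow> complex) \<Rightarrow> 'a \<Rightarrow> complex" where
  "fourier_proj A u =
     (SOME w. w \<in> L2 \<and> (AE \<zeta> in lborel. fourier_L2 w \<zeta> = indicator A \<zeta> * fourier_L2 u \<zeta>))"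

text \<open>
  Points of $\mathbb R^{1+2}$ are pairs; the inner product on the product type is
  $t\tau + x\cdot\xi$.
\<close>

type_synonym spacetime = "real \<times> (real^2)"

text \<open>
  The parameter \<open>s\<close> is the sign of the cone, \<open>1\<close> or \<open>-1\<close>, and \<open>M\<close> is the constant implicit in
  $\sim$ and $O(\cdot)$.
\<close>

definition thick_cone :: "real \<Rightarrow> real \<Rightarrow> real \<Rightarrow> real \<Rightarrow> spacetime set" where
  "thick_cone M s N L =
     {(\<tau>, \<xi>). N / M \<le> norm \<xi> \<and> norm \<xi> \<le> M * N \<and> \<bar>\<tau> - s * norm \<xi>\<bar> \<le> M * L}"

definition vector_angle :: "'a::euclidean_space \<Rightarrow> 'a \<Rightarrow> real" where
  "vector_angle x y = arccos (x \<bullet> y / (norm x * norm y))"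

text \<open>
  Since a line through the origin contains \<open>v\<close> together with \<open>-v\<close>, the infimum lies in
  $[0,\pi/2]$. For \<open>x = 0\<close> the value is $\pi/2$, by convention.
\<close>

definition line_angle :: "'a::euclidean_space \<Rightarrow> 'a set \<Rightarrow> real" where
  "line_angle x l = (INF v\<in>l - {0}. vector_angle x v)"

end

theory Submission
  imports Defs "HOL-Probability.Characteristic_Functions"
begin

text \<open>
  The Fourier transform of \<open>u\<^sub>1 u\<^sub>2\<close> is, up to a constant, the convolution of the compactly
  supported functions \<open>v\<^sub>j\<close>, the transforms of \<open>u\<^sub>j\<close>. For \<open>\<xi>\<^sub>0 \<bullet> \<omega> \<in> I\<close> one may cut both
  \<open>v\<^sub>j\<close> into strips of width comparable to \<open>|I|\<close> in the direction \<open>\<omega>\<close>, and only boundedly many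
  pairs of strips interact. For one pair, replacing \<open>v\<^sub>2\<close> by its reflection does not change the
  \<open>L\<^sup>2\<close> norm of the convolution of the moduli, so both signs may be assumed equal. By
  Cauchy-Schwarz it then suffices to bound the volume of the intersection of the first support
  with a reflected translate of the second. Integrating out \<open>\<tau>\<close> leaves, on each line
  parallel to \<open>\<omega>\<^sup>\<bottom>\<close>, a level set of \<open>|\<xi>| + |\<xi>\<^sub>0 - \<xi>|\<close>, whose length is controlled by the
  convexity of this function, or, where that degenerates, by its monotonicity; the angle
  condition quantifies both.
\<close>

section \<open>Square integrable functions\<close>

text \<open>The order of the reductions is forced. Reflecting one factor changes the output
  frequency, so it cannot coexist with a cut-off in \<open>\<xi>0 \<bullet> \<omega>\<close>; the
  strips move this cut-off to the inputs beforehand. The reflection is wanted because for unlike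
  signs the level function would be the difference of the two norms, which is not convex.

  The exponents arise as follows. A \<tau>-section has length of order min(L1,L2) and the strip has
  width |I|. A function on a line with curvature l stays within K of a given value on a set of
  length of order (K/l)^(1/2); typically K is of order max(L1,L2) and l of order \<alpha>^2/N_min.
  The product of the three lengths has the required form because min times max^(1/2) is at most (L1
  L2)^(3/4).

  The L2 transform is specified only as a limit in mean, picked by \<open>SOME\<close>. Its
  existence, uniqueness and inversion all rest on Gaussians, whose transforms are explicit. As
  constants need not be sharp, one-sided Bessel bounds take the place of Plancherel's
  identity.\<close>

definition sq_norm :: "('a::euclidean_space \<Rightarrow> complex) \<Rightarrow> ennreal" where
  "sq_norm f = (\<integral>\<^sup>+ z. ennreal ((norm (f z))^2) \<partial>lborel)"

lemma L2_iff: "u \<in> L2 \<longleftrightarrow> u \<in> borel_measurable borel \<and> sq_norm u < \<infinity>"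
  unfolding L2_def sq_norm_def by (auto simp: integrable_iff_bounded)

lemma L2_integrable: "u \<in> L2 \<Longrightarrow> integrable lborel (\<lambda>z. (norm (u z))^2)"
  by (simp add: L2_def)

lemma L2_norm_nonneg: "0 \<le> L2_norm u"
  by (simp add: L2_norm_def)

lemma sq_norm_eq_L2_norm: "u \<in> L2 \<Longrightarrow> sq_norm u = ennreal ((L2_norm u)^2)"
  unfolding sq_norm_def L2_norm_def
  by (subst nn_integral_eq_integral) (auto simp: L2_def)

lemma sq_norm_cong_AE: "AE z in lborel. f z = g z \<Longrightarrow> sq_norm f = sq_norm g"
  unfolding sq_norm_def by (rule nn_integral_cong_AE) auto

lemma sq_norm_mono: "(\<And>z. norm (f z) \<le> norm (g z)) \<Longrightarrow> sq_norm f \<le> sq_norm g"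
  unfolding sq_norm_def by (intro nn_integral_mono) (auto intro!: ennreal_leI power_mono)

lemma sq_norm_cmult:
  assumes [measurable]: "f \<in> borel_measurable borel"
  shows "sq_norm (\<lambda>z. c * f z) = ennreal ((norm c)^2) * sq_norm f"
  unfolding sq_norm_def
  by (subst nn_integral_cmult[symmetric]) (auto simp: norm_mult power_mult_distrib ennreal_mult)

lemma sq_norm_add:
  assumes [measurable]: "f \<in> borel_measurable borel" "g \<in> borel_measurable borel"
  shows "sq_norm (\<lambda>z. f z + g z) \<le> 2 * (sq_norm f + sq_norm g)"
proof -
  have "(norm (f z + g z))^2 \<le> 2 * ((norm (f z))^2 + (norm (g z))^2)" for z
  proof -
    have "(norm (f z + g z))^2 \<le> (norm (f z) + norm (g z))^2"
      by (intro power_mono norm_triangle_ineq) auto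
    also have "... \<le> 2 * ((norm (f z))^2 + (norm (g z))^2)"
      using sum_squares_bound[of "norm (f z)" "norm (g z)"] by (simp add: power2_sum)
    finally show ?thesis .
  qed
  then have "sq_norm (\<lambda>z. f z + g z) \<le> (\<integral>\<^sup>+z. ennreal 2 * (ennreal ((norm (f z))^2) + ennreal ((norm (g z))^2)) \<partial>lborel)"
    unfolding sq_norm_def
    by (intro nn_integral_mono) (subst ennreal_plus[symmetric], auto simp: ennreal_mult''[symmetric] intro!: ennreal_leI simp del: ennreal_plus ennreal_numeral)
  also have "... = ennreal 2 * (sq_norm f + sq_norm g)"
    unfolding sq_norm_def by (subst nn_integral_cmult) (auto simp: nn_integral_add distrib_left)
  finally show ?thesis by simp
qed

lemma sq_norm_diff:
  assumes "f \<in> borel_measurable borel" "g \<in> borel_measurable borel"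
  shows "sq_norm (\<lambda>z. f z - g z) \<le> 2 * (sq_norm f + sq_norm g)"
  using sq_norm_add[of f "\<lambda>z. - g z"] assms by (simp add: sq_norm_def)

lemma L2_mono:
  assumes "g \<in> L2" "f \<in> borel_measurable borel" "\<And>z. norm (f z) \<le> norm (g z)"
  shows "f \<in> L2"
  using assms sq_norm_mono[of f g] by (auto simp: L2_iff)

lemma L2_diff: "f \<in> L2 \<Longrightarrow> g \<in> L2 \<Longrightarrow> (\<lambda>z. f z - g z) \<in> L2"
  using sq_norm_diff[of f g] by (auto simp: L2_iff ennreal_mult_less_top intro: le_less_trans)

lemma L2_cmult: "f \<in> L2 \<Longrightarrow> (\<lambda>z. c * f z) \<in> L2"
  by (auto simp: L2_iff sq_norm_cmult ennreal_mult_less_top)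

lemma L2_cong_AE:
  "f \<in> L2 \<Longrightarrow> g \<in> borel_measurable borel \<Longrightarrow> AE z in lborel. f z = g z \<Longrightarrow> g \<in> L2"
  using sq_norm_cong_AE[of f g] by (auto simp: L2_iff)

lemma L2_indicator:
  assumes "S \<in> sets borel" "emeasure lborel S < \<infinity>"
  shows "(\<lambda>z. indicator S z) \<in> L2"
proof -
  have "sq_norm (\<lambda>z. indicator S z) = (\<integral>\<^sup>+ z. indicator S z \<partial>lborel)"
    unfolding sq_norm_def by (intro nn_integral_cong) (auto split: split_indicator)
  then show ?thesis using assms by (auto simp: L2_iff)
qed

lemma L2_mult_integrable:
  assumes f: "f \<in> L2" and g: "g \<in> L2"
  shows "integrable lborel (\<lambda>z. f z * g z)"
proof (rule Bochner_Integration.integrable_bound)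
  show "integrable lborel (\<lambda>z. (norm (f z))^2 + (norm (g z))^2)"
    using f g by (auto simp: L2_def)
  show "(\<lambda>z. f z * g z) \<in> borel_measurable lborel" using f g by (auto simp: L2_def)
  have "norm (f z) * norm (g z) \<le> (norm (f z))^2 + (norm (g z))^2" for z
    using sum_squares_bound[of "norm (f z)" "norm (g z)"]
      mult_nonneg_nonneg[OF norm_ge_zero[of "f z"] norm_ge_zero[of "g z"]] by linarith
  then show "AE z in lborel. norm (f z * g z) \<le> norm ((norm (f z))^2 + (norm (g z))^2)"
    by (auto simp: norm_mult)
qed

section \<open>The Cauchy-Schwarz inequality\<close>

text \<open>The weight \<open>t\<close> is left free so that it can later balance the two sides;
  being positive, it keeps the right-hand side infinite whenever an argument is.\<close>

lemma ennreal_AM_GM: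
  fixes a b :: ennreal
  assumes "0 < t"
  shows "2 * (a * b) \<le> ennreal t * a^2 + ennreal (1/t) * b^2"
proof (cases a; cases b)
  fix x y assume ab: "a = ennreal x" "0 \<le> x" "b = ennreal y" "0 \<le> y"
  have "t * x^2 + 1/t * y^2 - 2 * (x * y) = (t * x - y)^2 / t"
    using assms by (simp add: field_simps power2_eq_square)
  also have "... \<ge> 0" using assms by simp
  finally have "2 * (x * y) \<le> t * x^2 + 1/t * y^2" by simp
  then have "ennreal (2 * (x * y)) \<le> ennreal (t * x^2 + 1/t * y^2)" by (rule ennreal_leI)
  also have "ennreal (2 * (x * y)) = 2 * (a * b)"
    using ab by (simp add: ennreal_mult)
  also have "ennreal (t * x^2 + 1/t * y^2) = ennreal t * a^2 + ennreal (1/t) * b^2"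
    using ab assms by (simp add: ennreal_mult[symmetric] ennreal_power ennreal_plus[symmetric] del: ennreal_plus)
  finally show ?thesis .
qed (use assms in \<open>auto simp: power2_eq_square ennreal_mult_top ennreal_top_mult\<close>)

text \<open>The perturbation by \<^term>\<open>e\<close> avoids distinguishing whether one of the bounds vanishes.\<close>

lemma nn_integral_Cauchy_Schwarz:
  fixes f g :: "'a \<Rightarrow> ennreal"
  assumes [measurable]: "f \<in> borel_measurable M" "g \<in> borel_measurable M"
    and f: "(\<integral>\<^sup>+x. f x ^ 2 \<partial>M) \<le> ennreal (s^2)" and g: "(\<integral>\<^sup>+x. g x ^ 2 \<partial>M) \<le> ennreal (r^2)"
    and s: "0 \<le> s" and r: "0 \<le> r"
  shows "(\<integral>\<^sup>+x. f x * g x \<partial>M) \<le> ennreal (s * r)"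
proof -
  have *: "(\<integral>\<^sup>+x. f x * g x \<partial>M) \<le> ennreal ((s + e) * (r + e))" if e: "0 < e" for e :: real
  proof -
    \<comment> \<open>This weight makes \<open>t * (s + e)^2\<close> and
      \<open>1/t * (r + e)^2\<close> equal, hence their sum minimal.\<close>
    define t where "t = (r + e) / (s + e)"
    have t: "0 < t" using s r e by (simp add: t_def)
    have "2 * (\<integral>\<^sup>+x. f x * g x \<partial>M) = (\<integral>\<^sup>+x. 2 * (f x * g x) \<partial>M)"
      by (rule nn_integral_cmult[symmetric]) auto
    also have "... \<le> (\<integral>\<^sup>+x. ennreal t * f x ^ 2 + ennreal (1/t) * g x ^ 2 \<partial>M)"
      by (intro nn_integral_mono ennreal_AM_GM t)
    also have "... = ennreal t * (\<integral>\<^sup>+x. f x ^ 2 \<partial>M) + ennreal (1/t) * (\<integral>\<^sup>+x. g x ^ 2 \<partial>M)"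
      by (simp add: nn_integral_add nn_integral_cmult)
    also have "... \<le> ennreal t * ennreal (s^2) + ennreal (1/t) * ennreal (r^2)"
      by (intro add_mono mult_left_mono f g) auto
    also have "... \<le> ennreal t * ennreal ((s + e)^2) + ennreal (1/t) * ennreal ((r + e)^2)"
      using s r e by (intro add_mono mult_left_mono ennreal_leI power_mono) auto
    also have "... = ennreal (t * (s + e)^2 + 1/t * (r + e)^2)"
      using t by (simp add: ennreal_mult[symmetric] ennreal_plus[symmetric] del: ennreal_plus)
    also have "t * (s + e)^2 + 1/t * (r + e)^2 = 2 * ((s + e) * (r + e))"
      using s r e by (simp add: t_def power2_eq_square add_nonneg_pos)
    also have "ennreal (2 * ((s + e) * (r + e))) = 2 * ennreal ((s + e) * (r + e))"
      using s r e by (simp add: ennreal_mult)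
    finally show ?thesis
      by (subst (asm) ennreal_mult_le_mult_iff) auto
  qed
  have "((\<lambda>e. ennreal ((s + e) * (r + e))) \<longlongrightarrow> ennreal ((s + 0) * (r + 0))) (at_right 0)"
    by (intro tendsto_intros)
  then have "(\<integral>\<^sup>+x. f x * g x \<partial>M) \<le> ennreal ((s + 0) * (r + 0))"
    by (rule tendsto_lowerbound) (auto simp: eventually_at_right_less intro!: eventually_at_rightI[of 0 1] *)
  then show ?thesis by simp
qed

lemma integral_mult_bound:
  assumes f: "f \<in> L2" and g: "g \<in> L2"
  shows "norm (\<integral>z. f z * g z \<partial>lborel) \<le> L2_norm f * L2_norm g"
proof -
  have [measurable]: "f \<in> borel_measurable borel" "g \<in> borel_measurable borel"
    using f g by (auto simp: L2_iff)
  have "(\<integral>\<^sup>+z. ennreal (norm (f z)) * ennreal (norm (g z)) \<partial>lborel) \<le> ennreal (L2_norm f * L2_norm g)"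
    using sq_norm_eq_L2_norm[OF f] sq_norm_eq_L2_norm[OF g]
    by (intro nn_integral_Cauchy_Schwarz) (auto simp: sq_norm_def ennreal_power L2_norm_nonneg)
  moreover have "ennreal (norm (\<integral>z. f z * g z \<partial>lborel)) \<le> (\<integral>\<^sup>+z. ennreal (norm (f z * g z)) \<partial>lborel)"
    by (rule integral_norm_bound_ennreal[OF L2_mult_integrable[OF f g]])
  ultimately have "ennreal (norm (\<integral>z. f z * g z \<partial>lborel)) \<le> ennreal (L2_norm f * L2_norm g)"
    by (simp add: norm_mult ennreal_mult)
  then show ?thesis
    by (subst (asm) ennreal_le_iff) (auto simp: L2_norm_nonneg)
qed

text \<open>The complement of the support is a union of possibly uncountably many open sets. By the
  Lindelof property countably many of them already cover it, and countably many null sets can be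
  discarded.\<close>

lemma AE_zero_outside_ess_support: "AE z in lborel. z \<notin> ess_support f \<longrightarrow> f z = 0"
proof -
  define U where "U = {U. open U \<and> (AE z in lborel. z \<in> U \<longrightarrow> f z = 0)}"
  obtain V where V: "V \<subseteq> U" "countable V" "\<Union>V = \<Union>U"
    using Lindelof[of U] by (auto simp: U_def)
  have "AE z in lborel. \<forall>W\<in>V. z \<in> W \<longrightarrow> f z = 0"
    using V by (subst AE_ball_countable) (auto simp: U_def)
  then show ?thesis
    by eventually_elim (use V in \<open>auto simp: ess_support_def U_def[symmetric]\<close>)
qed

subsection \<open>Lebesgue measure under translation, reflection and dilation\<close>

lemma lborel_distr_diff:
  fixes t :: "'a::euclidean_space"
  shows "distr lborel borel (\<lambda>x. t - x) = lborel"
  by (subst lborel_affine[of "-1" t]) (auto simp: density_1)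

lemma nn_integral_lborel_diff:
  fixes f :: "'a::euclidean_space \<Rightarrow> ennreal"
  assumes "f \<in> borel_measurable borel"
  shows "(\<integral>\<^sup>+x. f (t - x) \<partial>lborel) = (\<integral>\<^sup>+x. f x \<partial>lborel)"
  using assms by (subst (2) lborel_distr_diff[of t, symmetric]) (simp add: nn_integral_distr)

lemma nn_integral_lborel_plus:
  fixes f :: "'a::euclidean_space \<Rightarrow> ennreal"
  assumes "f \<in> borel_measurable borel"
  shows "(\<integral>\<^sup>+x. f (t + x) \<partial>lborel) = (\<integral>\<^sup>+x. f x \<partial>lborel)"
  using assms by (subst (2) lborel_distr_plus[of t, symmetric]) (simp add: nn_integral_distr)

lemma nn_integral_lborel_uminus:
  fixes f :: "'a::euclidean_space \<Rightarrow> ennreal"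
  assumes "f \<in> borel_measurable borel"
  shows "(\<integral>\<^sup>+x. f (- x) \<partial>lborel) = (\<integral>\<^sup>+x. f x \<partial>lborel)"
  using nn_integral_lborel_diff[of f 0] assms by simp

lemma integral_lborel_diff:
  fixes f :: "'a::euclidean_space \<Rightarrow> 'b::{banach, second_countable_topology}"
  assumes "f \<in> borel_measurable borel"
  shows "(\<integral>x. f (t - x) \<partial>lborel) = (\<integral>x. f x \<partial>lborel)"
  using assms by (subst (2) lborel_distr_diff[of t, symmetric]) (simp add: integral_distr)

lemma integrable_lborel_plus:
  fixes f :: "'a::euclidean_space \<Rightarrow> 'b::{banach, second_countable_topology}"
  assumes "integrable lborel f"
  shows "integrable lborel (\<lambda>x. f (t + x))"
  using assms integrable_distr_eq[of "\<lambda>x. t + x" lborel borel f] by (auto simp: lborel_distr_plus)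

lemma integral_lborel_plus:
  fixes f :: "'a::euclidean_space \<Rightarrow> 'b::{banach, second_countable_topology}"
  assumes "f \<in> borel_measurable borel"
  shows "(\<integral>x. f (t + x) \<partial>lborel) = (\<integral>x. f x \<partial>lborel)"
  using assms by (subst (2) lborel_distr_plus[of t, symmetric]) (simp add: integral_distr)

lemma integral_lborel_scaleR:
  fixes f :: "'a::euclidean_space \<Rightarrow> 'b::{banach, second_countable_topology}"
  assumes [measurable]: "f \<in> borel_measurable borel" and c: "c > 0"
  shows "(\<integral>x. f (c *\<^sub>R x) \<partial>lborel) = (1 / c) ^ DIM('a) *\<^sub>R (\<integral>x. f x \<partial>lborel)"
proof -
  have "(\<integral>x. f x \<partial>lborel) = (\<integral>x. f x \<partial>density (distr lborel borel (\<lambda>x. 0 + c *\<^sub>R x)) (\<lambda>_. ennreal (\<bar>c\<bar>^DIM('a))))"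
    using c by (subst lborel_affine[of c 0]) (auto simp: ennreal_power)
  also have "... = c ^ DIM('a) *\<^sub>R (\<integral>x. f (c *\<^sub>R x) \<partial>lborel)"
    using c by (subst integral_density) (auto simp: integral_distr)
  finally show ?thesis using c by (simp add: power_one_over)
qed

section \<open>Gaussians\<close>

definition gauss :: "real \<Rightarrow> 'a::euclidean_space \<Rightarrow> real" where
  "gauss e z = exp (- (e\<^sup>2 * (z \<bullet> z)) / 2)"

lemma gauss_pos: "0 < gauss e z" and gauss_le_1: "gauss e z \<le> 1"
  by (auto simp: gauss_def)

lemma gauss_measurable [measurable]: "gauss e \<in> borel_measurable borel"
  unfolding gauss_def by measurable

lemma gauss_minus: "gauss e (- z) = gauss e z"
  by (simp add: gauss_def)

lemma gauss_scale: "gauss e z = gauss 1 (e *\<^sub>R z)"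
  by (simp add: gauss_def power2_eq_square mult.assoc)

lemma integrable_gauss_real:
  "integrable lborel (\<lambda>x::real. exp (- x\<^sup>2 / 2))"
proof -
  have "integrable lborel (\<lambda>x::real. sqrt (2 * pi) * std_normal_density x)"
    by (intro integrable_mult_right integrable_normal_density) auto
  then show ?thesis by (simp add: normal_density_def)
qed

lemma fourier_gauss_real:
  fixes y :: real
  shows "(\<integral>x. exp (- \<i> * complex_of_real (x * y)) * complex_of_real (exp (- x\<^sup>2 / 2)) \<partial>lborel)
    = complex_of_real (sqrt (2 * pi) * exp (- y\<^sup>2 / 2))"
proof -
  \<comment> \<open>\<open>char\<close> carries the opposite sign in the exponential, hence the
    evaluation at \<open>- y\<close>; the square absorbs the sign.\<close>
  have "complex_of_real (exp (- (- y)\<^sup>2 / 2)) = char std_normal_distribution (- y)"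
    by (simp add: char_std_normal_distribution)
  also have "... = (\<integral>x. std_normal_density x *\<^sub>R iexp (- y * x) \<partial>lborel)"
    unfolding char_def by (subst integral_density) auto
  also have "... = (\<integral>x. complex_of_real (1 / sqrt (2 * pi)) * (exp (- \<i> * complex_of_real (x * y)) * complex_of_real (exp (- x\<^sup>2 / 2))) \<partial>lborel)"
    by (intro Bochner_Integration.integral_cong refl)
       (auto simp: normal_density_def scaleR_conv_of_real mult_ac)
  also have "... = complex_of_real (1 / sqrt (2 * pi)) * (\<integral>x. exp (- \<i> * complex_of_real (x * y)) * complex_of_real (exp (- x\<^sup>2 / 2)) \<partial>lborel)"
    by (rule integral_mult_right_zero)
  finally have *: "complex_of_real (exp (- (- y)\<^sup>2 / 2)) = ..." .
  have "complex_of_real (sqrt (2 * pi)) \<noteq> 0" by simp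
  with * show ?thesis by (simp add: field_simps)
qed

text \<open>Lebesgue measure on a Euclidean space is the image of the product of one copy of
  \<open>lborel\<close> per basis vector, so integrals of tensor products factor. This reduces
  Gaussians to dimension one.\<close>

lemma integral_lborel_prod_Basis:
  fixes f :: "'a::euclidean_space \<Rightarrow> real \<Rightarrow> complex"
  assumes f: "\<And>b. b \<in> Basis \<Longrightarrow> integrable lborel (f b)"
  shows "(\<integral>x. (\<Prod>b\<in>Basis. f b (x \<bullet> b)) \<partial>lborel) = (\<Prod>b\<in>Basis. \<integral>x. f b x \<partial>lborel)"
    and "integrable lborel (\<lambda>x::'a. \<Prod>b\<in>Basis. f b (x \<bullet> b))"
proof -
  interpret product_sigma_finite "\<lambda>_::'a. lborel :: real measure" ..
  have [measurable]: "b \<in> Basis \<Longrightarrow> f b \<in> borel_measurable borel" for b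
    using f by (auto dest: borel_measurable_integrable)
  have inner: "(\<Sum>c\<in>Basis. x c *\<^sub>R c) \<bullet> b = x b" if "b \<in> Basis" for x :: "'a \<Rightarrow> real" and b
    using that by (simp add: inner_sum_left inner_Basis if_distrib sum.delta cong: if_cong)
  have "(\<integral>x. (\<Prod>b\<in>Basis. f b (x \<bullet> b)) \<partial>lborel) =
      (\<integral>x. (\<Prod>b\<in>Basis. f b ((\<Sum>c\<in>Basis. x c *\<^sub>R c) \<bullet> b)) \<partial>(\<Pi>\<^sub>M b\<in>(Basis::'a set). lborel))"
    by (subst lborel_eq, subst integral_distr) auto
  also have "... = (\<integral>x. (\<Prod>b\<in>Basis. f b (x b)) \<partial>(\<Pi>\<^sub>M b\<in>(Basis::'a set). lborel))"
    by (intro Bochner_Integration.integral_cong refl prod.cong) (simp add: inner)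
  also have "... = (\<Prod>b\<in>Basis. \<integral>x. f b x \<partial>lborel)"
    by (rule product_integral_prod) (use f in auto)
  finally show "(\<integral>x. (\<Prod>b\<in>Basis. f b (x \<bullet> b)) \<partial>lborel) = (\<Prod>b\<in>Basis. \<integral>x. f b x \<partial>lborel)" .
  have "integrable (\<Pi>\<^sub>M b\<in>(Basis::'a set). lborel) (\<lambda>x. \<Prod>b\<in>Basis. f b (x b))"
    by (rule product_integrable_prod) (use f in auto)
  also have "?this \<longleftrightarrow> integrable (\<Pi>\<^sub>M b\<in>(Basis::'a set). lborel) (\<lambda>x. \<Prod>b\<in>Basis. f b ((\<Sum>c\<in>Basis. x c *\<^sub>R c) \<bullet> b))"
    by (rule Bochner_Integration.integrable_cong) (auto simp: inner intro!: prod.cong)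
  also have "... \<longleftrightarrow> integrable lborel (\<lambda>x::'a. \<Prod>b\<in>Basis. f b (x \<bullet> b))"
    by (subst (2) lborel_eq, subst integrable_distr_eq) auto
  finally show "integrable lborel (\<lambda>x::'a. \<Prod>b\<in>Basis. f b (x \<bullet> b))" .
qed

lemma exp_gauss_prod:
  fixes z y :: "'a::euclidean_space"
  shows "exp (- \<i> * complex_of_real (z \<bullet> y)) * complex_of_real (gauss 1 z) =
    (\<Prod>b\<in>Basis. exp (- \<i> * complex_of_real ((z \<bullet> b) * (y \<bullet> b))) * complex_of_real (exp (- (z \<bullet> b)\<^sup>2 / 2)))"
  unfolding gauss_def
  by (subst (1 2) euclidean_inner)
     (simp add: prod.distrib exp_sum[symmetric] sum_negf sum_divide_distrib sum_distrib_left
        power2_eq_square flip: of_real_prod)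

lemma integrable_fourier_kernel:
  fixes u :: "'a::euclidean_space \<Rightarrow> complex"
  assumes "integrable lborel u"
  shows "integrable lborel (\<lambda>z. exp (- \<i> * complex_of_real (z \<bullet> \<zeta>)) * u z)"
  by (rule Bochner_Integration.integrable_bound[OF assms])
     (use assms in \<open>auto simp: norm_mult dest: borel_measurable_integrable\<close>)

lemma integrable_gauss_1:
  "integrable lborel (\<lambda>z::'a::euclidean_space. complex_of_real (gauss 1 z))"
proof -
  have "integrable lborel (\<lambda>z::'a. \<Prod>b\<in>Basis. exp (- \<i> * complex_of_real ((z \<bullet> b) * (0 \<bullet> b))) * complex_of_real (exp (- (z \<bullet> b)\<^sup>2 / 2)))"
    by (rule integral_lborel_prod_Basis)
       (use integrable_gauss_real[THEN integrable_of_real[where 'a=complex]] in simp)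
  then show ?thesis unfolding exp_gauss_prod[symmetric] by simp
qed

lemma fourier_gauss_1:
  "fourier_integral (\<lambda>z. complex_of_real (gauss 1 z)) \<zeta> =
    complex_of_real (sqrt (2 * pi) ^ DIM('a) * gauss 1 (\<zeta>::'a::euclidean_space))"
proof -
  have "fourier_integral (\<lambda>z. complex_of_real (gauss 1 z)) \<zeta> =
     (\<Prod>b\<in>Basis. \<integral>x. exp (- \<i> * complex_of_real (x * (\<zeta> \<bullet> b))) * complex_of_real (exp (- x\<^sup>2 / 2)) \<partial>lborel)"
    unfolding fourier_integral_def exp_gauss_prod
  proof (rule integral_lborel_prod_Basis)
    fix b
    show "integrable lborel (\<lambda>x. exp (- \<i> * complex_of_real (x * (\<zeta> \<bullet> b))) * complex_of_real (exp (- x\<^sup>2 / 2)))"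
      using integrable_fourier_kernel[OF integrable_of_real[OF integrable_gauss_real], of "\<zeta> \<bullet> b"] by simp
  qed
  also have "... = complex_of_real (\<Prod>b\<in>Basis. (sqrt (2 * pi) * exp (- (\<zeta> \<bullet> b)\<^sup>2 / 2)))"
    by (simp only: fourier_gauss_real of_real_prod)
  also have "(\<Prod>b\<in>Basis. (sqrt (2 * pi) * exp (- (\<zeta> \<bullet> b)\<^sup>2 / 2))) = sqrt (2 * pi) ^ DIM('a) * gauss 1 \<zeta>"
    unfolding gauss_def
    by (subst euclidean_inner) (simp add: prod.distrib exp_sum[symmetric] sum_negf sum_divide_distrib power2_eq_square)
  finally show ?thesis .
qed

lemma integrable_gauss:
  assumes "0 < e"
  shows "integrable lborel (\<lambda>z::'a::euclidean_space. gauss e z)"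
proof -
  have "integrable lborel (\<lambda>z::'a. gauss 1 z)"
    using integrable_gauss_1 integrable_norm[of lborel "\<lambda>z::'a. complex_of_real (gauss 1 z)"]
    by (simp add: gauss_pos less_imp_le)
  also have "?this \<longleftrightarrow> integrable (density (distr lborel borel (\<lambda>x. 0 + e *\<^sub>R x)) (\<lambda>_. ennreal (\<bar>e\<bar>^DIM('a)))) (\<lambda>z::'a. gauss 1 z)"
    using assms by (subst (1) lborel_affine[of e 0]) (auto simp: ennreal_power)
  also have "... \<longleftrightarrow> integrable lborel (\<lambda>z::'a. gauss 1 (e *\<^sub>R z))"
    using assms by (subst integrable_density) (auto simp: integrable_distr_eq)
  finally show ?thesis by (simp add: gauss_scale[symmetric])
qed

lemma L2_bounded_integrable:
  assumes f: "integrable lborel f" and B: "\<And>z. norm (f z) \<le> B"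
  shows "f \<in> L2"
proof -
  have "integrable lborel (\<lambda>z. (norm (f z))\<^sup>2)"
  proof (rule Bochner_Integration.integrable_bound)
    show "integrable lborel (\<lambda>z. B * norm (f z))" using f by auto
    show "AE z in lborel. norm ((norm (f z))\<^sup>2) \<le> norm (B * norm (f z))"
      using B norm_ge_zero order_trans[OF norm_ge_zero B]
      by (auto simp: power2_eq_square abs_mult intro!: mult_right_mono)
  qed (use f in \<open>auto dest: borel_measurable_integrable\<close>)
  then show ?thesis using f by (auto simp: L2_def dest: borel_measurable_integrable)
qed

definition gauss_shift :: "real \<Rightarrow> 'a::euclidean_space \<Rightarrow> 'a \<Rightarrow> complex" where
  "gauss_shift e y z = complex_of_real (gauss e (z - y))"

text \<open>Closed form of the Fourier transform of \<open>gauss_shift e y\<close>: translation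
  becomes modulation and the width is inverted.\<close>

definition gauss_hat :: "real \<Rightarrow> 'a::euclidean_space \<Rightarrow> 'a \<Rightarrow> complex" where
  "gauss_hat e y \<zeta> = exp (- \<i> * complex_of_real (\<zeta> \<bullet> y)) *
     complex_of_real ((sqrt (2 * pi) / e) ^ DIM('a) * gauss (1 / e) \<zeta>)"

lemma integrable_gauss_shift:
  assumes "0 < e" shows "integrable lborel (gauss_shift e y)"
  using integrable_lborel_plus[OF integrable_gauss[OF assms], of "- y", THEN integrable_of_real[where 'a=complex]]
  by (simp add: gauss_shift_def[abs_def])

lemma gauss_shift_L2:
  assumes "0 < e" shows "gauss_shift e y \<in> L2"
  by (rule L2_bounded_integrable[OF integrable_gauss_shift[OF assms], of _ 1])
     (auto simp: gauss_shift_def gauss_le_1 gauss_pos less_imp_le)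

lemma integrable_gauss_hat:
  assumes "0 < e" shows "integrable lborel (gauss_hat e y)"
proof -
  have "integrable lborel (\<lambda>\<zeta>. exp (- \<i> * complex_of_real (\<zeta> \<bullet> y)) *
     complex_of_real ((sqrt (2 * pi) / e) ^ DIM('a) * gauss (1 / e) \<zeta>))"
    using assms by (intro integrable_fourier_kernel integrable_of_real integrable_mult_right integrable_gauss) auto
  then show ?thesis unfolding gauss_hat_def[abs_def] .
qed

lemma gauss_hat_L2:
  fixes y :: "'a::euclidean_space"
  assumes "0 < e" shows "gauss_hat e y \<in> L2"
  by (rule L2_bounded_integrable[OF integrable_gauss_hat[OF assms], of _ "(sqrt (2 * pi) / e) ^ DIM('a)"])
     (use assms in \<open>auto simp: gauss_hat_def norm_mult norm_power norm_divide gauss_le_1 gauss_pos less_imp_le intro!: mult_left_le\<close>)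

lemma fourier_gauss_shift:
  fixes y :: "'a::euclidean_space"
  assumes e: "0 < e"
  shows "fourier_integral (gauss_shift e y) = gauss_hat e y"
proof
  fix \<zeta> :: 'a
  have cancel: "(e *\<^sub>R x) \<bullet> (\<zeta> /\<^sub>R e) = x \<bullet> \<zeta>" for x
    using e by simp
  have "fourier_integral (gauss_shift e y) \<zeta> =
      (\<integral>x. exp (- \<i> * complex_of_real ((y + x) \<bullet> \<zeta>)) * complex_of_real (gauss e ((y + x) - y)) \<partial>lborel)"
    unfolding fourier_integral_def gauss_shift_def
    by (rule integral_lborel_plus[symmetric]) measurable
  also have "... = (\<integral>x. exp (- \<i> * complex_of_real (\<zeta> \<bullet> y)) *
      (exp (- \<i> * complex_of_real ((e *\<^sub>R x) \<bullet> (\<zeta> /\<^sub>R e))) * complex_of_real (gauss 1 (e *\<^sub>R x))) \<partial>lborel)"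
    using e by (intro Bochner_Integration.integral_cong refl)
      (simp add: cancel inner_add_left gauss_scale[symmetric] exp_add[symmetric] inner_commute algebra_simps
         del: inner_scaleR_left inner_scaleR_right)
  also have "... = exp (- \<i> * complex_of_real (\<zeta> \<bullet> y)) *
      (\<integral>x. exp (- \<i> * complex_of_real ((e *\<^sub>R x) \<bullet> (\<zeta> /\<^sub>R e))) * complex_of_real (gauss 1 (e *\<^sub>R x)) \<partial>lborel)"
    by (rule integral_mult_right_zero)
  also have "(\<integral>x. exp (- \<i> * complex_of_real ((e *\<^sub>R x) \<bullet> (\<zeta> /\<^sub>R e))) * complex_of_real (gauss 1 (e *\<^sub>R x)) \<partial>lborel)
     = (1 / e) ^ DIM('a) *\<^sub>R fourier_integral (\<lambda>z. complex_of_real (gauss 1 z)) (\<zeta> /\<^sub>R e)"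
    unfolding fourier_integral_def by (rule integral_lborel_scaleR) (use e in measurable)
  also have "... = complex_of_real ((sqrt (2 * pi) / e) ^ DIM('a) * gauss (1 / e) \<zeta>)"
    unfolding fourier_gauss_1 using gauss_scale[of "1 / e" \<zeta>]
    by (simp add: scaleR_conv_of_real power_divide inverse_eq_divide)
  finally show "fourier_integral (gauss_shift e y) \<zeta> = gauss_hat e y \<zeta>"
    by (simp add: gauss_hat_def)
qed

text \<open>Inversion for the one family where it can be verified directly: modulation by
  \<open>y\<close> shifts the argument, and the normalisations \<open>sqrt (2 * pi) / e\<close> and
  \<open>sqrt (2 * pi) * e\<close> multiply to \<open>2 * pi\<close>. The general inversion formula
  follows from this by duality.\<close>

lemma fourier_gauss_hat:
  fixes y :: "'a::euclidean_space"
  assumes e: "0 < e"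
  shows "fourier_integral (gauss_hat e y) = (\<lambda>z. (2 * pi) ^ DIM('a) * gauss_shift e (- y) z)"
proof
  fix z :: 'a
  let ?C = "complex_of_real ((sqrt (2 * pi) / e) ^ DIM('a))"
  have "fourier_integral (gauss_hat e y) z =
      (\<integral>x. ?C * (exp (- \<i> * complex_of_real (x \<bullet> (z + y))) * gauss_shift (1 / e) 0 x) \<partial>lborel)"
    unfolding fourier_integral_def
    by (intro Bochner_Integration.integral_cong refl)
       (simp add: gauss_hat_def gauss_shift_def inner_add_right exp_add[symmetric] algebra_simps)
  also have "... = ?C * fourier_integral (gauss_shift (1 / e) 0) (z + y)"
    unfolding fourier_integral_def by (rule integral_mult_right_zero)
  also have "... = ?C * complex_of_real ((sqrt (2 * pi) * e) ^ DIM('a) * gauss e (z + y))"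
    using e by (subst fourier_gauss_shift) (auto simp: gauss_hat_def)
  also have "... = complex_of_real (((sqrt (2 * pi) / e) * (sqrt (2 * pi) * e)) ^ DIM('a) * gauss e (z + y))"
    by (simp only: of_real_mult power_mult_distrib mult.assoc)
  also have "(sqrt (2 * pi) / e) * (sqrt (2 * pi) * e) = 2 * pi"
    using e by simp
  finally show "fourier_integral (gauss_hat e y) z = (2 * pi) ^ DIM('a) * gauss_shift e (- y) z"
    by (simp add: gauss_shift_def)
qed

section \<open>The Fourier transform of square integrable functions\<close>

lemma norm_integral_le_nn_integral:
  fixes f :: "'a \<Rightarrow> 'b::{banach, second_countable_topology}"
  shows "ennreal (norm (\<integral>x. f x \<partial>M)) \<le> (\<integral>\<^sup>+x. ennreal (norm (f x)) \<partial>M)"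
  by (cases "integrable M f") (auto intro: integral_norm_bound_ennreal simp: not_integrable_integral_eq)

lemma ennreal_mult_left_le_imp_le:
  fixes a b c :: ennreal
  assumes "c * a \<le> c * b" "c \<noteq> 0" "c \<noteq> top"
  shows "a \<le> b"
  using assms by (simp add: ennreal_mult_le_mult_iff)

lemma cnj_measurable [measurable]: "cnj \<in> borel_measurable borel"
  by (intro borel_measurable_continuous_onI continuous_intros)

lemma gauss_hat_measurable [measurable]: "gauss_hat e y \<in> borel_measurable borel"
  unfolding gauss_hat_def[abs_def] by measurable

lemma fourier_integral_measurable [measurable]:
  assumes [measurable]: "u \<in> borel_measurable borel"
  shows "fourier_integral u \<in> borel_measurable borel"
  unfolding fourier_integral_def[abs_def] by measurable

lemma norm_fourier_integral_le:
  "norm (fourier_integral u \<zeta>) \<le> (\<integral>z. norm (u z) \<partial>lborel)"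
  unfolding fourier_integral_def by (rule order_trans[OF integral_norm_bound]) (simp add: norm_mult)

lemma fourier_integral_diff:
  assumes "integrable lborel u" "integrable lborel w"
  shows "fourier_integral (\<lambda>z. u z - w z) \<zeta> = fourier_integral u \<zeta> - fourier_integral w \<zeta>"
  unfolding fourier_integral_def right_diff_distrib
  using assms by (intro Bochner_Integration.integral_diff integrable_fourier_kernel)

lemma integrable_lborel_pair_mult:
  fixes f :: "'a::euclidean_space \<Rightarrow> complex" and g :: "'b::euclidean_space \<Rightarrow> complex"
  assumes f: "integrable lborel f" and g: "integrable lborel g"
  shows "integrable (lborel \<Otimes>\<^sub>M lborel) (\<lambda>(x, y). f x * g y)"
proof (rule lborel_pair.Fubini_integrable)
  have [measurable]: "f \<in> borel_measurable borel" "g \<in> borel_measurable borel"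
    using f g by (auto dest: borel_measurable_integrable)
  show "(\<lambda>(x, y). f x * g y) \<in> borel_measurable (lborel \<Otimes>\<^sub>M lborel)"
    by measurable
  show "integrable lborel (\<lambda>x. \<integral>y. norm (case (x, y) of (x, y) \<Rightarrow> f x * g y) \<partial>lborel)"
    using f by (simp add: norm_mult)
  show "AE x in lborel. integrable lborel (\<lambda>y. case (x, y) of (x, y) \<Rightarrow> f x * g y)"
    using g by simp
qed

text \<open>Fubini, together with the symmetry of the kernel in \<open>z\<close> and \<zeta>. This
  multiplication formula lets every pairing of a transform with a Gaussian be computed on the other
  side.\<close>

lemma fourier_integral_mult:
  assumes f: "integrable lborel f" and g: "integrable lborel g"
  shows "(\<integral>\<zeta>. fourier_integral f \<zeta> * g \<zeta> \<partial>lborel) = (\<integral>z. f z * fourier_integral g z \<partial>lborel)"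
proof -
  have [measurable]: "f \<in> borel_measurable borel" "g \<in> borel_measurable borel"
    using f g by (auto dest: borel_measurable_integrable)
  have int: "integrable (lborel \<Otimes>\<^sub>M lborel) (\<lambda>(z, \<zeta>). exp (- \<i> * complex_of_real (z \<bullet> \<zeta>)) * f z * g \<zeta>)"
    by (rule Bochner_Integration.integrable_bound[OF integrable_lborel_pair_mult[OF f g]])
       (auto simp: norm_mult split_beta)
  have "(\<integral>\<zeta>. fourier_integral f \<zeta> * g \<zeta> \<partial>lborel) =
      (\<integral>\<zeta>. \<integral>z. exp (- \<i> * complex_of_real (z \<bullet> \<zeta>)) * f z * g \<zeta> \<partial>lborel \<partial>lborel)"
    unfolding fourier_integral_def by simp
  also have "... = (\<integral>z. \<integral>\<zeta>. exp (- \<i> * complex_of_real (z \<bullet> \<zeta>)) * f z * g \<zeta> \<partial>lborel \<partial>lborel)"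
    by (rule lborel_pair.Fubini_integral[OF int])
  also have "... = (\<integral>z. f z * fourier_integral g z \<partial>lborel)"
    unfolding fourier_integral_def
    by (subst integral_mult_right_zero[symmetric]) (simp add: mult_ac inner_commute)
  finally show ?thesis .
qed

lemma nn_integral_gauss:
  assumes e: "0 < e"
  shows "(\<integral>\<^sup>+(z::'a::euclidean_space). ennreal (gauss e z) \<partial>lborel) = ennreal ((sqrt (2 * pi) / e) ^ DIM('a))"
proof -
  have "complex_of_real (\<integral>(z::'a). gauss e z \<partial>lborel) = fourier_integral (gauss_shift e 0) (0::'a)"
    unfolding fourier_integral_def gauss_shift_def by simp
  also have "... = complex_of_real ((sqrt (2 * pi) / e) ^ DIM('a))"
    unfolding fourier_gauss_shift[OF e] by (simp add: gauss_hat_def gauss_def)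
  finally have "(\<integral>(z::'a). gauss e z \<partial>lborel) = (sqrt (2 * pi) / e) ^ DIM('a)"
    by (simp only: of_real_eq_iff)
  then show ?thesis
    using integrable_gauss[OF e] by (subst nn_integral_eq_integral) (auto simp: gauss_pos less_imp_le)
qed

section \<open>Bessel's inequality for integrable functions\<close>

text \<open>Schur's test: once the product of the moduli is replaced by half the sum of their
  squares, the kernel integrates to the same constant in either variable.\<close>

lemma gauss_form_bound:
  fixes u :: "'a::euclidean_space \<Rightarrow> complex"
  assumes [measurable]: "u \<in> borel_measurable borel" and e: "0 < e"
  shows "(\<integral>\<^sup>+z. \<integral>\<^sup>+y. ennreal (norm (u z)) * ennreal (norm (u y)) * ennreal (gauss e (y - z)) \<partial>lborel \<partial>lborel)
    \<le> ennreal ((sqrt (2 * pi) / e) ^ DIM('a)) * sq_norm u"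
proof -
  define a where "a z = ennreal (norm (u z))" for z
  define G where "G z = ennreal (gauss e z)" for z :: 'a
  let ?C = "ennreal ((sqrt (2 * pi) / e) ^ DIM('a))"
  have [measurable]: "a \<in> borel_measurable borel" "G \<in> borel_measurable borel"
    unfolding a_def[abs_def] G_def[abs_def] by measurable
  have G: "(\<integral>\<^sup>+y. G (y - z) \<partial>lborel) = ?C" "(\<integral>\<^sup>+z. G (y - z) \<partial>lborel) = ?C" for y z
    using nn_integral_lborel_plus[of G "- z"] nn_integral_lborel_diff[of G y] nn_integral_gauss[OF e, where 'a='a]
    by (auto simp: G_def[symmetric])
  have S: "(\<integral>\<^sup>+z. a z ^ 2 \<partial>lborel) = sq_norm u"
    unfolding sq_norm_def a_def by (simp add: ennreal_power)
  have "2 * (\<integral>\<^sup>+z. \<integral>\<^sup>+y. a z * a y * G (y - z) \<partial>lborel \<partial>lborel) =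
      (\<integral>\<^sup>+z. \<integral>\<^sup>+y. 2 * (a z * a y) * G (y - z) \<partial>lborel \<partial>lborel)"
    by (simp add: nn_integral_cmult mult.assoc)
  also have "... \<le> (\<integral>\<^sup>+z. \<integral>\<^sup>+y. (a z ^ 2 + a y ^ 2) * G (y - z) \<partial>lborel \<partial>lborel)"
    using ennreal_AM_GM[of 1] by (intro nn_integral_mono mult_right_mono) auto
  also have "... = (\<integral>\<^sup>+z. \<integral>\<^sup>+y. a z ^ 2 * G (y - z) \<partial>lborel \<partial>lborel) + (\<integral>\<^sup>+z. \<integral>\<^sup>+y. a y ^ 2 * G (y - z) \<partial>lborel \<partial>lborel)"
    by (simp add: distrib_right nn_integral_add)
  also have "(\<integral>\<^sup>+z. \<integral>\<^sup>+y. a z ^ 2 * G (y - z) \<partial>lborel \<partial>lborel) = ?C * sq_norm u"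
    by (simp add: nn_integral_cmult nn_integral_multc G S mult.commute)
  also have "(\<integral>\<^sup>+z. \<integral>\<^sup>+y. a y ^ 2 * G (y - z) \<partial>lborel \<partial>lborel) = (\<integral>\<^sup>+y. \<integral>\<^sup>+z. a y ^ 2 * G (y - z) \<partial>lborel \<partial>lborel)"
    by (rule lborel_pair.Fubini') measurable
  also have "... = ?C * sq_norm u"
    by (simp add: nn_integral_cmult nn_integral_multc G S mult.commute)
  also have "?C * sq_norm u + ?C * sq_norm u = 2 * (?C * sq_norm u)"
    by (rule mult_2[symmetric])
  finally show ?thesis
    unfolding a_def G_def by (rule ennreal_mult_left_le_imp_le) auto
qed

text \<open>The transform of an integrable function is a priori only bounded; the Gaussian weight
  secures absolute convergence. The multiplication formula rewrites the weighted integral as a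
  quadratic form in \<open>u\<close> with a Gaussian kernel. The normalisation of the weight and the
  mass of the kernel are the same number \<open>C\<close> and cancel, so the bound is uniform in
  \<open>e\<close>.\<close>

lemma bessel_gauss:
  fixes u :: "'a::euclidean_space \<Rightarrow> complex"
  assumes u: "integrable lborel u" and e: "0 < e"
  shows "(\<integral>\<^sup>+\<zeta>. ennreal ((norm (fourier_integral u \<zeta>))^2 * gauss (1 / e) \<zeta>) \<partial>lborel)
    \<le> ennreal ((2 * pi) ^ DIM('a)) * sq_norm u"
proof -
  have [measurable]: "u \<in> borel_measurable borel" using u by (auto dest: borel_measurable_integrable)
  define C where "C = (sqrt (2 * pi) / e) ^ DIM('a)"
  have C: "0 < C" using e by (simp add: C_def)
  \<comment> \<open>Chosen so that \<open>fourier_integral u \<zeta> * g \<zeta>\<close> is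
    \<open>C\<close> times the weighted integrand, while \<open>g\<close> stays integrable.\<close>
  define g where "g \<zeta> = cnj (fourier_integral u \<zeta>) * gauss_hat e 0 \<zeta>" for \<zeta> :: 'a
  let ?B = "\<integral>z. norm (u z) \<partial>lborel"
  have g: "integrable lborel g"
  proof (rule Bochner_Integration.integrable_bound)
    show "integrable lborel (\<lambda>\<zeta>::'a. complex_of_real ?B * gauss_hat e 0 \<zeta>)"
      by (intro integrable_mult_right integrable_gauss_hat e)
    show "g \<in> borel_measurable lborel"
      unfolding g_def[abs_def] by measurable
    show "AE \<zeta> in lborel. norm (g \<zeta>) \<le> norm (complex_of_real ?B * gauss_hat e 0 \<zeta>)"
      by (auto simp: g_def norm_mult intro!: mult_right_mono norm_fourier_integral_le
            order_trans[OF norm_fourier_integral_le])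
  qed
  have Fg: "fourier_integral g z = cnj (\<integral>y. u y * ((2 * pi) ^ DIM('a) * gauss_shift e z y) \<partial>lborel)" for z
  proof -
    \<comment> \<open>The exponential of the outer transform is absorbed as a modulation of the
      Gaussian; after the multiplication formula it becomes a shift of the centre to
      \<open>z\<close>.\<close>
    have "fourier_integral g z = (\<integral>\<zeta>. cnj (fourier_integral u \<zeta> * gauss_hat e (- z) \<zeta>) \<partial>lborel)"
      unfolding fourier_integral_def[of g]
      by (intro Bochner_Integration.integral_cong refl)
         (simp add: g_def gauss_hat_def exp_cnj)
    also have "... = cnj (\<integral>\<zeta>. fourier_integral u \<zeta> * gauss_hat e (- z) \<zeta> \<partial>lborel)"
      by (rule integral_bounded_linear'[OF bounded_linear_cnj bounded_linear_cnj]) simp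
    also have "(\<integral>\<zeta>. fourier_integral u \<zeta> * gauss_hat e (- z) \<zeta> \<partial>lborel) = (\<integral>y. u y * fourier_integral (gauss_hat e (- z)) y \<partial>lborel)"
      by (rule fourier_integral_mult[OF u integrable_gauss_hat[OF e]])
    finally show ?thesis by (simp add: fourier_gauss_hat[OF e])
  qed
  have pull: "(\<integral>\<^sup>+z. ennreal (norm (u z)) * (\<integral>\<^sup>+y. K * (ennreal (norm (u y)) * ennreal (gauss e (y - z))) \<partial>lborel) \<partial>lborel)
     = K * (\<integral>\<^sup>+z. \<integral>\<^sup>+y. ennreal (norm (u z)) * ennreal (norm (u y)) * ennreal (gauss e (y - z)) \<partial>lborel \<partial>lborel)" for K
    by (simp add: nn_integral_cmult mult.assoc mult.left_commute[of _ K])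
  have "integrable lborel (\<lambda>\<zeta>. fourier_integral u \<zeta> * g \<zeta>)"
  proof (rule Bochner_Integration.integrable_bound)
    show "integrable lborel (\<lambda>\<zeta>. complex_of_real ?B * g \<zeta>)" using g by simp
    show "AE \<zeta> in lborel. norm (fourier_integral u \<zeta> * g \<zeta>) \<le> norm (complex_of_real ?B * g \<zeta>)"
      by (auto simp: norm_mult intro!: mult_right_mono order_trans[OF norm_fourier_integral_le])
  qed (use g in \<open>auto dest: borel_measurable_integrable\<close>)
  moreover have eq: "fourier_integral u \<zeta> * g \<zeta> = complex_of_real (C * ((norm (fourier_integral u \<zeta>))^2 * gauss (1 / e) \<zeta>))" for \<zeta>
    by (simp add: g_def gauss_hat_def C_def complex_norm_square mult_ac del: of_real_power)
  ultimately have int: "integrable lborel (\<lambda>\<zeta>. C * ((norm (fourier_integral u \<zeta>))^2 * gauss (1 / e) \<zeta>))"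
    by (simp only: eq complex_of_real_integrable_eq)
  have "ennreal C * (\<integral>\<^sup>+\<zeta>. ennreal ((norm (fourier_integral u \<zeta>))^2 * gauss (1 / e) \<zeta>) \<partial>lborel)
     = (\<integral>\<^sup>+\<zeta>. ennreal (C * ((norm (fourier_integral u \<zeta>))^2 * gauss (1 / e) \<zeta>)) \<partial>lborel)"
    using C by (subst nn_integral_cmult[symmetric]) (auto simp: ennreal_mult gauss_pos less_imp_le)
  also have "... = ennreal (\<integral>\<zeta>. C * ((norm (fourier_integral u \<zeta>))^2 * gauss (1 / e) \<zeta>) \<partial>lborel)"
    using C by (intro nn_integral_eq_integral int) (auto simp: gauss_pos less_imp_le)
  also have "... = ennreal (norm (complex_of_real (\<integral>\<zeta>. C * ((norm (fourier_integral u \<zeta>))^2 * gauss (1 / e) \<zeta>) \<partial>lborel)))"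
    using C by (subst norm_of_real, subst abs_of_nonneg) (auto intro!: integral_nonneg mult_nonneg_nonneg simp: gauss_pos less_imp_le)
  also have "complex_of_real (\<integral>\<zeta>. C * ((norm (fourier_integral u \<zeta>))^2 * gauss (1 / e) \<zeta>) \<partial>lborel) = (\<integral>\<zeta>. fourier_integral u \<zeta> * g \<zeta> \<partial>lborel)"
    unfolding eq by (rule integral_complex_of_real[symmetric])
  also have "... = (\<integral>z. u z * fourier_integral g z \<partial>lborel)"
    by (rule fourier_integral_mult[OF u g])
  also have "ennreal (norm ...) \<le> (\<integral>\<^sup>+z. ennreal (norm (u z * fourier_integral g z)) \<partial>lborel)"
    by (rule norm_integral_le_nn_integral)
  also have "... \<le> (\<integral>\<^sup>+z. ennreal (norm (u z)) * (\<integral>\<^sup>+y. ennreal ((2 * pi) ^ DIM('a)) * (ennreal (norm (u y)) * ennreal (gauss e (y - z))) \<partial>lborel) \<partial>lborel)"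
  proof (intro nn_integral_mono)
    fix z
    have "ennreal (norm (fourier_integral g z)) \<le> (\<integral>\<^sup>+y. ennreal (norm (u y * ((2 * pi) ^ DIM('a) * gauss_shift e z y))) \<partial>lborel)"
      unfolding Fg complex_mod_cnj by (rule norm_integral_le_nn_integral)
    also have "... = (\<integral>\<^sup>+y. ennreal ((2 * pi) ^ DIM('a)) * (ennreal (norm (u y)) * ennreal (gauss e (y - z))) \<partial>lborel)"
      by (intro nn_integral_cong)
         (simp add: gauss_shift_def norm_mult norm_power ennreal_mult[symmetric] gauss_pos less_imp_le mult_ac)
    finally show "ennreal (norm (u z * fourier_integral g z)) \<le> ennreal (norm (u z)) * ..."
      by (simp add: norm_mult ennreal_mult mult_left_mono)
  qed
  also have "... = ennreal ((2 * pi) ^ DIM('a)) * (\<integral>\<^sup>+z. \<integral>\<^sup>+y. ennreal (norm (u z)) * ennreal (norm (u y)) * ennreal (gauss e (y - z)) \<partial>lborel \<partial>lborel)"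
    by (rule pull)
  also have "... \<le> ennreal ((2 * pi) ^ DIM('a)) * (ennreal C * sq_norm u)"
    unfolding C_def by (intro mult_left_mono gauss_form_bound e) auto
  also have "... = ennreal C * (ennreal ((2 * pi) ^ DIM('a)) * sq_norm u)"
    by (simp add: mult_ac)
  finally show ?thesis
    by (rule ennreal_mult_left_le_imp_le) (use C in auto)
qed

text \<open>The weight in \<open>bessel_gauss\<close> increases to 1 as \<open>e\<close> tends to
  infinity while the bound there does not depend on \<open>e\<close>; monotone convergence removes
  the weight.\<close>

lemma bessel:
  fixes u :: "'a::euclidean_space \<Rightarrow> complex"
  assumes u: "integrable lborel u"
  shows "sq_norm (fourier_integral u) \<le> ennreal ((2 * pi) ^ DIM('a)) * sq_norm u"
proof -
  have [measurable]: "u \<in> borel_measurable borel" using u by (auto dest: borel_measurable_integrable)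
  define f where "f n \<zeta> = ennreal ((norm (fourier_integral u \<zeta>))^2 * gauss (1 / (real n + 1)) \<zeta>)" for n and \<zeta> :: 'a
  have "(\<lambda>n. \<integral>\<^sup>+\<zeta>. f n \<zeta> \<partial>lborel) \<longlonglongrightarrow> (\<integral>\<^sup>+\<zeta>. ennreal ((norm (fourier_integral u \<zeta>))^2) \<partial>lborel)"
  proof (rule nn_integral_LIMSEQ)
    show "incseq f"
    proof (intro incseq_SucI le_funI)
      fix n and \<zeta> :: 'a
      have "(1 / (real (Suc n) + 1))^2 \<le> (1 / (real n + 1))^2"
        by (intro power_mono) (auto simp: field_simps)
      then have "gauss (1 / (real n + 1)) \<zeta> \<le> gauss (1 / (real (Suc n) + 1)) \<zeta>"
        unfolding gauss_def exp_le_cancel_iff by (intro divide_right_mono le_imp_neg_le mult_right_mono) auto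
      then show "f n \<zeta> \<le> f (Suc n) \<zeta>"
        unfolding f_def by (intro ennreal_leI mult_left_mono) auto
    qed
    show "f n \<in> borel_measurable lborel" for n unfolding f_def[abs_def] by measurable
    show "(\<lambda>n. f n \<zeta>) \<longlonglongrightarrow> ennreal ((norm (fourier_integral u \<zeta>))^2)" for \<zeta>
    proof -
      have "(\<lambda>n. 1 / (real n + 1)) \<longlonglongrightarrow> 0"
        using LIMSEQ_inverse_real_of_nat by (simp add: inverse_eq_divide add.commute)
      then have "(\<lambda>n. (norm (fourier_integral u \<zeta>))^2 * gauss (1 / (real n + 1)) \<zeta>) \<longlonglongrightarrow> (norm (fourier_integral u \<zeta>))^2 * exp (- (0^2 * (\<zeta> \<bullet> \<zeta>)) / 2)"
        unfolding gauss_def by (intro tendsto_intros) auto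
      then show ?thesis unfolding f_def by (intro tendsto_ennrealI) simp
    qed
  qed
  moreover have "(\<integral>\<^sup>+\<zeta>. f n \<zeta> \<partial>lborel) \<le> ennreal ((2 * pi) ^ DIM('a)) * sq_norm u" for n
    unfolding f_def by (rule bessel_gauss[OF u]) simp
  ultimately show ?thesis
    unfolding sq_norm_def[of "fourier_integral u"] by (intro LIMSEQ_le_const2) auto
qed

lemma fourier_integral_L2:
  assumes "integrable lborel u" "u \<in> L2"
  shows "fourier_integral u \<in> L2"
  using bessel[OF assms(1)] assms
  by (auto simp: L2_iff ennreal_mult_less_top intro: le_less_trans)

section \<open>Completeness and existence of the transform\<close>

lemma L2_complete:
  fixes f :: "nat \<Rightarrow> 'a::euclidean_space \<Rightarrow> complex"
  assumes f: "\<And>n. f n \<in> L2"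
    and Cauchy: "\<And>e. 0 < e \<Longrightarrow> \<exists>N. \<forall>m\<ge>N. \<forall>n\<ge>N. sq_norm (\<lambda>z. f m z - f n z) \<le> ennreal e"
  shows "\<exists>v\<in>L2. (\<lambda>n. sq_norm (\<lambda>z. f n z - v z)) \<longlonglongrightarrow> 0"
proof -
  have [measurable]: "f n \<in> borel_measurable borel" for n using f by (simp add: L2_iff)
  have "\<forall>k. \<exists>N. \<forall>m\<ge>N. \<forall>n\<ge>N. sq_norm (\<lambda>z. f m z - f n z) \<le> ennreal ((1/4) ^ k)"
    using Cauchy by simp
  then obtain N where N: "\<And>k m n. N k \<le> m \<Longrightarrow> N k \<le> n \<Longrightarrow> sq_norm (\<lambda>z. f m z - f n z) \<le> ennreal ((1/4) ^ k)"
    by metis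
  \<comment> \<open>Summing the indices makes \<open>r\<close> nondecreasing and at the same time at
    least \<open>N k\<close> and at least \<open>k\<close>.\<close>
  define r where "r k = (\<Sum>i\<le>k. N i) + k" for k
  have rN: "N k \<le> r k" "k \<le> r k" and r_Suc: "r k \<le> r (Suc k)" for k
    by (auto simp: r_def member_le_sum trans_le_add1)
  define d where "d k z = f (r (Suc k)) z - f (r k) z" for k z
  have [measurable]: "d k \<in> borel_measurable borel" for k
    unfolding d_def[abs_def] by measurable
  have d: "sq_norm (d k) \<le> ennreal ((1/4) ^ k)" for k
    unfolding d_def[abs_def] by (rule N) (use rN(1)[of k] r_Suc[of k] in auto)
  have "(\<integral>\<^sup>+z. (\<Sum>k. ennreal (2 ^ k * (norm (d k z))^2)) \<partial>lborel) = (\<Sum>k. \<integral>\<^sup>+z. ennreal (2 ^ k * (norm (d k z))^2) \<partial>lborel)"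
    by (rule nn_integral_suminf) measurable
  \<comment> \<open>The weight \<open>2 ^ k\<close> is affordable since the squared norms decay like
    \<open>(1/4) ^ k\<close>; it is there to yield absolute summability of the increments at almost
    every point.\<close>
  also have "... \<le> (\<Sum>k. ennreal ((1/2) ^ k))"
  proof (intro suminf_le allI summableI)
    fix k
    have "(\<integral>\<^sup>+z. ennreal (2 ^ k * (norm (d k z))^2) \<partial>lborel) = ennreal (2 ^ k) * sq_norm (d k)"
      unfolding sq_norm_def by (subst nn_integral_cmult[symmetric]) (auto simp: ennreal_mult)
    also have "... \<le> ennreal (2 ^ k) * ennreal ((1/4) ^ k)"
      by (intro mult_left_mono d) auto
    also have "... = ennreal ((1/2) ^ k)"
      by (simp add: ennreal_mult[symmetric] power_mult_distrib[symmetric] del: power_mult_distrib)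
    finally show "(\<integral>\<^sup>+z. ennreal (2 ^ k * (norm (d k z))^2) \<partial>lborel) \<le> ennreal ((1/2) ^ k)" .
  qed
  also have "... < \<infinity>"
    by (subst suminf_ennreal2) (auto simp: summable_geometric)
  finally have "(\<integral>\<^sup>+z. (\<Sum>k. ennreal (2 ^ k * (norm (d k z))^2)) \<partial>lborel) \<noteq> \<infinity>" by simp
  then have "AE z in lborel. (\<Sum>k. ennreal (2 ^ k * (norm (d k z))^2)) \<noteq> \<infinity>"
    by (intro nn_integral_PInf_AE) auto
  then have conv: "AE z in lborel. convergent (\<lambda>k. f (r k) z)"
  proof eventually_elim
    fix z assume "(\<Sum>k. ennreal (2 ^ k * (norm (d k z))^2)) \<noteq> \<infinity>"
    then have "summable (\<lambda>k. 2 ^ k * (norm (d k z))^2)"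
      by (intro summable_suminf_not_top) auto
    then have "summable (\<lambda>k. (1/2) ^ k + 2 ^ k * (norm (d k z))^2)"
      by (intro summable_add) (auto simp: summable_geometric)
    moreover have "norm (norm (d k z)) \<le> (1/2) ^ k + 2 ^ k * (norm (d k z))^2" for k
    proof -
      \<comment> \<open>This square bounds \<open>2 * norm (d k z)\<close> by a geometric term plus
        the weighted square of the increment.\<close>
      have "0 \<le> (1/2) ^ k * (1 - 2 ^ k * norm (d k z))^2" by simp
      also have "... = (1/2) ^ k + 2 ^ k * (norm (d k z))^2 - 2 * norm (d k z)"
        by (simp add: power2_diff power_mult_distrib power_one_over field_simps power2_eq_square)
      finally show ?thesis using norm_ge_zero[of "d k z"]
        unfolding real_norm_def abs_norm_cancel by linarith
    qed
    ultimately have "summable (\<lambda>k. norm (d k z))"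
      by (rule summable_comparison_test') 
    then have "summable (\<lambda>k. d k z)" by (rule summable_norm_cancel)
    then have "convergent (\<lambda>n. \<Sum>k<n. d k z)" by (simp add: summable_iff_convergent)
    then have "convergent (\<lambda>n. (f (r n) z - f (r 0) z) + f (r 0) z)"
      by (intro convergent_add convergent_const) (simp add: d_def sum_lessThan_telescope[of "\<lambda>n. f (r n) z"])
    then show "convergent (\<lambda>n. f (r n) z)" by simp
  qed
  define v where "v z = lim (\<lambda>k. f (r k) z)" for z
  have [measurable]: "v \<in> borel_measurable borel"
    unfolding v_def[abs_def] by measurable
  have lim: "AE z in lborel. (\<lambda>k. f (r k) z) \<longlonglongrightarrow> v z"
    using conv by eventually_elim (simp add: v_def convergent_LIMSEQ_iff)
  have bound: "sq_norm (\<lambda>z. f n z - v z) \<le> ennreal e"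
    if M: "\<forall>m\<ge>M. \<forall>n\<ge>M. sq_norm (\<lambda>z. f m z - f n z) \<le> ennreal e" and n: "M \<le> n" for M n e
  proof -
    \<comment> \<open>Fatou's lemma carries the Cauchy bound to the limit: only the subsequence
      converges pointwise, but every late \<open>f n\<close> is close to it in norm.\<close>
    have "sq_norm (\<lambda>z. f n z - v z) = (\<integral>\<^sup>+z. liminf (\<lambda>k. ennreal ((norm (f n z - f (r k) z))^2)) \<partial>lborel)"
      unfolding sq_norm_def
    proof (rule nn_integral_cong_AE, use lim in eventually_elim)
      fix z assume "(\<lambda>k. f (r k) z) \<longlonglongrightarrow> v z"
      then have "(\<lambda>k. ennreal ((norm (f n z - f (r k) z))^2)) \<longlonglongrightarrow> ennreal ((norm (f n z - v z))^2)"
        by (intro tendsto_intros tendsto_ennrealI)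
      then show "ennreal ((norm (f n z - v z))^2) = liminf (\<lambda>k. ennreal ((norm (f n z - f (r k) z))^2))"
        by (intro lim_imp_Liminf[symmetric]) auto
    qed
    also have "... \<le> liminf (\<lambda>k. sq_norm (\<lambda>z. f n z - f (r k) z))"
      unfolding sq_norm_def by (rule nn_integral_liminf) measurable
    also have "... \<le> ennreal e"
    proof (rule Liminf_le[OF trivial_limit_sequentially], rule eventually_sequentiallyI[of M])
      fix k assume "M \<le> k"
      then show "sq_norm (\<lambda>z. f n z - f (r k) z) \<le> ennreal e"
        using M n rN(2)[of k] by auto
    qed
    finally show ?thesis .
  qed
  obtain M where M: "\<forall>m\<ge>M. \<forall>n\<ge>M. sq_norm (\<lambda>z. f m z - f n z) \<le> ennreal 1"
    using Cauchy[of 1] by auto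
  have "(\<lambda>z. f M z - v z) \<in> L2"
    using le_less_trans[OF bound[OF M order_refl] ennreal_less_top] by (simp add: L2_iff)
  then have "v \<in> L2"
    using L2_diff[OF f[of M], of "\<lambda>z. f M z - v z"] by simp
  moreover have "(\<lambda>n. sq_norm (\<lambda>z. f n z - v z)) \<longlonglongrightarrow> 0"
  proof (rule order_tendstoI)
    fix e :: ennreal assume "0 < e"
    then obtain d where d: "0 < d" "d < e" using dense by blast
    then obtain e' where e': "0 < ennreal e'" "ennreal e' < e"
      by (cases d) auto
    then have "0 < e'" by simp
    then obtain M where "\<forall>m\<ge>M. \<forall>n\<ge>M. sq_norm (\<lambda>z. f m z - f n z) \<le> ennreal e'"
      using Cauchy by blast
    then show "\<forall>\<^sub>F n in sequentially. sq_norm (\<lambda>z. f n z - v z) < e"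
      using bound e' by (intro eventually_sequentiallyI[of M]) (blast intro: le_less_trans)
  qed simp
  ultimately show ?thesis by blast
qed

definition truncate :: "nat \<Rightarrow> ('a::euclidean_space \<Rightarrow> complex) \<Rightarrow> 'a \<Rightarrow> complex" where
  "truncate n u z = indicator (cball 0 (real n)) z * u z"

lemma truncate_measurable [measurable]:
  "u \<in> borel_measurable borel \<Longrightarrow> truncate n u \<in> borel_measurable borel"
  unfolding truncate_def[abs_def] by (intro borel_measurable_times borel_measurable_indicator) auto

lemma truncate_L2: "u \<in> L2 \<Longrightarrow> truncate n u \<in> L2"
  by (rule L2_mono[of u]) (auto simp: L2_iff truncate_def split: split_indicator)

lemma truncate_integrable:
  assumes "u \<in> L2" shows "integrable lborel (truncate n u)"
  unfolding truncate_def[abs_def]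
  by (intro L2_mult_integrable assms L2_indicator) (use emeasure_lborel_cball_finite in auto)

lemma truncate_LIMSEQ: "(\<lambda>n. truncate n u z) \<longlonglongrightarrow> u z"
proof (rule tendsto_eventually)
  obtain N where "norm z \<le> real N" using real_arch_simple by blast
  then show "\<forall>\<^sub>F n in sequentially. truncate n u z = u z"
    by (intro eventually_sequentiallyI[of N]) (auto simp: truncate_def)
qed

lemma sq_norm_truncate:
  assumes u: "u \<in> L2"
  shows "(\<lambda>n. sq_norm (\<lambda>z. u z - truncate n u z)) \<longlonglongrightarrow> 0"
proof -
  have [measurable]: "u \<in> borel_measurable borel" using u by (simp add: L2_iff)
  have "(\<lambda>n. \<integral>\<^sup>+z. ennreal ((norm (u z - truncate n u z))^2) \<partial>lborel) \<longlonglongrightarrow> (\<integral>\<^sup>+(z::'a). 0 \<partial>lborel)"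
  proof (rule nn_integral_dominated_convergence[where w="\<lambda>z. ennreal ((norm (u z))^2)"])
    show "AE z in lborel. (\<lambda>n. ennreal ((norm (u z - truncate n u z))^2)) \<longlonglongrightarrow> 0"
    proof (rule AE_I2)
      fix z
      have "(\<lambda>n. (norm (u z - truncate n u z))^2) \<longlonglongrightarrow> (norm (u z - u z))^2"
        by (intro tendsto_intros truncate_LIMSEQ)
      then show "(\<lambda>n. ennreal ((norm (u z - truncate n u z))^2)) \<longlonglongrightarrow> 0"
        by (simp add: ennreal_tendsto_0_iff)
    qed
    show "AE z in lborel. ennreal ((norm (u z - truncate n u z))^2) \<le> ennreal ((norm (u z))^2)" for n
      by (auto simp: truncate_def split: split_indicator)
    show "(\<integral>\<^sup>+z. ennreal ((norm (u z))^2) \<partial>lborel) < \<infinity>"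
      using u by (simp add: L2_iff sq_norm_def)
  qed measurable
  then show ?thesis by (simp add: sq_norm_def)
qed

lemma has_fourier_L2_iff:
  "has_fourier_L2 u v \<longleftrightarrow> u \<in> L2 \<and> v \<in> L2 \<and>
     (\<lambda>n. sq_norm (\<lambda>\<zeta>. fourier_integral (truncate n u) \<zeta> - v \<zeta>)) \<longlonglongrightarrow> 0"
  unfolding has_fourier_L2_def sq_norm_def truncate_def[abs_def] by simp

text \<open>Bessel's inequality, applied to differences of truncations, bounds the distance between
  their transforms by the tails of \<open>u\<close>; completeness supplies the limit.\<close>

lemma fourier_L2_exists:
  fixes u :: "'a::euclidean_space \<Rightarrow> complex"
  assumes u: "u \<in> L2"
  shows "\<exists>v. has_fourier_L2 u v"
proof -
  have [measurable]: "u \<in> borel_measurable borel" using u by (simp add: L2_iff)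
  let ?c = "(2 * pi) ^ DIM('a)"
  define T where "T n = sq_norm (\<lambda>z. u z - truncate n u z)" for n
  have le: "sq_norm (\<lambda>\<zeta>. fourier_integral (truncate m u) \<zeta> - fourier_integral (truncate n u) \<zeta>)
      \<le> ennreal ?c * (2 * (T m + T n))" for m n
  proof -
    have "sq_norm (\<lambda>\<zeta>. fourier_integral (truncate m u) \<zeta> - fourier_integral (truncate n u) \<zeta>)
       = sq_norm (fourier_integral (\<lambda>z. truncate m u z - truncate n u z))"
      by (rule arg_cong[where f=sq_norm]) (auto simp: fun_eq_iff fourier_integral_diff truncate_integrable u)
    also have "... \<le> ennreal ?c * sq_norm (\<lambda>z. truncate m u z - truncate n u z)"
      by (intro bessel Bochner_Integration.integrable_diff truncate_integrable u)
    also have "sq_norm (\<lambda>z. truncate m u z - truncate n u z)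
        = sq_norm (\<lambda>z. (u z - truncate n u z) - (u z - truncate m u z))"
      by simp
    also have "... \<le> 2 * (T n + T m)" unfolding T_def by (rule sq_norm_diff) auto
    finally show ?thesis by (simp add: add.commute mult_left_mono)
  qed
  have "\<exists>v\<in>L2. (\<lambda>n. sq_norm (\<lambda>\<zeta>. fourier_integral (truncate n u) \<zeta> - v \<zeta>)) \<longlonglongrightarrow> 0"
  proof (rule L2_complete)
    show "fourier_integral (truncate n u) \<in> L2" for n
      by (intro fourier_integral_L2 truncate_integrable truncate_L2 u)
    fix e :: real assume e: "0 < e"
    have "(\<lambda>n. T n) \<longlonglongrightarrow> 0" unfolding T_def by (rule sq_norm_truncate[OF u])
    then have "\<forall>\<^sub>F n in sequentially. T n < ennreal (e / (4 * ?c))"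
      by (rule order_tendstoD) (use e in auto)
    \<comment> \<open>The 4 is the factor 2 of \<open>sq_norm_diff\<close> times the two tails;
      dividing by \<open>?c\<close> compensates the Bessel constant.\<close>
    then obtain N where N: "\<And>n. N \<le> n \<Longrightarrow> T n < ennreal (e / (4 * ?c))"
      by (auto simp: eventually_sequentially)
    have "sq_norm (\<lambda>\<zeta>. fourier_integral (truncate m u) \<zeta> - fourier_integral (truncate n u) \<zeta>) \<le> ennreal e"
      if "N \<le> m" "N \<le> n" for m n
    proof -
      have "ennreal ?c * (2 * (T m + T n)) \<le> ennreal ?c * (2 * (ennreal (e / (4 * ?c)) + ennreal (e / (4 * ?c))))"
        using N[OF that(1)] N[OF that(2)] by (intro mult_left_mono add_mono) auto
      also have "... = ennreal ?c * (ennreal 2 * ennreal (e / (4 * ?c) + e / (4 * ?c)))"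
        using e by (subst ennreal_plus) auto
      also have "... = ennreal (?c * (2 * (e / (4 * ?c) + e / (4 * ?c))))"
        using e by (subst ennreal_mult, simp, simp, subst ennreal_mult) auto
      also have "?c * (2 * (e / (4 * ?c) + e / (4 * ?c))) = e"
        by (simp add: field_simps)
      finally show ?thesis using le[of m n] by (rule order_trans[rotated])
    qed
    then show "\<exists>N. \<forall>m\<ge>N. \<forall>n\<ge>N. sq_norm (\<lambda>z. fourier_integral (truncate m u) z - fourier_integral (truncate n u) z) \<le> ennreal e"
      by blast
  qed
  then show ?thesis using u by (auto simp: has_fourier_L2_iff)
qed

lemma L2_norm_tendsto_0:
  assumes f: "\<And>n. f n \<in> L2" and lim: "(\<lambda>n. sq_norm (f n)) \<longlonglongrightarrow> 0"
  shows "(\<lambda>n. L2_norm (f n)) \<longlonglongrightarrow> 0"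
proof -
  have "(\<lambda>n. ennreal ((L2_norm (f n))^2)) \<longlonglongrightarrow> 0"
    using lim by (simp add: sq_norm_eq_L2_norm f)
  then have "(\<lambda>n. (L2_norm (f n))^2) \<longlonglongrightarrow> 0" by (simp add: ennreal_tendsto_0_iff)
  then have "(\<lambda>n. sqrt ((L2_norm (f n))^2)) \<longlonglongrightarrow> sqrt 0" by (rule tendsto_real_sqrt)
  then show ?thesis by (simp add: L2_norm_nonneg)
qed

text \<open>Both sides pass to the limit over truncations, the left by convergence in mean, the
  right by dominated convergence. Taking \<open>g\<close> in L1 and L2 makes its transform a genuine
  integral that is again square integrable.\<close>

lemma fourier_L2_mult:
  assumes uv: "has_fourier_L2 u v" and g: "integrable lborel g" "g \<in> L2"
  shows "(\<integral>\<zeta>. v \<zeta> * g \<zeta> \<partial>lborel) = (\<integral>z. u z * fourier_integral g z \<partial>lborel)"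
proof -
  have u: "u \<in> L2" and v: "v \<in> L2"
    and lim: "(\<lambda>n. sq_norm (\<lambda>\<zeta>. fourier_integral (truncate n u) \<zeta> - v \<zeta>)) \<longlonglongrightarrow> 0"
    using uv by (auto simp: has_fourier_L2_iff)
  have [measurable]: "u \<in> borel_measurable borel" using u by (simp add: L2_iff)
  have Fg: "fourier_integral g \<in> L2" using g by (rule fourier_integral_L2)
  have [measurable]: "fourier_integral g \<in> borel_measurable borel" using Fg by (simp add: L2_iff)
  define F where "F n = fourier_integral (truncate n u)" for n
  have F: "F n \<in> L2" for n
    unfolding F_def by (intro fourier_integral_L2 truncate_integrable truncate_L2 u)
  have lim0: "(\<lambda>n. L2_norm (\<lambda>\<zeta>. F n \<zeta> - v \<zeta>) * L2_norm g) \<longlonglongrightarrow> 0"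
    by (intro tendsto_mult_left_zero L2_norm_tendsto_0 L2_diff F v) (use lim in \<open>simp add: F_def\<close>)
  have "(\<lambda>n. (\<integral>\<zeta>. F n \<zeta> * g \<zeta> \<partial>lborel) - (\<integral>\<zeta>. v \<zeta> * g \<zeta> \<partial>lborel)) \<longlonglongrightarrow> 0"
  proof (rule tendsto_0_le[OF lim0, where K=1], intro always_eventually allI)
    fix n
    have "(\<integral>\<zeta>. F n \<zeta> * g \<zeta> \<partial>lborel) - (\<integral>\<zeta>. v \<zeta> * g \<zeta> \<partial>lborel) = (\<integral>\<zeta>. (F n \<zeta> - v \<zeta>) * g \<zeta> \<partial>lborel)"
      unfolding left_diff_distrib
      by (rule Bochner_Integration.integral_diff[symmetric]) (intro L2_mult_integrable F v g)+
    then show "norm ((\<integral>\<zeta>. F n \<zeta> * g \<zeta> \<partial>lborel) - (\<integral>\<zeta>. v \<zeta> * g \<zeta> \<partial>lborel))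
        \<le> norm (L2_norm (\<lambda>\<zeta>. F n \<zeta> - v \<zeta>) * L2_norm g) * 1"
      using integral_mult_bound[OF L2_diff[OF F[of n] v] g(2)] by (simp add: abs_mult L2_norm_nonneg)
  qed
  then have "(\<lambda>n. \<integral>\<zeta>. F n \<zeta> * g \<zeta> \<partial>lborel) \<longlonglongrightarrow> (\<integral>\<zeta>. v \<zeta> * g \<zeta> \<partial>lborel)"
    by (simp add: LIM_zero_iff)
  moreover have "(\<integral>\<zeta>. F n \<zeta> * g \<zeta> \<partial>lborel) = (\<integral>z. truncate n u z * fourier_integral g z \<partial>lborel)" for n
    unfolding F_def by (rule fourier_integral_mult[OF truncate_integrable[OF u] g(1)])
  moreover have "(\<lambda>n. \<integral>z. truncate n u z * fourier_integral g z \<partial>lborel) \<longlonglongrightarrow> (\<integral>z. u z * fourier_integral g z \<partial>lborel)"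
  proof (rule integral_dominated_convergence[where w="\<lambda>z. norm (u z * fourier_integral g z)"])
    show "integrable lborel (\<lambda>z. norm (u z * fourier_integral g z))"
      by (intro integrable_norm L2_mult_integrable u Fg)
    show "AE z in lborel. (\<lambda>n. truncate n u z * fourier_integral g z) \<longlonglongrightarrow> u z * fourier_integral g z"
      by (intro AE_I2 tendsto_intros truncate_LIMSEQ)
    show "AE z in lborel. norm (truncate n u z * fourier_integral g z) \<le> norm (u z * fourier_integral g z)" for n
      by (auto simp: truncate_def norm_mult split: split_indicator)
  qed measurable
  ultimately show ?thesis by (auto intro: LIMSEQ_unique)
qed

lemma L2_reflect: "f \<in> L2 \<Longrightarrow> (\<lambda>z. f (- z)) \<in> L2"
  using nn_integral_lborel_uminus[of "\<lambda>z. ennreal ((norm (f z))^2)"]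
  by (auto simp: L2_iff sq_norm_def)

lemma sq_norm_reflect:
  "f \<in> borel_measurable borel \<Longrightarrow> sq_norm (\<lambda>z. f (- z)) = sq_norm f"
  unfolding sq_norm_def by (rule nn_integral_lborel_uminus[of "\<lambda>z. ennreal ((norm (f z))^2)"]) measurable

lemma L2_compact_support:
  fixes \<phi> :: "'a::euclidean_space \<Rightarrow> complex"
  assumes [measurable]: "\<phi> \<in> borel_measurable borel" and B: "\<And>z. norm (\<phi> z) \<le> B"
    and R: "\<And>z. R < norm z \<Longrightarrow> \<phi> z = 0"
  shows "\<phi> \<in> L2" "integrable lborel \<phi>"
proof -
  have B0: "0 \<le> B" using order_trans[OF norm_ge_zero B] .
  have fin: "emeasure lborel (cball (0::'a) R) < \<infinity>" by (rule emeasure_lborel_cball_finite)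
  have le: "norm (\<phi> z) \<le> norm (complex_of_real B * indicator (cball 0 R) z)" for z
    using B[of z] R[of z] B0 by (auto simp: norm_mult split: split_indicator)
  show \<phi>: "\<phi> \<in> L2"
    by (rule L2_mono[OF L2_cmult[OF L2_indicator] _ le]) (use fin in auto)
  have "integrable lborel (\<lambda>z. \<phi> z * indicator (cball 0 R) z)"
    using fin by (intro L2_mult_integrable \<phi> L2_indicator) auto
  also have "(\<lambda>z. \<phi> z * indicator (cball 0 R) z) = \<phi>"
    using R by (auto simp: fun_eq_iff split: split_indicator)
  finally show "integrable lborel \<phi>" .
qed

section \<open>Gaussians determine square integrable functions\<close>

text \<open>Licence for Fubini: the pairing of \<open>w\<close> with a translate of \<open>f\<close>
  is bounded uniformly in the translation, which leaves only the integrable factor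
  \<open>g\<close>.\<close>

lemma integrable_pair_shift:
  fixes w f g :: "'a::euclidean_space \<Rightarrow> complex"
  assumes w: "w \<in> L2" and f: "f \<in> L2" and g: "integrable lborel g"
  shows "integrable (lborel \<Otimes>\<^sub>M lborel) (\<lambda>(x, y). w x * f (x - y) * g y)"
proof (rule integrableI_bounded)
  have [measurable]: "w \<in> borel_measurable borel" "f \<in> borel_measurable borel" "g \<in> borel_measurable borel"
    using w f g by (auto simp: L2_iff dest: borel_measurable_integrable)
  show meas: "(\<lambda>(x, y). w x * f (x - y) * g y) \<in> borel_measurable (lborel \<Otimes>\<^sub>M lborel)"
    by measurable
  have wf: "(\<integral>\<^sup>+x. ennreal (norm (w x)) * ennreal (norm (f (x - y))) \<partial>lborel) \<le> sq_norm w + sq_norm f" for y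
  proof -
    have "(\<integral>\<^sup>+x. ennreal (norm (w x)) * ennreal (norm (f (x - y))) \<partial>lborel)
       \<le> (\<integral>\<^sup>+x. ennreal ((norm (w x))^2) + ennreal ((norm (f (- y + x)))^2) \<partial>lborel)"
    proof (rule nn_integral_mono)
      fix x
      have "norm (w x) * norm (f (x - y)) \<le> (norm (w x))^2 + (norm (f (x - y)))^2"
        using sum_squares_bound[of "norm (w x)" "norm (f (x - y))"]
          mult_nonneg_nonneg[OF norm_ge_zero[of "w x"] norm_ge_zero[of "f (x - y)"]] by linarith
      then show "ennreal (norm (w x)) * ennreal (norm (f (x - y))) \<le> ennreal ((norm (w x))^2) + ennreal ((norm (f (- y + x)))^2)"
        by (simp add: ennreal_mult[symmetric] ennreal_plus[symmetric] del: ennreal_plus)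
    qed
    also have "... = sq_norm w + (\<integral>\<^sup>+x. ennreal ((norm (f (- y + x)))^2) \<partial>lborel)"
      unfolding sq_norm_def by (rule nn_integral_add) measurable
    also have "(\<integral>\<^sup>+x. ennreal ((norm (f (- y + x)))^2) \<partial>lborel) = sq_norm f"
      unfolding sq_norm_def by (rule nn_integral_lborel_plus[of "\<lambda>x. ennreal ((norm (f x))^2)"]) measurable
    finally show ?thesis .
  qed
  have "(\<integral>\<^sup>+z. ennreal (norm (case z of (x, y) \<Rightarrow> w x * f (x - y) * g y)) \<partial>(lborel \<Otimes>\<^sub>M lborel))
     = (\<integral>\<^sup>+y. \<integral>\<^sup>+x. ennreal (norm (w x * f (x - y) * g y)) \<partial>lborel \<partial>lborel)"
    by (subst lborel_pair.nn_integral_snd[symmetric]) auto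
  also have "... = (\<integral>\<^sup>+y. (\<integral>\<^sup>+x. ennreal (norm (w x)) * ennreal (norm (f (x - y))) \<partial>lborel) * ennreal (norm (g y)) \<partial>lborel)"
    by (simp add: norm_mult ennreal_mult nn_integral_multc)
  also have "... \<le> (\<integral>\<^sup>+y. (sq_norm w + sq_norm f) * ennreal (norm (g y)) \<partial>lborel)"
    by (intro nn_integral_mono mult_right_mono wf) auto
  also have "... = (sq_norm w + sq_norm f) * (\<integral>\<^sup>+y. ennreal (norm (g y)) \<partial>lborel)"
    by (rule nn_integral_cmult) measurable
  also have "... < \<infinity>"
    using w f g by (auto simp: L2_iff integrable_iff_bounded ennreal_mult_less_top)
  finally show "(\<integral>\<^sup>+z. ennreal (norm (case z of (x, y) \<Rightarrow> w x * f (x - y) * g y)) \<partial>(lborel \<Otimes>\<^sub>M lborel)) < \<infinity>" .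
qed

lemma gauss_shift_measurable [measurable]: "gauss_shift e y \<in> borel_measurable borel"
  unfolding gauss_shift_def[abs_def] by measurable

lemma gauss_shift_symmetric: "gauss_shift e y x = gauss_shift e 0 (x - y)"
  by (simp add: gauss_shift_def)

text \<open>The Gaussians form an approximate identity, so testing against all of their translates is as
  good as testing against continuous functions of compact support.\<close>

lemma gauss_orthogonal_compact_support:
  fixes w \<phi> :: "'a::euclidean_space \<Rightarrow> complex"
  assumes w: "w \<in> L2" and orth: "\<And>e y. 0 < e \<Longrightarrow> (\<integral>z. w z * gauss_shift e y z \<partial>lborel) = 0"
    and cont: "continuous_on UNIV \<phi>" and B: "\<And>z. norm (\<phi> z) \<le> B" and R: "\<And>z. R < norm z \<Longrightarrow> \<phi> z = 0"
  shows "(\<integral>z. w z * \<phi> z \<partial>lborel) = 0"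
proof -
  have [measurable]: "w \<in> borel_measurable borel" using w by (simp add: L2_iff)
  have [measurable]: "\<phi> \<in> borel_measurable borel" using cont by (rule borel_measurable_continuous_onI)
  note \<phi> = L2_compact_support[of \<phi>, OF _ B R]
  have \<phi>L2: "\<phi> \<in> L2" and \<phi>int: "integrable lborel \<phi>" by (auto intro: \<phi>)
  \<comment> \<open>\<open>\<psi> 0\<close> is the integral sought. The average of \<psi> against
    every centred Gaussian vanishes, and concentrating the Gaussian recovers
    \<open>\<psi> 0\<close>.\<close>
  define \<psi> where "\<psi> h = (\<integral>x. w x * \<phi> (x - h) \<partial>lborel)" for h
  have \<phi>shift: "(\<lambda>x. \<phi> (x - h)) \<in> L2" for h
    using \<phi>L2 nn_integral_lborel_plus[of "\<lambda>x. ennreal ((norm (\<phi> x))^2)" "- h"]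
    by (auto simp: L2_iff sq_norm_def)
  have \<psi>_bound: "norm (\<psi> h) \<le> L2_norm w * L2_norm \<phi>" for h
  proof -
    have "L2_norm (\<lambda>x. \<phi> (x - h)) = L2_norm \<phi>"
      unfolding L2_norm_def using integral_lborel_plus[of "\<lambda>x. (norm (\<phi> x))^2" "- h"] by simp
    then show ?thesis unfolding \<psi>_def using integral_mult_bound[OF w \<phi>shift[of h]] by simp
  qed
  have \<psi>_meas [measurable]: "\<psi> \<in> borel_measurable borel"
    unfolding \<psi>_def[abs_def] by measurable
  have conv0: "(\<integral>k. gauss_shift e 0 k * \<psi> k \<partial>lborel) = 0" if e: "0 < e" for e
  proof -
    have "(\<integral>k. gauss_shift e 0 k * \<psi> k \<partial>lborel) = (\<integral>k. \<integral>x. w x * \<phi> (x - k) * gauss_shift e 0 k \<partial>lborel \<partial>lborel)"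
      unfolding \<psi>_def by (subst integral_mult_right_zero[symmetric]) (simp add: mult_ac)
    also have "... = (\<integral>x. \<integral>k. w x * \<phi> (x - k) * gauss_shift e 0 k \<partial>lborel \<partial>lborel)"
      by (rule lborel_pair.Fubini_integral) (rule integrable_pair_shift[OF w \<phi>L2 integrable_gauss_shift[OF e]])
    also have "... = (\<integral>x. \<integral>y. w x * gauss_shift e 0 (x - y) * \<phi> y \<partial>lborel \<partial>lborel)"
    proof (rule Bochner_Integration.integral_cong[OF refl])
      fix x
      show "(\<integral>k. w x * \<phi> (x - k) * gauss_shift e 0 k \<partial>lborel) = (\<integral>y. w x * gauss_shift e 0 (x - y) * \<phi> y \<partial>lborel)"
        using integral_lborel_diff[of "\<lambda>k. w x * \<phi> (x - k) * gauss_shift e 0 k" x] by (simp add: mult_ac)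
    qed
    also have "... = (\<integral>y. \<integral>x. w x * gauss_shift e 0 (x - y) * \<phi> y \<partial>lborel \<partial>lborel)"
      by (rule lborel_pair.Fubini_integral[symmetric]) (rule integrable_pair_shift[OF w gauss_shift_L2[OF e] \<phi>int])
    also have "... = 0" by (simp add: orth[OF e] flip: gauss_shift_symmetric)
    finally show ?thesis .
  qed
  \<comment> \<open>Dilating the variable keeps the Gaussian fixed and shrinks the argument of
    \<psi> instead, which provides one majorant for dominated convergence.\<close>
  have conv1: "(\<integral>k. gauss_shift 1 0 k * \<psi> (k /\<^sub>R e) \<partial>lborel) = 0" if e: "0 < e" for e
  proof -
    have "0 = (\<integral>k. gauss_shift 1 0 (e *\<^sub>R k) * \<psi> ((e *\<^sub>R k) /\<^sub>R e) \<partial>lborel)"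
      using conv0[OF e] e by (simp add: gauss_shift_def gauss_scale[of e, symmetric])
    also have "... = (1 / e) ^ DIM('a) *\<^sub>R (\<integral>k. gauss_shift 1 0 k * \<psi> (k /\<^sub>R e) \<partial>lborel)"
      by (rule integral_lborel_scaleR) (use e in measurable)
    finally show ?thesis using e by simp
  qed
  have \<psi>_lim: "(\<lambda>n. \<psi> (k /\<^sub>R (real n + 1))) \<longlonglongrightarrow> \<psi> 0" for k
  proof -
    have "(\<lambda>n. \<integral>x. w x * \<phi> (x - k /\<^sub>R (real n + 1)) \<partial>lborel) \<longlonglongrightarrow> (\<integral>x. w x * \<phi> x \<partial>lborel)"
    proof (rule integral_dominated_convergence[where w="\<lambda>x. norm (w x * (complex_of_real B * indicator (cball 0 (R + norm k)) x))"])
      show "integrable lborel (\<lambda>x. norm (w x * (complex_of_real B * indicator (cball 0 (R + norm k)) x)))"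
        by (intro integrable_norm L2_mult_integrable w L2_cmult L2_indicator)
           (use emeasure_lborel_cball_finite in auto)
      show "AE x in lborel. (\<lambda>n. w x * \<phi> (x - k /\<^sub>R (real n + 1))) \<longlonglongrightarrow> w x * \<phi> x"
      proof (rule AE_I2)
        fix x
        have "(\<lambda>n. inverse (real n + 1)) \<longlonglongrightarrow> 0"
          using LIMSEQ_inverse_real_of_nat by (simp add: add.commute)
        then have "(\<lambda>n. x - inverse (real n + 1) *\<^sub>R k) \<longlonglongrightarrow> x - 0 *\<^sub>R k"
          by (intro tendsto_intros)
        then have "(\<lambda>n. \<phi> (x - inverse (real n + 1) *\<^sub>R k)) \<longlonglongrightarrow> \<phi> x"
          using cont by (intro continuous_on_tendsto_compose[OF cont]) auto
        then show "(\<lambda>n. w x * \<phi> (x - k /\<^sub>R (real n + 1))) \<longlonglongrightarrow> w x * \<phi> x"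
          by (intro tendsto_intros)
      qed
      show "AE x in lborel. norm (w x * \<phi> (x - k /\<^sub>R (real n + 1))) \<le> norm (w x * (complex_of_real B * indicator (cball 0 (R + norm k)) x))" for n
      proof (rule AE_I2)
        fix x
        have B0: "0 \<le> B" using order_trans[OF norm_ge_zero B] .
        have "norm (\<phi> (x - k /\<^sub>R (real n + 1))) \<le> norm (complex_of_real B * indicator (cball 0 (R + norm k)) x)"
        proof (cases "norm x \<le> R + norm k")
          case False
          have "norm (k /\<^sub>R (real n + 1)) \<le> norm k"
            by (simp add: divide_le_eq field_simps)
          then have "R < norm (x - k /\<^sub>R (real n + 1))"
            using False norm_triangle_ineq2[of x "k /\<^sub>R (real n + 1)"] by linarith
          then show ?thesis using R by simp
        qed (use B B0 in \<open>auto simp: norm_mult\<close>)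
        then show "norm (w x * \<phi> (x - k /\<^sub>R (real n + 1))) \<le> norm (w x * (complex_of_real B * indicator (cball 0 (R + norm k)) x))"
          by (simp add: norm_mult mult_left_mono)
      qed
    qed measurable
    then show ?thesis by (simp add: \<psi>_def)
  qed
  have "(\<lambda>n. \<integral>k. gauss_shift 1 0 k * \<psi> (k /\<^sub>R (real n + 1)) \<partial>lborel) \<longlonglongrightarrow> (\<integral>(k::'a). gauss_shift 1 0 k * \<psi> 0 \<partial>lborel)"
  proof (rule integral_dominated_convergence[where w="\<lambda>k::'a. L2_norm w * L2_norm \<phi> * norm (gauss_shift 1 0 k)"])
    show "integrable lborel (\<lambda>k::'a. L2_norm w * L2_norm \<phi> * norm (gauss_shift 1 0 k))"
      by (intro integrable_mult_right integrable_norm integrable_gauss_shift) simp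
    show "AE k in lborel. (\<lambda>n. gauss_shift 1 0 k * \<psi> (k /\<^sub>R (real n + 1))) \<longlonglongrightarrow> gauss_shift 1 0 k * \<psi> 0"
      by (intro AE_I2 tendsto_intros \<psi>_lim)
    show "AE k in lborel. norm (gauss_shift 1 0 k * \<psi> (k /\<^sub>R (real n + 1))) \<le> L2_norm w * L2_norm \<phi> * norm (gauss_shift 1 0 k)" for n
      by (intro AE_I2) (subst norm_mult, subst mult.commute, rule mult_right_mono[OF \<psi>_bound norm_ge_zero])
    show "(\<lambda>k::'a. gauss_shift 1 0 k * \<psi> 0) \<in> borel_measurable lborel" by measurable
    show "(\<lambda>k. gauss_shift 1 0 k * \<psi> (k /\<^sub>R (real n + 1))) \<in> borel_measurable lborel" for n by measurable
  qed
  then have "(\<integral>(k::'a). gauss_shift 1 0 k * \<psi> 0 \<partial>lborel) = 0"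
    using conv1 by (simp add: LIMSEQ_const_iff)
  then have "(\<integral>(k::'a). gauss_shift 1 0 k \<partial>lborel) * \<psi> 0 = 0" by simp
  moreover have "(\<integral>(k::'a). gauss_shift 1 0 k \<partial>lborel) \<noteq> 0"
  proof -
    have "(\<integral>(k::'a). gauss_shift 1 0 k \<partial>lborel) = fourier_integral (gauss_shift 1 0) (0::'a)"
      unfolding fourier_integral_def by simp
    also have "... = complex_of_real (sqrt (2 * pi) ^ DIM('a))"
      by (subst fourier_gauss_shift) (auto simp: gauss_hat_def gauss_def)
    finally show ?thesis by simp
  qed
  ultimately show ?thesis by (simp add: \<psi>_def)
qed

text \<open>Testing \<open>w\<close> against its own conjugate, restricted to a set \<open>A\<close>
  where position and value are bounded, would give the claim at once. The restricted conjugate need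
  not be continuous, but it is an almost everywhere limit of continuous functions, which become
  admissible once cut off in space and in modulus. The sets \<open>A\<close> exhaust the
  space.\<close>

lemma gauss_orthogonal_imp_zero:
  fixes w :: "'a::euclidean_space \<Rightarrow> complex"
  assumes w: "w \<in> L2" and orth: "\<And>e y. 0 < e \<Longrightarrow> (\<integral>z. w z * gauss_shift e y z \<partial>lborel) = 0"
  shows "AE z in lborel. w z = 0"
proof -
  have [measurable]: "w \<in> borel_measurable borel" using w by (simp add: L2_iff)
  have "AE z in lborel. norm z \<le> real n \<and> norm (w z) \<le> real n \<longrightarrow> w z = 0" for n :: nat
  proof -
    define A where "A = {z. norm z \<le> real n \<and> norm (w z) \<le> real n}"
    have [measurable]: "A \<in> sets borel" unfolding A_def by measurable
    \<comment> \<open>The conjugate turns the pairing with \<open>w\<close> into the integral of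
      \<open>(norm (w z))^2\<close> over \<open>A\<close>.\<close>
    define g where "g z = indicator A z * cnj (w z)" for z
    have "g \<in> borel_measurable borel" unfolding g_def[abs_def] by measurable
    then have "g \<in> borel_measurable lebesgue" by (simp add: measurable_completion)
    then have "g measurable_on UNIV" by (simp add: lebesgue_measurable_imp_measurable_on)
    then obtain N G where N: "negligible N" and G: "\<And>m. continuous_on UNIV (G m)"
      and lim: "\<And>z. z \<notin> N \<Longrightarrow> (\<lambda>m. G m z) \<longlonglongrightarrow> g z"
      unfolding measurable_on_def by auto
    \<comment> \<open>One more than \<open>n\<close>: the spatial cut-off then equals 1 on the ball
      of radius \<open>n\<close>, and clipping the modulus at \<open>B\<close> leaves
      \<open>g\<close> unchanged.\<close>
    define B where "B = real n + 1"
    have B: "0 < B" "real n \<le> B" by (simp_all add: B_def)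
    define cut where "cut z = max 0 (min 1 (B - norm z))" for z :: 'a
    \<comment> \<open>Dividing by the maximum is a continuous way of rescaling values of modulus
      above \<open>B\<close> to modulus \<open>B\<close>.\<close>
    define \<phi> where "\<phi> m z = complex_of_real (cut z) * (G m z / complex_of_real (max 1 (norm (G m z) / B)))" for m z
    have cut: "0 \<le> cut z" "cut z \<le> 1" for z by (auto simp: cut_def)
    have \<phi>_bound: "norm (\<phi> m z) \<le> B" for m z
    proof -
      have pos: "0 < max 1 (norm (G m z) / B)" by simp
      have "norm (\<phi> m z) = cut z * (norm (G m z) / max 1 (norm (G m z) / B))"
        unfolding \<phi>_def norm_mult norm_divide norm_of_real using cut[of z] pos by simp
      also have "... \<le> 1 * (norm (G m z) / max 1 (norm (G m z) / B))"
        using cut pos by (intro mult_right_mono divide_nonneg_pos) auto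
      also have "... \<le> B"
      proof -
        have "norm (G m z) = B * (norm (G m z) / B)" using B by simp
        also have "... \<le> B * max 1 (norm (G m z) / B)" using B by (intro mult_left_mono) auto
        finally show ?thesis using pos by (simp add: divide_le_eq)
      qed
      finally show ?thesis .
    qed
    have \<phi>_supp: "\<phi> m z = 0" if "B < norm z" for m z
      using that by (simp add: \<phi>_def cut_def)
    have \<phi>_cont: "continuous_on UNIV (\<phi> m)" for m
      unfolding \<phi>_def[abs_def] cut_def[abs_def]
      by (intro continuous_intros G) (use B in \<open>auto simp: max_def\<close>)
    have [measurable]: "\<phi> m \<in> borel_measurable borel" for m
      using \<phi>_cont by (rule borel_measurable_continuous_onI)
    have \<phi>_lim: "(\<lambda>m. \<phi> m z) \<longlonglongrightarrow> g z" if "z \<notin> N" for z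
    proof -
      have "(\<lambda>m. \<phi> m z) \<longlonglongrightarrow> complex_of_real (cut z) * (g z / complex_of_real (max 1 (norm (g z) / B)))"
        unfolding \<phi>_def using lim[OF that] B by (intro tendsto_intros) (auto simp: max_def)
      also have "complex_of_real (cut z) * (g z / complex_of_real (max 1 (norm (g z) / B))) = g z"
        using B by (auto simp: g_def A_def cut_def B_def norm_mult divide_le_eq split: split_indicator)
      finally show ?thesis .
    qed
    have "(\<lambda>m. \<integral>z. w z * \<phi> m z \<partial>lborel) \<longlonglongrightarrow> (\<integral>z. w z * g z \<partial>lborel)"
    proof (rule integral_dominated_convergence[where w="\<lambda>x. norm (w x * (complex_of_real B * indicator (cball 0 B) x))"])
      show "integrable lborel (\<lambda>x. norm (w x * (complex_of_real B * indicator (cball 0 B) x)))"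
        by (intro integrable_norm L2_mult_integrable w L2_cmult L2_indicator)
           (use emeasure_lborel_cball_finite in auto)
      have "AE z in lebesgue. z \<notin> N" using N by (simp add: AE_not_in negligible_iff_null_sets)
      then have "AE z in lborel. z \<notin> N" by (simp add: AE_completion_iff)
      then show "AE z in lborel. (\<lambda>m. w z * \<phi> m z) \<longlonglongrightarrow> w z * g z"
        by eventually_elim (intro tendsto_intros \<phi>_lim)
      show "AE z in lborel. norm (w z * \<phi> m z) \<le> norm (w z * (complex_of_real B * indicator (cball 0 B) z))" for m
      proof (rule AE_I2)
        fix z
        have "norm (\<phi> m z) \<le> norm (complex_of_real B * indicator (cball 0 B) z)"
          using \<phi>_bound[of m z] \<phi>_supp[of z m] B by (auto simp: norm_mult split: split_indicator)
        then show "norm (w z * \<phi> m z) \<le> norm (w z * (complex_of_real B * indicator (cball 0 B) z))"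
          by (simp add: norm_mult mult_left_mono)
      qed
      show "(\<lambda>z. w z * g z) \<in> borel_measurable lborel" unfolding g_def[abs_def] by measurable
    qed measurable
    moreover have "(\<integral>z. w z * \<phi> m z \<partial>lborel) = 0" for m
      by (rule gauss_orthogonal_compact_support[OF w orth \<phi>_cont \<phi>_bound \<phi>_supp])
    ultimately have "(\<integral>z. w z * g z \<partial>lborel) = 0" by (simp add: LIMSEQ_const_iff)
    moreover have wg: "w z * g z = complex_of_real (indicator A z * (norm (w z))^2)" for z
      by (cases "z \<in> A") (simp_all add: g_def complex_norm_square del: of_real_power)
    ultimately have "complex_of_real (\<integral>z. indicator A z * (norm (w z))^2 \<partial>lborel) = 0"
      by (simp only: wg integral_complex_of_real)
    then have "(\<integral>z. indicator A z * (norm (w z))^2 \<partial>lborel) = 0" by simp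
    moreover have "integrable lborel (\<lambda>z. indicator A z * (norm (w z))^2)"
      by (rule Bochner_Integration.integrable_bound[OF L2_integrable[OF w]])
         (auto split: split_indicator)
    ultimately have "AE z in lborel. indicator A z * (norm (w z))^2 = 0"
      by (subst (asm) integral_nonneg_eq_0_iff_AE) auto
    then show ?thesis by eventually_elim (auto simp: A_def split: split_indicator_asm)
  qed
  then have "AE z in lborel. \<forall>n::nat. norm z \<le> real n \<and> norm (w z) \<le> real n \<longrightarrow> w z = 0"
    unfolding AE_all_countable by (rule allI)
  then show ?thesis
  proof eventually_elim
    fix z assume *: "\<forall>n::nat. norm z \<le> real n \<and> norm (w z) \<le> real n \<longrightarrow> w z = 0"
    obtain n :: nat where "max (norm z) (norm (w z)) \<le> real n" using real_arch_simple by blast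
    then show "w z = 0" using * by auto
  qed
qed

text \<open>The criterion behind uniqueness and inversion: only pairings with Gaussians have to be
  computed.\<close>

lemma L2_eq_AE_iff_gauss:
  assumes f: "f \<in> L2" and g: "g \<in> L2"
    and eq: "\<And>e y. 0 < e \<Longrightarrow> (\<integral>z. f z * gauss_shift e y z \<partial>lborel) = (\<integral>z. g z * gauss_shift e y z \<partial>lborel)"
  shows "AE z in lborel. f z = g z"
proof -
  have "AE z in lborel. f z - g z = 0"
  proof (rule gauss_orthogonal_imp_zero[OF L2_diff[OF f g]])
    fix e :: real and y assume e: "0 < e"
    have "(\<integral>z. (f z - g z) * gauss_shift e y z \<partial>lborel)
        = (\<integral>z. f z * gauss_shift e y z \<partial>lborel) - (\<integral>z. g z * gauss_shift e y z \<partial>lborel)"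
      unfolding left_diff_distrib
      by (intro Bochner_Integration.integral_diff L2_mult_integrable f g gauss_shift_L2 e)
    then show "(\<integral>z. (f z - g z) * gauss_shift e y z \<partial>lborel) = 0" using eq[OF e] by simp
  qed
  then show ?thesis by simp
qed

text \<open>The multiplication formula expresses all Gaussian pairings of a transform through
  \<open>u\<close> alone. Hence the choice in \<open>fourier_L2\<close> is immaterial up to null
  sets.\<close>

lemma has_fourier_L2_unique:
  assumes "has_fourier_L2 u v" "has_fourier_L2 u v'"
  shows "AE \<zeta> in lborel. v \<zeta> = v' \<zeta>"
  using assms fourier_L2_mult[OF assms(1) integrable_gauss_shift gauss_shift_L2]
    fourier_L2_mult[OF assms(2) integrable_gauss_shift gauss_shift_L2]
  by (intro L2_eq_AE_iff_gauss) (auto simp: has_fourier_L2_iff)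

lemma has_fourier_L2_fourier_L2: "u \<in> L2 \<Longrightarrow> has_fourier_L2 u (fourier_L2 u)"
  unfolding fourier_L2_def using fourier_L2_exists by (rule someI_ex)

lemma fourier_L2_eq_AE:
  assumes "has_fourier_L2 u v"
  shows "AE \<zeta> in lborel. fourier_L2 u \<zeta> = v \<zeta>"
  using assms by (intro has_fourier_L2_unique[OF has_fourier_L2_fourier_L2]) (auto simp: has_fourier_L2_iff)

lemma has_fourier_L2_cong_AE:
  assumes uv: "has_fourier_L2 u v" and u': "u' \<in> borel_measurable borel" and eq: "AE z in lborel. u z = u' z"
    and v': "v' \<in> borel_measurable borel" and eqv: "AE \<zeta> in lborel. v \<zeta> = v' \<zeta>"
  shows "has_fourier_L2 u' v'"
proof -
  have L2: "u' \<in> L2" "v' \<in> L2"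
    using uv L2_cong_AE[OF _ u' eq] L2_cong_AE[OF _ v' eqv] by (auto simp: has_fourier_L2_iff)
  have [measurable]: "u \<in> borel_measurable borel" "u' \<in> borel_measurable borel"
    using uv u' by (auto simp: has_fourier_L2_iff L2_iff)
  have F: "fourier_integral (truncate n u') = fourier_integral (truncate n u)" for n
    unfolding fourier_integral_def truncate_def
    by (intro ext integral_cong_AE) (use eq in \<open>auto elim!: eventually_mono intro!: borel_measurable_times borel_measurable_indicator\<close>)
  have "sq_norm (\<lambda>\<zeta>. fourier_integral (truncate n u') \<zeta> - v' \<zeta>) = sq_norm (\<lambda>\<zeta>. fourier_integral (truncate n u) \<zeta> - v \<zeta>)" for n
    by (rule sq_norm_cong_AE) (use eqv in \<open>auto simp: F elim!: eventually_mono\<close>)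
  then show ?thesis using uv L2 by (simp add: has_fourier_L2_iff)
qed

lemma has_fourier_L2_cmult:
  assumes uv: "has_fourier_L2 u v"
  shows "has_fourier_L2 (\<lambda>z. c * u z) (\<lambda>\<zeta>. c * v \<zeta>)"
proof -
  have u: "u \<in> L2" and v: "v \<in> L2" and lim: "(\<lambda>n. sq_norm (\<lambda>\<zeta>. fourier_integral (truncate n u) \<zeta> - v \<zeta>)) \<longlonglongrightarrow> 0"
    using uv by (auto simp: has_fourier_L2_iff)
  have [measurable]: "u \<in> borel_measurable borel" "v \<in> borel_measurable borel" using u v by (auto simp: L2_iff)
  have "fourier_integral (truncate n (\<lambda>z. c * u z)) \<zeta> = c * fourier_integral (truncate n u) \<zeta>" for n \<zeta>
    unfolding fourier_integral_def truncate_def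
    by (subst integral_mult_right_zero[symmetric]) (simp add: mult_ac)
  then have "sq_norm (\<lambda>\<zeta>. fourier_integral (truncate n (\<lambda>z. c * u z)) \<zeta> - c * v \<zeta>)
      = ennreal ((norm c)^2) * sq_norm (\<lambda>\<zeta>. fourier_integral (truncate n u) \<zeta> - v \<zeta>)" for n
    by (subst sq_norm_cmult[symmetric]) (auto simp: right_diff_distrib)
  moreover have "(\<lambda>n. ennreal ((norm c)^2) * sq_norm (\<lambda>\<zeta>. fourier_integral (truncate n u) \<zeta> - v \<zeta>)) \<longlonglongrightarrow> ennreal ((norm c)^2) * 0"
    using lim by (intro ennreal_tendsto_cmult) auto
  ultimately show ?thesis using u v by (simp add: has_fourier_L2_iff L2_cmult)
qed

section \<open>Inversion and comparison of norms\<close>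

text \<open>Duality with Gaussians: the multiplication formula is used once to move the transform
  onto the Gaussian and once to move the transform of \<open>h\<close> back, and inversion for
  Gaussians produces the factor.\<close>

lemma has_fourier_L2_inverse_integral:
  fixes h :: "'a::euclidean_space \<Rightarrow> complex"
  assumes h: "integrable lborel h" "h \<in> L2"
  shows "has_fourier_L2 (\<lambda>z. fourier_integral h (- z)) (\<lambda>\<zeta>. (2 * pi) ^ DIM('a) * h \<zeta>)"
proof -
  let ?H = "\<lambda>z. fourier_integral h (- z)"
  have H: "?H \<in> L2" by (rule L2_reflect[OF fourier_integral_L2[OF h]])
  obtain v where v: "has_fourier_L2 ?H v" using fourier_L2_exists[OF H] by blast
  have h_meas [measurable]: "h \<in> borel_measurable borel" using h by (simp add: L2_iff)
  have "AE \<zeta> in lborel. v \<zeta> = (2 * pi) ^ DIM('a) * h \<zeta>"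
  proof (rule L2_eq_AE_iff_gauss)
    fix e :: real and y :: 'a assume e: "0 < e"
    have refl: "gauss_hat e y (- z) = gauss_hat e (- y) z" for z :: 'a
      by (simp add: gauss_hat_def gauss_minus)
    have "(\<integral>\<zeta>. v \<zeta> * gauss_shift e y \<zeta> \<partial>lborel) = (\<integral>z. ?H z * gauss_hat e y z \<partial>lborel)"
      using fourier_L2_mult[OF v integrable_gauss_shift[OF e] gauss_shift_L2[OF e]]
      by (simp add: fourier_gauss_shift[OF e])
    also have "... = (\<integral>z. fourier_integral h z * gauss_hat e (- y) z \<partial>lborel)"
      using integral_lborel_diff[of "\<lambda>z. fourier_integral h z * gauss_hat e (- y) z" 0] by (simp add: refl[symmetric])
    also have "... = (\<integral>z. h z * fourier_integral (gauss_hat e (- y)) z \<partial>lborel)"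
      by (rule fourier_integral_mult[OF h(1) integrable_gauss_hat[OF e]])
    also have "... = (\<integral>z. (2 * pi) ^ DIM('a) * h z * gauss_shift e y z \<partial>lborel)"
      by (simp add: fourier_gauss_hat[OF e] mult_ac)
    finally show "(\<integral>\<zeta>. v \<zeta> * gauss_shift e y \<zeta> \<partial>lborel) = (\<integral>z. (2 * pi) ^ DIM('a) * h z * gauss_shift e y z \<partial>lborel)" .
  qed (use v h in \<open>auto simp: has_fourier_L2_iff L2_cmult\<close>)
  then show ?thesis
    by (intro has_fourier_L2_cong_AE[OF v]) (use H in \<open>auto simp: L2_iff\<close>)
qed

text \<open>The representative \<open>q\<close> is integrable, so the inverse transform is a genuine
  integral and the identity holds at almost every point. This is what allows products to be formed
  pointwise later.\<close>

lemma fourier_inversion: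
  fixes u v q :: "'a::euclidean_space \<Rightarrow> complex"
  assumes uv: "has_fourier_L2 u v" and q: "integrable lborel q" "q \<in> L2" and eq: "AE \<zeta> in lborel. v \<zeta> = q \<zeta>"
  shows "AE z in lborel. u z = (1 / (2 * pi) ^ DIM('a)) * fourier_integral q (- z)"
proof (rule L2_eq_AE_iff_gauss)
  let ?c = "1 / (2 * pi) ^ DIM('a) :: complex"
  have U: "has_fourier_L2 (\<lambda>z. ?c * fourier_integral q (- z)) (\<lambda>\<zeta>. ?c * ((2 * pi) ^ DIM('a) * q \<zeta>))"
    by (intro has_fourier_L2_cmult has_fourier_L2_inverse_integral q)
  then show "(\<lambda>z. ?c * fourier_integral q (- z)) \<in> L2" and u: "u \<in> L2"
    using uv by (auto simp: has_fourier_L2_iff)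
  fix e :: real and y :: 'a assume e: "0 < e"
  \<comment> \<open>The Gaussian whose transform is \<open>gauss_shift e y\<close>; pairing
    \<open>v\<close> with it computes the pairing of \<open>u\<close> with
    \<open>gauss_shift e y\<close>.\<close>
  define g where "g \<zeta> = ?c * gauss_hat e (- y) \<zeta>" for \<zeta>
  have g: "integrable lborel g" "g \<in> L2"
    unfolding g_def[abs_def] by (intro integrable_mult_right integrable_gauss_hat L2_cmult gauss_hat_L2 e)+
  have Fg: "fourier_integral g z = gauss_shift e y z" for z
  proof -
    have "fourier_integral g z = ?c * fourier_integral (gauss_hat e (- y)) z"
      unfolding fourier_integral_def g_def
      by (subst integral_mult_right_zero[symmetric]) (simp add: mult_ac)
    then show ?thesis by (simp add: fourier_gauss_hat[OF e])
  qed
  have [measurable]: "v \<in> borel_measurable borel" "q \<in> borel_measurable borel" "g \<in> borel_measurable borel"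
    using uv q g by (auto simp: has_fourier_L2_iff L2_iff)
  have "(\<integral>z. u z * gauss_shift e y z \<partial>lborel) = (\<integral>\<zeta>. v \<zeta> * g \<zeta> \<partial>lborel)"
    using fourier_L2_mult[OF uv g] by (simp add: Fg)
  also have "... = (\<integral>\<zeta>. ?c * ((2 * pi) ^ DIM('a) * q \<zeta>) * g \<zeta> \<partial>lborel)"
    by (rule integral_cong_AE) (use eq in \<open>auto elim!: eventually_mono\<close>)
  also have "... = (\<integral>z. ?c * fourier_integral q (- z) * gauss_shift e y z \<partial>lborel)"
    using fourier_L2_mult[OF U g] by (simp add: Fg)
  finally show "(\<integral>z. u z * gauss_shift e y z \<partial>lborel) = (\<integral>z. ?c * fourier_integral q (- z) * gauss_shift e y z \<partial>lborel)" .
qed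

text \<open>Bessel's bound applied to the inverse transform. Squaring the normalisation puts
  \<open>(2 * pi) ^ DIM('a)\<close> twice in the denominator, and Bessel's constant cancels one of
  them.\<close>

lemma sq_norm_le_fourier:
  fixes u v q :: "'a::euclidean_space \<Rightarrow> complex"
  assumes uv: "has_fourier_L2 u v" and q: "integrable lborel q" "q \<in> L2" and eq: "AE \<zeta> in lborel. v \<zeta> = q \<zeta>"
  shows "sq_norm u \<le> ennreal (1 / (2 * pi) ^ DIM('a)) * sq_norm q"
proof -
  let ?d = "(2 * pi) ^ DIM('a)"
  have [measurable]: "q \<in> borel_measurable borel" using q by (simp add: L2_iff)
  have "sq_norm u = sq_norm (\<lambda>z. (1 / ?d) * fourier_integral q (- z))"
    by (rule sq_norm_cong_AE[OF fourier_inversion[OF assms]])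
  also have "... = ennreal ((1 / ?d)^2) * sq_norm (fourier_integral q)"
    by (subst sq_norm_cmult, measurable) (simp add: sq_norm_reflect norm_divide norm_power norm_mult)
  also have "... \<le> ennreal ((1 / ?d)^2) * (ennreal ?d * sq_norm q)"
    by (intro mult_left_mono bessel q) simp
  also have "... = ennreal ((1 / ?d)^2 * ?d) * sq_norm q"
    by (subst ennreal_mult) (simp_all add: mult.assoc)
  also have "(1 / ?d)^2 * ?d = 1 / ?d" by (simp add: power2_eq_square)
  finally show ?thesis .
qed

text \<open>Plancherel's theorem has no factor 2 here; the triangle inequality used instead costs it.\<close>

lemma sq_norm_fourier_le:
  fixes u v :: "'a::euclidean_space \<Rightarrow> complex"
  assumes uv: "has_fourier_L2 u v"
  shows "sq_norm v \<le> 2 * (ennreal ((2 * pi) ^ DIM('a)) * sq_norm u)"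
proof -
  have u: "u \<in> L2" and v: "v \<in> L2" and lim: "(\<lambda>n. sq_norm (\<lambda>\<zeta>. fourier_integral (truncate n u) \<zeta> - v \<zeta>)) \<longlonglongrightarrow> 0"
    using uv by (auto simp: has_fourier_L2_iff)
  have [measurable]: "u \<in> borel_measurable borel" "v \<in> borel_measurable borel" using u v by (auto simp: L2_iff)
  let ?C = "ennreal ((2 * pi) ^ DIM('a)) * sq_norm u"
  have "sq_norm v \<le> 2 * (?C + sq_norm (\<lambda>\<zeta>. fourier_integral (truncate n u) \<zeta> - v \<zeta>))" for n
  proof -
    have "sq_norm v = sq_norm (\<lambda>\<zeta>. fourier_integral (truncate n u) \<zeta> - (fourier_integral (truncate n u) \<zeta> - v \<zeta>))"
      by simp
    also have "... \<le> 2 * (sq_norm (fourier_integral (truncate n u)) + sq_norm (\<lambda>\<zeta>. fourier_integral (truncate n u) \<zeta> - v \<zeta>))"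
      by (rule sq_norm_diff) measurable
    also have "sq_norm (fourier_integral (truncate n u)) \<le> ennreal ((2 * pi) ^ DIM('a)) * sq_norm (truncate n u)"
      by (intro bessel truncate_integrable u)
    also have "sq_norm (truncate n u) \<le> sq_norm u"
      by (rule sq_norm_mono) (auto simp: truncate_def split: split_indicator)
    finally show ?thesis by (simp add: mult_left_mono add_right_mono)
  qed
  moreover have "(\<lambda>n. 2 * (?C + sq_norm (\<lambda>\<zeta>. fourier_integral (truncate n u) \<zeta> - v \<zeta>))) \<longlonglongrightarrow> 2 * (?C + 0)"
    by (intro ennreal_tendsto_cmult tendsto_add lim tendsto_const) simp
  ultimately show ?thesis
    by (intro LIMSEQ_le_const[of _ "2 * ?C" "sq_norm v"]) auto
qed

section \<open>Overlap of thickened cones\<close>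

text \<open>Lagrange's identity evaluates the defect in the Cauchy-Schwarz inequality for the
  vectors \<open>(x, b)\<close> and \<open>(x, y)\<close>; divided by the norm of the first, this
  defect is the height of the curve above its tangent at \<open>b\<close>.\<close>

lemma norm2_tangent:
  fixes x y b :: real
  assumes r: "0 < sqrt (x^2 + b^2)" and R: "0 < sqrt (x^2 + y^2)"
  shows "sqrt (x^2 + b^2) + b / sqrt (x^2 + b^2) * (y - b) + x^2 * (y - b)^2 / (2 * (sqrt (x^2 + b^2))^2 * sqrt (x^2 + y^2))
    \<le> sqrt (x^2 + y^2)"
proof -
  define r where "r = sqrt (x^2 + b^2)"
  define R where "R = sqrt (x^2 + y^2)"
  have r2: "r^2 = x^2 + b^2" and R2: "R^2 = x^2 + y^2" by (simp_all add: r_def R_def)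
  have pos: "0 < r" "0 < R" using r R by (simp_all add: r_def R_def)
  define s where "s = x^2 + b * y"
  have id: "(R * r)^2 - s^2 = x^2 * (y - b)^2"
    unfolding power_mult_distrib r2 R2 s_def by (simp add: power2_eq_square algebra_simps)
  moreover have "0 \<le> x^2 * (y - b)^2" by simp
  ultimately have "s^2 \<le> (R * r)^2" by linarith
  then have s: "s \<le> R * r" by (rule power2_le_imp_le) (use pos in auto)
  have "x^2 * (y - b)^2 = (R * r - s) * (R * r + s)"
    unfolding id[symmetric] by (simp add: power2_eq_square algebra_simps)
  also have "... \<le> (R * r - s) * (2 * (R * r))"
    using s by (intro mult_left_mono) auto
  finally have "x^2 * (y - b)^2 / (2 * r^2 * R) \<le> (R * r - s) * (2 * (R * r)) / (2 * r^2 * R)"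
    using pos by (intro divide_right_mono) auto
  also have "... = R - s / r"
    using pos by (simp add: field_simps power2_eq_square)
  also have "s / r = r + b / r * (y - b)"
    using pos r2 by (simp add: s_def field_simps power2_eq_square)
  finally show ?thesis unfolding r_def R_def by simp
qed

text \<open>The case \<open>x = b = 0\<close> is covered too: the quotient is then 0 by convention
  and the left-hand side vanishes.\<close>

lemma norm2_convex:
  fixes x y b :: real
  shows "sqrt (x^2 + b^2) + b / sqrt (x^2 + b^2) * (y - b) \<le> sqrt (x^2 + y^2)"
proof (cases "sqrt (x^2 + b^2) = 0")
  case False
  then have r: "0 < sqrt (x^2 + b^2)" by (metis less_le real_sqrt_ge_zero sum_power2_ge_zero)
  have quot: "(q * q + b * c) / q = q + b / q * c" if "q \<noteq> 0" for q c :: real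
    using that by (simp add: field_simps)
  have "sqrt (x^2 + b^2) * sqrt (x^2 + b^2) + b * (y - b) = x^2 + b * y"
    by (simp add: power2_eq_square algebra_simps)
  also have "... \<le> sqrt (x^2 + b^2) * sqrt (x^2 + y^2)"
  proof (rule power2_le_imp_le)
    have "(sqrt (x^2 + b^2) * sqrt (x^2 + y^2))^2 - (x^2 + b * y)^2 = (x * (y - b))^2"
      by (simp add: power_mult_distrib) (simp add: power2_eq_square algebra_simps)
    then show "(x^2 + b * y)^2 \<le> (sqrt (x^2 + b^2) * sqrt (x^2 + y^2))^2"
      using zero_le_power2[of "x * (y - b)"] by linarith
  qed auto
  finally have "(sqrt (x^2 + b^2) * sqrt (x^2 + b^2) + b * (y - b)) / sqrt (x^2 + b^2) \<le> sqrt (x^2 + y^2)"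
    using r by (simp only: pos_divide_le_eq mult.commute)
  also have "(sqrt (x^2 + b^2) * sqrt (x^2 + b^2) + b * (y - b)) / sqrt (x^2 + b^2) = sqrt (x^2 + b^2) + b / sqrt (x^2 + b^2) * (y - b)"
    by (rule quot) (use r in linarith)
  finally show ?thesis .
qed simp

lemma emeasure_le_diameter:
  fixes S :: "real set"
  assumes S: "bdd_above S" "0 \<le> d" and diam: "\<And>a b. a \<in> S \<Longrightarrow> b \<in> S \<Longrightarrow> b - a \<le> d"
  shows "emeasure lborel S \<le> ennreal d"
proof (cases "S = {}")
  case False
  have "S \<subseteq> {Sup S - d..Sup S}"
  proof
    fix b assume b: "b \<in> S"
    have "Sup S \<le> b + d" using False diam[OF b] by (intro cSup_least) (auto simp: algebra_simps)
    then show "b \<in> {Sup S - d..Sup S}" using b S by (auto intro: cSup_upper)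
  qed
  then have "emeasure lborel S \<le> emeasure lborel {Sup S - d..Sup S}"
    by (intro emeasure_mono) auto
  then show ?thesis using S by simp
qed simp

text \<open>A point far from both ends of \<open>S\<close> would have a point of \<open>S\<close>
  near the infimum more than \<rho> to its left and one near the supremum more than \<rho> to its
  right. Hence \<open>S\<close> hugs its two ends.\<close>

lemma emeasure_two_clusters:
  fixes S :: "real set"
  assumes bdd: "bdd_above S" "bdd_below S" and \<rho>: "0 < \<rho>"
    and gap: "\<And>a b c. a \<in> S \<Longrightarrow> b \<in> S \<Longrightarrow> c \<in> S \<Longrightarrow> a < b \<Longrightarrow> b < c \<Longrightarrow> b - a \<le> \<rho> \<or> c - b \<le> \<rho>"
  shows "emeasure lborel S \<le> ennreal (4 * \<rho>)"
proof (cases "S = {}")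
  case False
  have "S \<subseteq> {Inf S..Inf S + 2 * \<rho>} \<union> {Sup S - 2 * \<rho>..Sup S}"
  proof
    fix b assume b: "b \<in> S"
    show "b \<in> {Inf S..Inf S + 2 * \<rho>} \<union> {Sup S - 2 * \<rho>..Sup S}"
    proof (rule ccontr)
      assume "b \<notin> {Inf S..Inf S + 2 * \<rho>} \<union> {Sup S - 2 * \<rho>..Sup S}"
      moreover have "Inf S \<le> b" "b \<le> Sup S"
        using b bdd by (auto intro: cInf_lower cSup_upper)
      ultimately have lt: "Inf S + 2 * \<rho> < b" "b < Sup S - 2 * \<rho>" by auto
      \<comment> \<open>The infimum and supremum need not be attained; clusters of width
        \<open>2 * \<rho>\<close> leave room to lose \<rho> here.\<close>
      obtain a where a: "a \<in> S" "a < Inf S + \<rho>"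
        using cInf_lessD[OF False, of "Inf S + \<rho>"] \<rho> by auto
      obtain c where c: "c \<in> S" "Sup S - \<rho> < c"
        using less_cSupD[OF False, of "Sup S - \<rho>"] \<rho> by auto
      show False using gap[OF a(1) b c(1)] a c lt \<rho> by auto
    qed
  qed
  then have "emeasure lborel S \<le> emeasure lborel ({Inf S..Inf S + 2 * \<rho>} \<union> {Sup S - 2 * \<rho>..Sup S})"
    by (intro emeasure_mono) auto
  also have "... \<le> emeasure lborel {Inf S..Inf S + 2 * \<rho>} + emeasure lborel {Sup S - 2 * \<rho>..Sup S}"
    by (intro emeasure_subadditive) auto
  also have "... = ennreal (4 * \<rho>)"
    using \<rho> by (simp add: ennreal_plus[symmetric] del: ennreal_plus)
  finally show ?thesis .
qed simp

text \<open>On the side of \<open>b\<close> where the tangent does not descend, a point at distance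
  \<open>t\<close> raises \<open>f\<close> by at least \<open>l * t^2\<close>, whereas values on the
  level set differ by at most \<open>2 * K\<close>. So on one side of \<open>b\<close> all points of
  \<open>S\<close> are within \<open>sqrt (2 * K / l)\<close>, as
  \<open>emeasure_two_clusters\<close> demands. Tangents are compared only at points of
  \<open>S\<close>, which need not be an interval.\<close>

lemma emeasure_strongly_convex_level:
  fixes S :: "real set" and f D :: "real \<Rightarrow> real"
  assumes bdd: "bdd_above S" "bdd_below S" and pos: "0 < K" "0 < l"
    and conv: "\<And>a b. a \<in> S \<Longrightarrow> b \<in> S \<Longrightarrow> f b + D b * (a - b) + l * (a - b)^2 \<le> f a"
    and level: "\<And>a. a \<in> S \<Longrightarrow> \<bar>f a - \<sigma>\<bar> \<le> K"
  shows "emeasure lborel S \<le> ennreal (4 * sqrt (2 * K / l))"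
proof (rule emeasure_two_clusters[OF bdd])
  show "0 < sqrt (2 * K / l)" using pos by simp
  fix a b c assume abc: "a \<in> S" "b \<in> S" "c \<in> S" "a < b" "b < c"
  have *: "d \<le> sqrt (2 * K / l)" if "l * d^2 \<le> 2 * K" for d
    using that pos by (intro real_le_rsqrt) (simp add: field_simps)
  show "b - a \<le> sqrt (2 * K / l) \<or> c - b \<le> sqrt (2 * K / l)"
  proof (cases "0 \<le> D b")
    case True
    then have "0 \<le> D b * (c - b)" using abc by simp
    then have "l * (c - b)^2 \<le> 2 * K"
      using conv[OF abc(3,2)] level[OF abc(2)] level[OF abc(3)] by linarith
    then show ?thesis using * by blast
  next
    case False
    then have "0 \<le> D b * (a - b)" using abc by (intro mult_nonpos_nonpos) auto
    then have "l * (b - a)^2 \<le> 2 * K"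
      using conv[OF abc(1,2)] level[OF abc(2)] level[OF abc(1)] by (simp add: power2_commute[of b a])
    then show ?thesis using * by blast
  qed
qed

text \<open>Here \<open>x\<close> is fixed and \<open>y\<close> runs along the line. The angle
  condition keeps \<open>|x|\<close> at least \<open>\<alpha> / 2\<close> times the first norm, so
  the first summand has curvature at least of order \<open>\<alpha>^2 / R1\<close>; from the second
  summand only convexity is taken.\<close>

lemma slice_bound_first:
  fixes S :: "real set"
  assumes bdd: "bdd_above S" "bdd_below S" and pos: "0 < K" "0 < R1" "0 < \<alpha>" "\<alpha> \<le> 1"
    and S: "\<And>y. y \<in> S \<Longrightarrow> 0 < sqrt (x^2 + y^2) \<and> sqrt (x^2 + y^2) \<le> R1 \<and> \<bar>y\<bar> \<le> (1 - \<alpha>^2/4) * sqrt (x^2 + y^2)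
       \<and> \<bar>sqrt (x^2 + y^2) + sqrt (p^2 + (y0 - y)^2) - \<sigma>\<bar> \<le> K"
  shows "emeasure lborel S \<le> ennreal (16 * sqrt (K * R1) / \<alpha>)"
proof -
  \<comment> \<open>The remainder coefficient of \<open>norm2_tangent\<close>, with
    \<open>x^2\<close> lowered to \<open>\<alpha>^2 / 4\<close> times the squared radius at
    \<open>b\<close> and the other radius raised to \<open>R1\<close>.\<close>
  let ?l = "\<alpha>^2 / (8 * R1)"
  have l: "0 < ?l" using pos by simp
  have x2: "(\<alpha>^2 / 4) * (sqrt (x^2 + y^2))^2 \<le> x^2" if "y \<in> S" for y
  proof -
    define r where "r = sqrt (x^2 + y^2)"
    have r2: "r^2 = x^2 + y^2" by (simp add: r_def)
    have "\<alpha>^2 \<le> 1" using pos by (simp add: power_le_one)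
    then have "0 \<le> 1 - \<alpha>^2/4" by simp
    have "y^2 = \<bar>y\<bar>^2" by simp
    also have "... \<le> ((1 - \<alpha>^2/4) * r)^2"
      using S[OF that] by (intro power_mono) (auto simp: r_def)
    finally have "y^2 \<le> (1 - \<alpha>^2/4)^2 * r^2" by (simp only: power_mult_distrib)
    then have "(1 - (1 - \<alpha>^2/4)^2) * r^2 \<le> x^2"
      using r2 by (simp only: left_diff_distrib) simp
    moreover have "\<alpha>^2 / 4 \<le> 1 - (1 - \<alpha>^2/4)^2"
    proof -
      have "1 - (1 - \<alpha>^2/4)^2 - \<alpha>^2/4 = \<alpha>^2/4 * (1 - \<alpha>^2/4)"
        by (simp add: power2_eq_square algebra_simps)
      also have "... \<ge> 0" using \<open>0 \<le> 1 - \<alpha>^2/4\<close> by simp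
      finally show ?thesis by simp
    qed
    ultimately show ?thesis
      unfolding r_def[symmetric] using mult_right_mono[of "\<alpha>^2 / 4" "1 - (1 - \<alpha>^2/4)^2" "r^2"] by simp
  qed
  have D: "(u - v) * (a - b) = u * (a - b) + v * ((y0 - a) - (y0 - b))" for u v a b :: real
    by (simp add: algebra_simps)
  have quot: "?l * d = (\<alpha>^2 / 4) * r^2 * d / (2 * r^2 * R1)" if "r \<noteq> 0" for r d
    using that pos by (simp add: field_simps)
  have "emeasure lborel S \<le> ennreal (4 * sqrt (2 * K / ?l))"
  proof (rule emeasure_strongly_convex_level[OF bdd pos(1) l])
    show "\<bar>(sqrt (x^2 + y^2) + sqrt (p^2 + (y0 - y)^2)) - \<sigma>\<bar> \<le> K" if "y \<in> S" for y
      using S[OF that] by simp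
    fix a b assume a: "a \<in> S" and b: "b \<in> S"
    \<comment> \<open>The slope of the sum; the second term has a minus sign because its argument is
      \<open>y0 - b\<close>.\<close>
    let ?D = "\<lambda>b. b / sqrt (x^2 + b^2) - (y0 - b) / sqrt (p^2 + (y0 - b)^2)"
    have "?l * (a - b)^2 \<le> x^2 * (a - b)^2 / (2 * (sqrt (x^2 + b^2))^2 * sqrt (x^2 + a^2))"
    proof -
      have "?l * (a - b)^2 = (\<alpha>^2 / 4) * (sqrt (x^2 + b^2))^2 * (a - b)^2 / (2 * (sqrt (x^2 + b^2))^2 * R1)"
        by (rule quot) (use S[OF b] in auto)
      also have "... \<le> x^2 * (a - b)^2 / (2 * (sqrt (x^2 + b^2))^2 * R1)"
        using x2[OF b] pos by (intro divide_right_mono mult_right_mono) auto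
      also have "... \<le> x^2 * (a - b)^2 / (2 * (sqrt (x^2 + b^2))^2 * sqrt (x^2 + a^2))"
        using S[OF a] S[OF b] pos by (intro divide_left_mono mult_left_mono mult_pos_pos) auto
      finally show ?thesis .
    qed
    moreover have "sqrt (x^2 + b^2) + b / sqrt (x^2 + b^2) * (a - b) + x^2 * (a - b)^2 / (2 * (sqrt (x^2 + b^2))^2 * sqrt (x^2 + a^2)) \<le> sqrt (x^2 + a^2)"
      using S[OF a] S[OF b] by (intro norm2_tangent) auto
    moreover have "sqrt (p^2 + (y0 - b)^2) + (y0 - b) / sqrt (p^2 + (y0 - b)^2) * ((y0 - a) - (y0 - b)) \<le> sqrt (p^2 + (y0 - a)^2)"
      by (rule norm2_convex)
    moreover have "?D b * (a - b) = b / sqrt (x^2 + b^2) * (a - b) + (y0 - b) / sqrt (p^2 + (y0 - b)^2) * ((y0 - a) - (y0 - b))"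
      by (rule D)
    ultimately show "sqrt (x^2 + b^2) + sqrt (p^2 + (y0 - b)^2) + ?D b * (a - b) + ?l * (a - b)^2
        \<le> sqrt (x^2 + a^2) + sqrt (p^2 + (y0 - a)^2)"
      by linarith
  qed
  also have "2 * K / ?l = (4 * sqrt (K * R1) / \<alpha>)^2"
    using pos by (simp add: power_divide power_mult_distrib field_simps)
  also have "sqrt ... = 4 * sqrt (K * R1) / \<alpha>"
    using pos by (simp only: real_sqrt_abs) simp
  finally show ?thesis by simp
qed

text \<open>
  If \<^term>\<open>p\<close> is large, the curvature of the second circle suffices. Otherwise its unit normal is
  nearly parallel to the axis of the slice, while that of the first circle is not, and the level
  function is strictly monotone on either side of \<^term>\<open>y0\<close>.
\<close>

lemma slice_bound_second:
  fixes S :: "real set"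
  assumes bdd: "bdd_above S" "bdd_below S" and pos: "0 < K" "0 < N" "1 \<le> M" "0 < \<alpha>" "\<alpha> \<le> 1"
    and S: "\<And>y. y \<in> S \<Longrightarrow> 0 < sqrt (x^2 + y^2) \<and> \<bar>y\<bar> \<le> (1 - \<alpha>^2/4) * sqrt (x^2 + y^2)
       \<and> N / M \<le> sqrt (p^2 + (y0 - y)^2) \<and> sqrt (p^2 + (y0 - y)^2) \<le> M * N
       \<and> \<bar>sqrt (x^2 + y^2) + sqrt (p^2 + (y0 - y)^2) - \<sigma>\<bar> \<le> K"
    and meas: "S \<in> sets borel"
  shows "emeasure lborel S \<le> ennreal (32 * sqrt (K * (M^5 * N)) / \<alpha>)"
proof (cases "\<alpha> * N / (4 * M) \<le> \<bar>p\<bar>")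
  case True
  \<comment> \<open>The remainder coefficient of \<open>norm2_tangent\<close> for the second
    summand, with \<open>|p|\<close> at its lower bound \<open>\<alpha> * N / (4 * M)\<close> and
    both radii at their upper bound \<open>M * N\<close>; this is the origin of
    \<open>M^5\<close>.\<close>
  let ?l = "\<alpha>^2 / (32 * M^5 * N)"
  have l: "0 < ?l" using pos by simp
  have D: "(u - v) * (a - b) = u * (a - b) + v * ((y0 - a) - (y0 - b))" for u v a b :: real
    by (simp add: algebra_simps)
  have quot: "?l * d = (\<alpha> * N / (4 * M))^2 * d / (2 * (M * N)^2 * (M * N))" for d
    using pos by (simp add: divide_simps) (simp add: power2_eq_square eval_nat_numeral)
  have r2: "0 < sqrt (p^2 + (y0 - y)^2)" if "y \<in> S" for y
    by (rule less_le_trans[of 0 "N / M"]) (use S[OF that] pos in auto)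
  have "emeasure lborel S \<le> ennreal (4 * sqrt (2 * K / ?l))"
  proof (rule emeasure_strongly_convex_level[OF bdd pos(1) l])
    show "\<bar>(sqrt (x^2 + y^2) + sqrt (p^2 + (y0 - y)^2)) - \<sigma>\<bar> \<le> K" if "y \<in> S" for y
      using S[OF that] by simp
    fix a b assume a: "a \<in> S" and b: "b \<in> S"
    let ?D = "\<lambda>b. b / sqrt (x^2 + b^2) - (y0 - b) / sqrt (p^2 + (y0 - b)^2)"
    have "?l * (a - b)^2 \<le> p^2 * (a - b)^2 / (2 * (sqrt (p^2 + (y0 - b)^2))^2 * sqrt (p^2 + (y0 - a)^2))"
    proof -
      have "?l * (a - b)^2 = (\<alpha> * N / (4 * M))^2 * (a - b)^2 / (2 * (M * N)^2 * (M * N))"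
        by (rule quot)
      also have "... \<le> p^2 * (a - b)^2 / (2 * (M * N)^2 * (M * N))"
        using power_mono[OF True, of 2] pos by (intro divide_right_mono mult_right_mono) auto
      also have "... \<le> p^2 * (a - b)^2 / (2 * (sqrt (p^2 + (y0 - b)^2))^2 * sqrt (p^2 + (y0 - a)^2))"
        using S[OF a] S[OF b] r2[OF a] r2[OF b] pos
        by (intro divide_left_mono mult_mono mult_pos_pos power_mono) auto
      finally show ?thesis .
    qed
    moreover have "sqrt (x^2 + b^2) + b / sqrt (x^2 + b^2) * (a - b) \<le> sqrt (x^2 + a^2)"
      by (rule norm2_convex)
    moreover have "sqrt (p^2 + (y0 - b)^2) + (y0 - b) / sqrt (p^2 + (y0 - b)^2) * ((y0 - a) - (y0 - b))
        + p^2 * (a - b)^2 / (2 * (sqrt (p^2 + (y0 - b)^2))^2 * sqrt (p^2 + (y0 - a)^2)) \<le> sqrt (p^2 + (y0 - a)^2)"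
    proof -
      have "((y0 - a) - (y0 - b))^2 = (a - b)^2" by (simp add: power2_commute)
      then show ?thesis using norm2_tangent[OF r2[OF b] r2[OF a]] by simp
    qed
    moreover have "?D b * (a - b) = b / sqrt (x^2 + b^2) * (a - b) + (y0 - b) / sqrt (p^2 + (y0 - b)^2) * ((y0 - a) - (y0 - b))"
      by (rule D)
    ultimately show "sqrt (x^2 + b^2) + sqrt (p^2 + (y0 - b)^2) + ?D b * (a - b) + ?l * (a - b)^2
        \<le> sqrt (x^2 + a^2) + sqrt (p^2 + (y0 - a)^2)"
      by linarith
  qed
  also have "2 * K / ?l = (8 * sqrt (K * (M^5 * N)) / \<alpha>)^2"
    using pos by (simp add: power_divide power_mult_distrib field_simps)
  also have "sqrt ... = 8 * sqrt (K * (M^5 * N)) / \<alpha>"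
    using pos by (simp only: real_sqrt_abs) simp
  finally show ?thesis by simp
next
  case False
  have \<alpha>2: "\<alpha>^2 \<le> 1" using pos by (simp add: power_le_one)
  \<comment> \<open>With \<open>p\<close> small the second radius is almost entirely
    \<open>|y0 - y|\<close>. The threshold for \<open>p\<close> is set so that 1/16 stands against
    the 1/4 of the angle condition, leaving a gap of \<open>3 * \<alpha>^2 / 16\<close> between the
    two slopes.\<close>
  have z: "(1 - \<alpha>^2/16) * sqrt (p^2 + (y0 - y)^2) \<le> \<bar>y0 - y\<bar>" if "y \<in> S" for y
  proof (rule power2_le_imp_le)
    define r where "r = sqrt (p^2 + (y0 - y)^2)"
    have r2: "r^2 = p^2 + (y0 - y)^2" and r0: "0 \<le> r" by (simp_all add: r_def)
    have "\<bar>p\<bar> \<le> (\<alpha> / 4) * (N / M)" using False by simp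
    also have "... \<le> (\<alpha> / 4) * r" using S[OF that] pos by (intro mult_left_mono) (auto simp: r_def)
    finally have "\<bar>p\<bar>^2 \<le> ((\<alpha> / 4) * r)^2" by (intro power_mono) auto
    then have p: "p^2 \<le> \<alpha>^2/16 * r^2" by (simp add: power_mult_distrib power_divide)
    have "(1 - \<alpha>^2/16)^2 \<le> 1 - \<alpha>^2/16"
      using \<alpha>2 by (simp add: power2_eq_square mult_left_le)
    then have "((1 - \<alpha>^2/16) * r)^2 \<le> (1 - \<alpha>^2/16) * r^2"
      unfolding power_mult_distrib by (intro mult_right_mono) auto
    also have "... \<le> (y0 - y)^2" using p r2 by (simp add: algebra_simps)
    finally show "((1 - \<alpha>^2/16) * sqrt (p^2 + (y0 - y)^2))^2 \<le> \<bar>y0 - y\<bar>^2"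
      by (simp add: r_def)
  qed simp
  have zle: "\<bar>y0 - y\<bar> \<le> M * N" if "y \<in> S" for y
  proof -
    have "\<bar>y0 - y\<bar> \<le> sqrt (p^2 + (y0 - y)^2)" by (rule real_le_rsqrt) simp
    then show ?thesis using S[OF that] by linarith
  qed
  \<comment> \<open>Two bounds for the diameter of a branch, one from monotonicity and one from the
    size of the second radius. Neither alone has the right form, but their geometric mean is of
    order \<open>sqrt (K * N) / \<alpha>\<close> for fixed \<open>M\<close>.\<close>
  let ?d = "min (16 * K / \<alpha>^2) (M * N)"
  have d0: "0 \<le> ?d" using pos by simp
  \<comment> \<open>The sign \<open>t\<close> selects a side of \<open>y0\<close>, on which
    \<open>t * (y - y0)\<close> is \<open>|y - y0|\<close>; the slope of the second summand changes
    sign at \<open>y0\<close>.\<close>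
  have branch: "emeasure lborel (S \<inter> {y. 0 < t * (y - y0)}) \<le> ennreal ?d" if t: "t = 1 \<or> t = -1" for t :: real
  proof (rule emeasure_le_diameter)
    show "bdd_above (S \<inter> {y. 0 < t * (y - y0)})" using bdd by (auto intro: bdd_above_mono)
    have mono: "\<bar>b - a\<bar> \<le> 16 * K / \<alpha>^2" if a: "a \<in> S" "0 < t * (a - y0)" and b: "b \<in> S" "0 < t * (b - y0)" and ab: "t * a < t * b" for a b
    proof -
      define ra where "ra = sqrt (x^2 + a^2)"
      define rb where "rb = sqrt (x^2 + b^2)"
      define qa where "qa = sqrt (p^2 + (y0 - a)^2)"
      define qb where "qb = sqrt (p^2 + (y0 - b)^2)"
      define e where "e = t * b - t * a"
      have e: "0 < e" "e = \<bar>b - a\<bar>" using ab t by (auto simp: e_def)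
      have r: "0 < ra" "0 < rb" "\<bar>a\<bar> \<le> (1 - \<alpha>^2/4) * ra" "\<bar>b\<bar> \<le> (1 - \<alpha>^2/4) * rb"
        using S[OF a(1)] S[OF b(1)] by (auto simp: ra_def rb_def)
      have q0: "0 < qa" "0 < qb"
      proof -
        have "N / M \<le> qa" "N / M \<le> qb" using S[OF a(1)] S[OF b(1)] by (auto simp: qa_def qb_def)
        moreover have "0 < N / M" using pos by simp
        ultimately show "0 < qa" "0 < qb" by linarith+
      qed
      have q: "(1 - \<alpha>^2/16) * qa \<le> t * (a - y0)" "(1 - \<alpha>^2/16) * qb \<le> t * (b - y0)"
        using z[OF a(1)] z[OF b(1)] a(2) b(2) t by (auto simp: qa_def qb_def)
      have sq: "ra^2 = x^2 + a^2" "rb^2 = x^2 + b^2" "qa^2 = p^2 + (y0 - a)^2" "qb^2 = p^2 + (y0 - b)^2"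
        by (simp_all add: ra_def rb_def qa_def qb_def)
      \<comment> \<open>Differences of squares replace derivatives: per unit length the first radius
        changes by at most \<open>1 - \<alpha>^2/4\<close>, while the second grows away from
        \<open>y0\<close> by at least \<open>1 - \<alpha>^2/16\<close>.\<close>
      have "(rb - ra) * (rb + ra) = (b - a) * (b + a)"
        using sq by (simp add: power2_eq_square algebra_simps)
      then have "\<bar>rb - ra\<bar> * (rb + ra) = e * \<bar>b + a\<bar>"
        using r e by (metis abs_mult abs_of_pos add_pos_pos)
      also have "... \<le> e * ((1 - \<alpha>^2/4) * (rb + ra))"
      proof (rule mult_left_mono)
        show "\<bar>b + a\<bar> \<le> (1 - \<alpha>^2/4) * (rb + ra)" using r(3,4) unfolding distrib_left by linarith
      qed (use e in simp)
      finally have 1: "\<bar>rb - ra\<bar> \<le> e * (1 - \<alpha>^2/4)"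
        using r mult_le_cancel_right_pos[of "rb + ra" "\<bar>rb - ra\<bar>" "e * (1 - \<alpha>^2/4)"] by (simp add: mult.assoc)
      have "(qb - qa) * (qb + qa) = e * (t * (b - y0) + t * (a - y0))"
        using sq t by (auto simp: e_def power2_eq_square algebra_simps)
      also have "... \<ge> e * ((1 - \<alpha>^2/16) * (qb + qa))"
      proof (rule mult_left_mono)
        show "(1 - \<alpha>^2/16) * (qb + qa) \<le> t * (b - y0) + t * (a - y0)" using q unfolding distrib_left by linarith
      qed (use e in simp)
      finally have 2: "e * (1 - \<alpha>^2/16) \<le> qb - qa"
        using q0 mult_le_cancel_right_pos[of "qb + qa" "e * (1 - \<alpha>^2/16)" "qb - qa"] by (simp add: mult.assoc)
      have "(rb + qb) - (ra + qa) \<le> 2 * K"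
        using S[OF a(1)] S[OF b(1)] by (auto simp: ra_def rb_def qa_def qb_def)
      then have "e * (3 * \<alpha>^2/16) \<le> 2 * K" using 1 2 by (simp add: algebra_simps)
      moreover have "e * (\<alpha>^2/8) \<le> e * (3 * \<alpha>^2/16)" using e by (intro mult_left_mono) auto
      ultimately have "e * (\<alpha>^2/8) \<le> 2 * K" by linarith
      then show ?thesis using pos e by (simp add: field_simps)
    qed
    fix a b assume "a \<in> S \<inter> {y. 0 < t * (y - y0)}" "b \<in> S \<inter> {y. 0 < t * (y - y0)}"
    then have a: "a \<in> S" "0 < t * (a - y0)" and b: "b \<in> S" "0 < t * (b - y0)" by auto
    have "b - a \<le> 16 * K / \<alpha>^2"
    proof -
      have "0 \<le> 16 * K / \<alpha>^2" using pos by simp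
      then show ?thesis
        using mono[OF a b] mono[OF b a] by (cases "t * a" "t * b" rule: linorder_cases) (use t in auto)
    qed
    moreover have "b - a \<le> M * N"
      using zle[OF a(1)] zle[OF b(1)] a(2) b(2) t by auto
    ultimately show "b - a \<le> ?d" by simp
  qed (rule d0)
  have d: "?d \<le> 4 * sqrt (K * (M^5 * N)) / \<alpha>"
  proof -
    \<comment> \<open>The square of a minimum is at most the product of its entries.\<close>
    have "?d^2 \<le> (16 * K / \<alpha>^2) * (M * N)"
      unfolding power2_eq_square using pos by (intro mult_mono) auto
    also have "... \<le> (16 * K / \<alpha>^2) * (M^5 * N)"
      using pos power_increasing[of 1 5 M] by (intro mult_left_mono mult_right_mono) auto
    also have "... = (4 * sqrt (K * (M^5 * N)) / \<alpha>)^2"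
      using pos by (simp add: power_divide power_mult_distrib)
    finally show ?thesis by (rule power2_le_imp_le) (use pos in auto)
  qed
  have "S \<inter> {y. y \<noteq> y0} = (S \<inter> {y. 0 < 1 * (y - y0)}) \<union> (S \<inter> {y. 0 < -1 * (y - y0)})" by auto
  moreover have "S \<inter> {y. 0 < t * (y - y0)} \<in> sets lborel" for t
    using meas by (simp add: sets.Int borel_open open_Collect_less continuous_intros)
  ultimately have "emeasure lborel (S \<inter> {y. y \<noteq> y0}) \<le> emeasure lborel (S \<inter> {y. 0 < 1 * (y - y0)}) + emeasure lborel (S \<inter> {y. 0 < -1 * (y - y0)})"
    by (simp only: emeasure_subadditive)
  also have "... \<le> ennreal ?d + ennreal ?d"
    by (rule add_mono[OF branch branch]) simp_all
  also have "... = ennreal (?d + ?d)"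
    by (rule ennreal_plus[OF d0 d0, symmetric])
  also have "... \<le> ennreal (32 * sqrt (K * (M^5 * N)) / \<alpha>)"
  proof (rule ennreal_leI)
    have "0 \<le> sqrt (K * (M^5 * N)) / \<alpha>" using pos by simp
    then show "?d + ?d \<le> 32 * sqrt (K * (M^5 * N)) / \<alpha>" using d by linarith
  qed
  also have "emeasure lborel (S \<inter> {y. y \<noteq> y0}) = emeasure lborel S"
    using AE_lborel_singleton[of y0] meas by (intro emeasure_eq_AE) auto
  finally show ?thesis .
qed

section \<open>Orthonormal frames in the plane and the angle condition\<close>

definition perp :: "real^2 \<Rightarrow> real^2" where
  "perp \<omega> = vector [- \<omega> $ 2, \<omega> $ 1]"

lemma inner_real2: "(x::real^2) \<bullet> y = x $ 1 * y $ 1 + x $ 2 * y $ 2"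
  by (simp add: inner_vec_def sum_2)

lemma inner_perp: "\<omega> \<bullet> perp \<omega> = 0"
  by (simp add: inner_real2 perp_def)

lemma norm_perp: "norm (perp \<omega>) = norm \<omega>"
  unfolding norm_eq_sqrt_inner by (simp add: inner_real2 perp_def)

lemma norm_eq_frame:
  assumes "norm (\<omega>::real^2) = 1"
  shows "norm \<xi> = sqrt ((\<xi> \<bullet> \<omega>)^2 + (\<xi> \<bullet> perp \<omega>)^2)"
proof -
  have "\<omega> \<bullet> \<omega> = 1" using assms by (simp add: norm_eq_1)
  then have w: "\<omega> $ 1 * \<omega> $ 1 + \<omega> $ 2 * \<omega> $ 2 = 1" by (simp add: inner_real2)
  have "(\<xi> \<bullet> \<omega>)^2 + (\<xi> \<bullet> perp \<omega>)^2 = (\<xi> $ 1 * \<xi> $ 1 + \<xi> $ 2 * \<xi> $ 2) * (\<omega> $ 1 * \<omega> $ 1 + \<omega> $ 2 * \<omega> $ 2)"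
    by (simp add: inner_real2 perp_def power2_eq_square algebra_simps)
  also have "... = \<xi> \<bullet> \<xi>" by (simp add: w inner_real2)
  finally show ?thesis by (simp add: norm_eq_sqrt_inner)
qed

lemma Basis_real2: "(Basis :: (real^2) set) = {axis 1 1, axis 2 1}"
  by (auto simp: Basis_vec_def UNIV_2)

lemma Basis_real_prod: "(Basis :: (real \<times> real) set) = {(1, 0), (0, 1)}"
  by (auto simp: Basis_prod_def)

text \<open>Rotation invariance of Lebesgue measure, in a form that delivers pairs so that Fubini
  applies to the two frame coordinates. Comparing boxes suffices.\<close>

lemma lborel_distr_frame:
  assumes w: "norm (\<omega>::real^2) = 1"
  shows "distr lborel borel (\<lambda>\<xi>. (\<xi> \<bullet> \<omega>, \<xi> \<bullet> perp \<omega>)) = lborel"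
proof (rule lborel_eqI[symmetric])
  fix l u :: "real \<times> real"
  assume le: "\<And>b. b \<in> Basis \<Longrightarrow> l \<bullet> b \<le> u \<bullet> b"
  have le: "fst l \<le> fst u" "snd l \<le> snd u"
    using le[of "(1, 0)"] le[of "(0, 1)"] by (auto simp: Basis_real_prod inner_prod_def)
  \<comment> \<open>The same coordinate map with values in \<open>real^2\<close>, where invariance
    of the measure under orthogonal transformations applies.\<close>
  define O' :: "real^2 \<Rightarrow> real^2" where "O' \<xi> = vector [\<xi> \<bullet> \<omega>, \<xi> \<bullet> perp \<omega>]" for \<xi>
  define B :: "(real^2) set" where "B = box (vector [fst l, snd l]) (vector [fst u, snd u])"
  have lin: "linear O'"
    by (rule linearI) (auto simp: O'_def vec_eq_iff forall_2 inner_add_left)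
  have O_norm: "norm (O' \<xi>) = norm \<xi>" for \<xi>
    unfolding norm_eq_frame[OF w, of \<xi>] by (simp add: O'_def norm_eq_sqrt_inner inner_real2 power2_eq_square)
  have O_orth: "orthogonal_transformation O'"
    using lin O_norm by (simp add: orthogonal_transformation)
  have "continuous_on UNIV O'" using lin by (simp add: linear_continuous_on linear_linear)
  then have "open (O' -` B)" unfolding B_def by (intro open_vimage) auto
  moreover have "bounded (O' -` B)"
  proof -
    obtain C where "\<And>x. x \<in> B \<Longrightarrow> norm x \<le> C"
      using bounded_box unfolding B_def bounded_iff by blast
    then show ?thesis unfolding bounded_iff using O_norm by (metis vimageE)
  qed
  ultimately have S: "O' -` B \<in> lmeasurable" by (simp add: lmeasurable_open)
  have "surj O'" using O_orth by (rule orthogonal_transformation_surj)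
  then have "O' ` (O' -` B) = B" by (simp add: surj_image_vimage_eq)
  then have "measure lebesgue B = measure lebesgue (O' -` B)"
    using measure_orthogonal_image[OF O_orth S] by simp
  moreover have "measure lebesgue B = (fst u - fst l) * (snd u - snd l)"
    unfolding B_def using le
    by (simp add: measure_lborel_box_eq Basis_real2 inner_axis inner_axis' axis_eq_axis forall_2)
  moreover have vim: "(\<lambda>\<xi>. (\<xi> \<bullet> \<omega>, \<xi> \<bullet> perp \<omega>)) -` box l u = O' -` B"
    by (auto simp: B_def O'_def box_def Basis_real2 Basis_real_prod inner_axis inner_axis' inner_prod_def)
  moreover have "emeasure lborel (O' -` B) = emeasure lebesgue (O' -` B)"
    using \<open>open (O' -` B)\<close> by simp
  ultimately have "emeasure lborel (O' -` B) = ennreal ((fst u - fst l) * (snd u - snd l))"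
    using emeasure_eq_measure2[OF S] by simp
  then show "emeasure (distr lborel borel (\<lambda>\<xi>. (\<xi> \<bullet> \<omega>, \<xi> \<bullet> perp \<omega>))) (box l u) = ennreal (\<Prod>b\<in>Basis. (u - l) \<bullet> b)"
    by (subst emeasure_distr) (auto simp: vim Basis_real_prod inner_prod_def)
qed simp

lemma emeasure_frame:
  assumes "norm (\<omega>::real^2) = 1" and T: "T \<in> sets borel"
  shows "emeasure lborel {\<xi>. (\<xi> \<bullet> \<omega>, \<xi> \<bullet> perp \<omega>) \<in> T} = emeasure lborel T"
  using T by (subst lborel_distr_frame[OF assms(1), symmetric], subst emeasure_distr)
    (auto simp: vimage_def)

text \<open>Taylor expansion to fourth order: the remainder is at most \<open>x^2 / 24\<close>, well
  below the \<open>x^2 / 4\<close> given away.\<close>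

lemma cos_le_quadratic:
  fixes x :: real
  assumes "0 \<le> x" "x \<le> 1"
  shows "cos x \<le> 1 - x^2/4"
proof (cases "x = 0")
  case False
  then obtain t where t: "cos x = (\<Sum>m<4. cos_coeff m * x ^ m) + (cos (t + 1/2 * real 4 * pi) / fact 4) * x ^ 4"
    using Maclaurin_cos_expansion2[of x 4] assms by auto
  have "{..<4} = {0, 1, 2, 3::nat}" by auto
  then have "(\<Sum>m<4. cos_coeff m * x ^ m) = 1 - x^2/2"
    by (simp add: cos_coeff_def)
  moreover have "(cos (t + 1/2 * real 4 * pi) / fact 4) * x ^ 4 \<le> x^2/24"
  proof -
    have "(cos (t + 1/2 * real 4 * pi) / fact 4) * x ^ 4 \<le> (1 / 24) * x ^ 4"
      by (intro mult_right_mono) (auto simp: fact_numeral)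
    also have "x ^ 4 \<le> x^2" using assms by (intro power_decreasing) auto
    finally show ?thesis by simp
  qed
  moreover have "0 \<le> x^2" by simp
  ultimately show ?thesis using t by linarith
qed simp

text \<open>Turns the angle hypothesis into a closed algebraic condition. The infimum is compared
  with the angle to a single vector, \<open>perp \<omega>\<close> or its negative, whichever has
  nonnegative inner product with \<xi>; then \<open>cos\<close>, being decreasing, reverses the
  inequality.\<close>

lemma line_angle_bound:
  assumes w: "norm (\<omega>::real^2) = 1" and a: "0 < \<alpha>" "\<alpha> \<le> 1"
    and angle: "\<alpha> \<le> line_angle \<xi> (orthogonal_comp {\<omega>})"
  shows "\<bar>\<xi> \<bullet> perp \<omega>\<bar> \<le> (1 - \<alpha>^2/4) * norm \<xi>"
proof (cases "\<xi> = 0")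
  case False
  define v where "v = (if 0 \<le> \<xi> \<bullet> perp \<omega> then perp \<omega> else - perp \<omega>)"
  have v1: "norm v = 1" by (simp add: v_def norm_perp w)
  have mem: "v \<in> orthogonal_comp {\<omega>} - {0}"
    using v1 inner_perp[of \<omega>] by (auto simp: v_def orthogonal_comp_def orthogonal_def inner_commute)
  have "\<bar>x \<bullet> y / (norm x * norm y)\<bar> \<le> 1" for x y :: "real^2"
    using Cauchy_Schwarz_ineq2[of x y] by (auto simp: abs_mult divide_le_eq)
  then have cs: "- 1 \<le> x \<bullet> y / (norm x * norm y)" "x \<bullet> y / (norm x * norm y) \<le> 1" for x y :: "real^2"
    by (simp_all only: abs_le_iff minus_le_iff)
  have "bdd_below (vector_angle \<xi> ` (orthogonal_comp {\<omega>} - {0}))"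
    by (intro bdd_belowI[of _ 0]) (auto simp: vector_angle_def cs arccos_lbound)
  then have "line_angle \<xi> (orthogonal_comp {\<omega>}) \<le> vector_angle \<xi> v"
    unfolding line_angle_def using mem by (intro cINF_lower)
  then have "\<alpha> \<le> arccos (\<xi> \<bullet> v / (norm \<xi> * norm v))" using angle by (simp add: vector_angle_def)
  moreover have "arccos (\<xi> \<bullet> v / (norm \<xi> * norm v)) \<le> pi"
    by (intro arccos_ubound cs)
  ultimately have "cos (arccos (\<xi> \<bullet> v / (norm \<xi> * norm v))) \<le> cos \<alpha>"
    using a by (intro cos_monotone_0_pi_le) auto
  then have "\<xi> \<bullet> v / (norm \<xi> * norm v) \<le> 1 - \<alpha>^2/4"
    using cs[of \<xi> v] cos_le_quadratic[of \<alpha>] a by (simp add: cos_arccos)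
  then have "\<xi> \<bullet> v \<le> (1 - \<alpha>^2/4) * norm \<xi>" using v1 False by (simp add: divide_le_eq)
  then show ?thesis by (auto simp: v_def split: if_splits)
qed (simp add: perp_def)

text \<open>Source of the exponent 3/4: the excess \<open>x powr (1/4)\<close> is traded for
  \<open>y powr (1/4)\<close>. It serves for the smaller and the larger of the two
  thicknesses.\<close>

lemma mult_sqrt_le_powr:
  fixes x y :: real
  assumes "0 < x" "x \<le> y"
  shows "x * sqrt y \<le> (x * y) powr (3/4)"
proof -
  have "x * sqrt y = x powr (3/4) * x powr (1/4) * y powr (1/2)"
    using assms by (simp add: powr_add[symmetric] powr_half_sqrt)
  also have "... \<le> x powr (3/4) * y powr (1/4) * y powr (1/2)"
    using assms by (intro mult_right_mono mult_left_mono powr_mono2) auto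
  also have "... = (x * y) powr (3/4)"
    using assms by (simp add: powr_mult mult.assoc powr_add[symmetric])
  finally show ?thesis .
qed

section \<open>Volume of the overlap\<close>

text \<open>Fubini in the frame \<omega>, \<open>perp \<omega>\<close>: the strip contributes the
  factor \<open>d\<close>, and each slice is a level set on a line. The slice bound belonging to the
  smaller radius is selected, which yields \<open>min N1 N2\<close>.\<close>

lemma planar_overlap:
  fixes \<omega> x0 :: "real^2"
  assumes M: "1 \<le> M" and N: "0 < N1" "0 < N2" and K: "0 < K" and w: "norm \<omega> = 1"
    and a: "0 < \<alpha>" "\<alpha> \<le> 1" and d: "0 \<le> d"
  shows "emeasure lborel {\<xi>. N1 / M \<le> norm \<xi> \<and> norm \<xi> \<le> M * N1 \<and> \<bar>\<xi> \<bullet> perp \<omega>\<bar> \<le> (1 - \<alpha>^2/4) * norm \<xi>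
      \<and> \<xi> \<bullet> \<omega> \<in> {c..c + d} \<and> N2 / M \<le> norm (x0 - \<xi>) \<and> norm (x0 - \<xi>) \<le> M * N2
      \<and> \<bar>norm \<xi> + norm (x0 - \<xi>) - \<sigma>\<bar> \<le> K}
    \<le> ennreal (d * (32 * sqrt (K * (M^5 * min N1 N2)) / \<alpha>))"
proof -
  define p where "p = x0 \<bullet> \<omega>"
  define q where "q = x0 \<bullet> perp \<omega>"
  define T where "T = {z. N1 / M \<le> sqrt ((fst z)^2 + (snd z)^2) \<and> sqrt ((fst z)^2 + (snd z)^2) \<le> M * N1
     \<and> \<bar>snd z\<bar> \<le> (1 - \<alpha>^2/4) * sqrt ((fst z)^2 + (snd z)^2)
     \<and> c \<le> fst z \<and> fst z \<le> c + d \<and> N2 / M \<le> sqrt ((p - fst z)^2 + (q - snd z)^2) \<and> sqrt ((p - fst z)^2 + (q - snd z)^2) \<le> M * N2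
     \<and> \<bar>sqrt ((fst z)^2 + (snd z)^2) + sqrt ((p - fst z)^2 + (q - snd z)^2) - \<sigma>\<bar> \<le> K}"
  let ?B = "32 * sqrt (K * (M^5 * min N1 N2)) / \<alpha>"
  have "closed T" unfolding T_def
    by (intro closed_Collect_conj closed_Collect_le continuous_intros)
  then have T: "T \<in> sets borel" by (rule borel_closed)
  then have T': "T \<in> sets (lborel \<Otimes>\<^sub>M lborel)" unfolding lborel_prod by simp
  have "{\<xi>. N1 / M \<le> norm \<xi> \<and> norm \<xi> \<le> M * N1 \<and> \<bar>\<xi> \<bullet> perp \<omega>\<bar> \<le> (1 - \<alpha>^2/4) * norm \<xi>
      \<and> \<xi> \<bullet> \<omega> \<in> {c..c + d} \<and> N2 / M \<le> norm (x0 - \<xi>) \<and> norm (x0 - \<xi>) \<le> M * N2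
      \<and> \<bar>norm \<xi> + norm (x0 - \<xi>) - \<sigma>\<bar> \<le> K} = {\<xi>. (\<xi> \<bullet> \<omega>, \<xi> \<bullet> perp \<omega>) \<in> T}" (is "?P = _")
    unfolding T_def norm_eq_frame[OF w] by (auto simp: p_def q_def inner_diff_left)
  then have "emeasure lborel ?P = emeasure lborel T"
    using emeasure_frame[OF w T] by simp
  also have "... = (\<integral>\<^sup>+x. emeasure lborel (Pair x -` T) \<partial>lborel)"
    unfolding lborel_prod[symmetric] by (rule lborel.emeasure_pair_measure_alt[OF T'])
  also have "... \<le> (\<integral>\<^sup>+x. ennreal ?B * indicator {c..c + d} x \<partial>lborel)"
  proof (rule nn_integral_mono)
    fix x
    show "emeasure lborel (Pair x -` T) \<le> ennreal ?B * indicator {c..c + d} x"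
    proof (cases "x \<in> {c..c + d}")
      case True
      define S where "S = Pair x -` T"
      have meas: "S \<in> sets borel"
        unfolding S_def using \<open>closed T\<close> by (intro borel_closed closed_vimage continuous_intros)
      have S: "0 < sqrt (x^2 + y^2) \<and> sqrt (x^2 + y^2) \<le> M * N1 \<and> \<bar>y\<bar> \<le> (1 - \<alpha>^2/4) * sqrt (x^2 + y^2)
         \<and> N2 / M \<le> sqrt ((p - x)^2 + (q - y)^2) \<and> sqrt ((p - x)^2 + (q - y)^2) \<le> M * N2
         \<and> \<bar>sqrt (x^2 + y^2) + sqrt ((p - x)^2 + (q - y)^2) - \<sigma>\<bar> \<le> K" if "y \<in> S" for y
      proof -
        have "0 < N1 / M" using M N by simp
        then show ?thesis using that unfolding S_def T_def
          by (auto simp del: real_sqrt_gt_0_iff intro: less_le_trans)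
      qed
      have y: "\<bar>y\<bar> \<le> M * N1" if "y \<in> S" for y
      proof -
        have "\<bar>y\<bar> \<le> sqrt (x^2 + y^2)" by (rule real_le_rsqrt) simp
        then show ?thesis using S[OF that] by linarith
      qed
      have bdd: "bdd_above S" "bdd_below S"
        using y by (auto intro!: bdd_aboveI[of _ "M * N1"] bdd_belowI[of _ "- (M * N1)"] simp: abs_le_iff minus_le_iff)
      have "emeasure lborel S \<le> ennreal ?B"
      proof (cases "N1 \<le> N2")
        case True
        have "emeasure lborel S \<le> ennreal (16 * sqrt (K * (M * N1)) / \<alpha>)"
          by (rule slice_bound_first[OF bdd K _ a]) (use M N S in auto)
        also have "... \<le> ennreal ?B"
        proof (rule ennreal_leI)
          have "sqrt (K * (M * N1)) \<le> sqrt (K * (M^5 * min N1 N2))"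
            using True K N M power_increasing[of 1 5 M] by (simp add: min_def)
          moreover have "0 \<le> sqrt (K * (M * N1))" using K M N by simp
          ultimately have "16 * sqrt (K * (M * N1)) \<le> 32 * sqrt (K * (M^5 * min N1 N2))" by linarith
          then show "16 * sqrt (K * (M * N1)) / \<alpha> \<le> ?B" using a by (intro divide_right_mono) auto
        qed
        finally show ?thesis .
      next
        case False
        have "emeasure lborel S \<le> ennreal (32 * sqrt (K * (M^5 * N2)) / \<alpha>)"
          by (rule slice_bound_second[OF bdd K N(2) M a _ meas]) (use S in blast)
        then show ?thesis using False by (simp add: min_def)
      qed
      then show ?thesis using True by (simp add: S_def)
    next
      case False
      then have "Pair x -` T = {}" by (auto simp: T_def)
      then show ?thesis by simp
    qed
  qed
  also have "... = ennreal ?B * ennreal d"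
    using d by (subst nn_integral_cmult_indicator) auto
  also have "... = ennreal (d * ?B)"
    using d by (subst mult.commute, subst ennreal_mult') auto
  finally show ?thesis .
qed

text \<open>For fixed \<xi> the admissible \<tau> lie in two intervals, hence in a set no longer
  than the shorter one. Adding the two cone conditions eliminates \<tau> and leaves a level set of
  the sum of the norms, with tolerance of order \<open>max La Lb\<close>; the norms add because both
  cones carry the same sign \<open>s\<close>.\<close>

lemma thick_cone_overlap:
  fixes \<omega> :: "real^2" and \<eta> :: spacetime
  assumes M: "1 \<le> M" and N: "0 < N1" "0 < N2" and L: "0 < La" "0 < Lb" and s: "s = 1 \<or> s = -1"
    and w: "norm \<omega> = 1" and a: "0 < \<alpha>" "\<alpha> \<le> 1" and d: "0 \<le> d"
  shows "emeasure lborel {\<zeta>. \<zeta> \<in> thick_cone M s N1 La \<and> \<bar>snd \<zeta> \<bullet> perp \<omega>\<bar> \<le> (1 - \<alpha>^2/4) * norm (snd \<zeta>)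
      \<and> snd \<zeta> \<bullet> \<omega> \<in> {c..c + d} \<and> \<eta> - \<zeta> \<in> thick_cone M s N2 Lb}
    \<le> ennreal (128 * M^4 * d * sqrt (min N1 N2) * (La * Lb) powr (3/4) / \<alpha>)"
proof -
  obtain t0 x0 where \<eta>: "\<eta> = (t0, x0)" by (cases \<eta>)
  define E where "E = {\<zeta>. \<zeta> \<in> thick_cone M s N1 La \<and> \<bar>snd \<zeta> \<bullet> perp \<omega>\<bar> \<le> (1 - \<alpha>^2/4) * norm (snd \<zeta>)
      \<and> snd \<zeta> \<bullet> \<omega> \<in> {c..c + d} \<and> \<eta> - \<zeta> \<in> thick_cone M s N2 Lb}"
  define K where "K = M * (La + Lb)"
  have K: "0 < K" using M L by (simp add: K_def)
  define P where "P = {\<xi>. N1 / M \<le> norm \<xi> \<and> norm \<xi> \<le> M * N1 \<and> \<bar>\<xi> \<bullet> perp \<omega>\<bar> \<le> (1 - \<alpha>^2/4) * norm \<xi>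
      \<and> \<xi> \<bullet> \<omega> \<in> {c..c + d} \<and> N2 / M \<le> norm (x0 - \<xi>) \<and> norm (x0 - \<xi>) \<le> M * N2
      \<and> \<bar>norm \<xi> + norm (x0 - \<xi>) - s * t0\<bar> \<le> K}"
  have E_iff: "E = {\<zeta>. N1 / M \<le> norm (snd \<zeta>) \<and> norm (snd \<zeta>) \<le> M * N1 \<and> \<bar>fst \<zeta> - s * norm (snd \<zeta>)\<bar> \<le> M * La
      \<and> \<bar>snd \<zeta> \<bullet> perp \<omega>\<bar> \<le> (1 - \<alpha>^2/4) * norm (snd \<zeta>) \<and> c \<le> snd \<zeta> \<bullet> \<omega> \<and> snd \<zeta> \<bullet> \<omega> \<le> c + d
      \<and> N2 / M \<le> norm (x0 - snd \<zeta>) \<and> norm (x0 - snd \<zeta>) \<le> M * N2 \<and> \<bar>(t0 - fst \<zeta>) - s * norm (x0 - snd \<zeta>)\<bar> \<le> M * Lb}"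
    unfolding E_def thick_cone_def \<eta> by auto
  have "closed E" unfolding E_iff
    by (intro closed_Collect_conj closed_Collect_le continuous_intros)
  then have E: "E \<in> sets (lborel \<Otimes>\<^sub>M lborel)" unfolding lborel_prod by (simp add: borel_closed)
  have P: "P \<in> sets borel"
  proof (rule borel_closed)
    show "closed P" unfolding P_def atLeastAtMost_iff
      by (intro closed_Collect_conj closed_Collect_le continuous_intros)
  qed
  have m: "0 < min La Lb" using L by simp
  have "emeasure lborel E = (\<integral>\<^sup>+\<xi>. emeasure lborel ((\<lambda>\<tau>. (\<tau>, \<xi>)) -` E) \<partial>lborel)"
    unfolding lborel_prod[symmetric] by (rule lborel_pair.emeasure_pair_measure_alt2[OF E])
  also have "... \<le> (\<integral>\<^sup>+\<xi>. ennreal (2 * M * min La Lb) * indicator P \<xi> \<partial>lborel)"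
  proof (rule nn_integral_mono)
    fix \<xi>
    let ?S = "(\<lambda>\<tau>. (\<tau>, \<xi>)) -` E"
    show "emeasure lborel ?S \<le> ennreal (2 * M * min La Lb) * indicator P \<xi>"
    proof (cases "?S = {}")
      case False
      then obtain \<tau> where \<tau>: "(\<tau>, \<xi>) \<in> E" by auto
      have "\<bar>norm \<xi> + norm (x0 - \<xi>) - s * t0\<bar> \<le> K"
      proof -
        have "\<bar>\<tau> - s * norm \<xi>\<bar> \<le> M * La" "\<bar>(t0 - \<tau>) - s * norm (x0 - \<xi>)\<bar> \<le> M * Lb"
          using \<tau> by (auto simp: E_iff)
        then show ?thesis using s by (auto simp: K_def distrib_left abs_le_iff)
      qed
      then have "\<xi> \<in> P" using \<tau> by (auto simp: E_iff P_def)
      have 1: "?S \<subseteq> {s * norm \<xi> - M * La..s * norm \<xi> + M * La}"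
        "?S \<subseteq> {t0 - s * norm (x0 - \<xi>) - M * Lb..t0 - s * norm (x0 - \<xi>) + M * Lb}"
        by (auto simp: E_iff abs_le_iff)
      have "emeasure lborel ?S \<le> ennreal (2 * M * La)" "emeasure lborel ?S \<le> ennreal (2 * M * Lb)"
        using emeasure_mono[OF 1(1), of lborel] emeasure_mono[OF 1(2), of lborel] M L by (auto simp: mult_ac)
      then show ?thesis using \<open>\<xi> \<in> P\<close> by (auto simp: min_def)
    qed simp
  qed
  also have "... = ennreal (2 * M * min La Lb) * emeasure lborel P"
    using P by (subst nn_integral_cmult_indicator) auto
  also have "... \<le> ennreal (2 * M * min La Lb) * ennreal (d * (32 * sqrt (K * (M^5 * min N1 N2)) / \<alpha>))"
    unfolding P_def by (intro mult_left_mono planar_overlap M N K w a d) auto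
  also have "... = ennreal (2 * M * min La Lb * (d * (32 * sqrt (K * (M^5 * min N1 N2)) / \<alpha>)))"
    using M m by (subst ennreal_mult') auto
  also have "... \<le> ennreal (128 * M^4 * d * sqrt (min N1 N2) * (La * Lb) powr (3/4) / \<alpha>)"
  proof (rule ennreal_leI)
    \<comment> \<open>A factor 2 would be enough here; 4 completes \<open>4 * M^6\<close> to the
      square of \<open>2 * M^3\<close>.\<close>
    have "K \<le> M * (4 * max La Lb)" unfolding K_def using M L by (intro mult_left_mono) auto
    then have "K * (M^5 * min N1 N2) \<le> M * (4 * max La Lb) * (M^5 * min N1 N2)"
      using M N by (intro mult_right_mono) auto
    also have "... = (2 * M^3)^2 * (max La Lb * min N1 N2)"
      by (simp add: eval_nat_numeral)
    finally have "sqrt (K * (M^5 * min N1 N2)) \<le> sqrt ((2 * M^3)^2 * (max La Lb * min N1 N2))"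
      by simp
    also have "... = 2 * M^3 * (sqrt (max La Lb) * sqrt (min N1 N2))"
      using M by (simp only: real_sqrt_mult real_sqrt_abs) simp
    finally have "2 * M * min La Lb * (d * (32 * sqrt (K * (M^5 * min N1 N2)) / \<alpha>))
      \<le> 2 * M * min La Lb * (d * (32 * (2 * M^3 * (sqrt (max La Lb) * sqrt (min N1 N2))) / \<alpha>))"
      using M m d a by (intro mult_left_mono divide_right_mono) auto
    also have "... = 128 * M^4 * d * sqrt (min N1 N2) * (min La Lb * sqrt (max La Lb)) / \<alpha>"
      by (simp add: eval_nat_numeral)
    also have "... \<le> 128 * M^4 * d * sqrt (min N1 N2) * (La * Lb) powr (3/4) / \<alpha>"
    proof -
      have "min La Lb * sqrt (max La Lb) \<le> (min La Lb * max La Lb) powr (3/4)"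
        using L by (intro mult_sqrt_le_powr) auto
      also have "min La Lb * max La Lb = La * Lb" by (simp add: min_def max_def)
      finally show ?thesis using M d a N by (intro divide_right_mono mult_left_mono) auto
    qed
    finally show "2 * M * min La Lb * (d * (32 * sqrt (K * (M^5 * min N1 N2)) / \<alpha>))
      \<le> 128 * M^4 * d * sqrt (min N1 N2) * (La * Lb) powr (3/4) / \<alpha>" .
  qed
  finally show ?thesis unfolding E_def .
qed

section \<open>Convolution\<close>

lemma nn_integral_Cauchy_Schwarz_square:
  fixes f g :: "'a \<Rightarrow> ennreal"
  assumes [measurable]: "f \<in> borel_measurable M" "g \<in> borel_measurable M"
  shows "(\<integral>\<^sup>+x. f x * g x \<partial>M)^2 \<le> (\<integral>\<^sup>+x. f x ^ 2 \<partial>M) * (\<integral>\<^sup>+x. g x ^ 2 \<partial>M)"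
proof -
  define A where "A = (\<integral>\<^sup>+x. f x ^ 2 \<partial>M)"
  define B where "B = (\<integral>\<^sup>+x. g x ^ 2 \<partial>M)"
  consider "A = 0" | "B = 0" | "A \<noteq> 0" "B \<noteq> 0" "A = top \<or> B = top" | "A \<noteq> top" "B \<noteq> top" by blast
  then show ?thesis
  proof cases
    case 1
    then have "AE x in M. f x = 0" by (simp add: A_def nn_integral_0_iff_AE)
    then have "AE x in M. f x * g x = 0" by eventually_elim simp
    then have "(\<integral>\<^sup>+x. f x * g x \<partial>M) = 0" by (simp add: nn_integral_0_iff_AE)
    then show ?thesis by simp
  next
    case 2
    then have "AE x in M. g x = 0" by (simp add: B_def nn_integral_0_iff_AE)
    then have "AE x in M. f x * g x = 0" by eventually_elim simp
    then have "(\<integral>\<^sup>+x. f x * g x \<partial>M) = 0" by (simp add: nn_integral_0_iff_AE)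
    then show ?thesis by simp
  next
    case 3
    then have "A * B = top" by (auto simp: ennreal_mult_eq_top_iff)
    then show ?thesis unfolding A_def B_def by simp
  next
    case 4
    then obtain x y where xy: "A = ennreal x" "0 \<le> x" "B = ennreal y" "0 \<le> y"
      by (cases A; cases B) auto
    have "(\<integral>\<^sup>+x. f x * g x \<partial>M) \<le> ennreal (sqrt x * sqrt y)"
      by (rule nn_integral_Cauchy_Schwarz) (use xy in \<open>auto simp: A_def B_def\<close>)
    then have "(\<integral>\<^sup>+x. f x * g x \<partial>M)^2 \<le> (ennreal (sqrt x * sqrt y))^2"
      by (rule power_mono) simp
    also have "... = A * B"
      using xy by (simp add: ennreal_power power_mult_distrib ennreal_mult)
    finally show ?thesis unfolding A_def B_def .
  qed
qed

text \<open>After expanding the square, each mixed term is handled by Cauchy-Schwarz in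
  \<open>x\<close>, and the resulting sum of \<open>sqrt (a k) * sqrt (b k)\<close> by
  Cauchy-Schwarz in \<open>k\<close>. The number of summands does not enter, so cutting into many
  strips costs only their overlap.\<close>

lemma nn_integral_Minkowski_sum:
  fixes h :: "'k \<Rightarrow> 'a \<Rightarrow> ennreal" and a b :: "'k \<Rightarrow> real"
  assumes [measurable]: "\<And>k. k \<in> K \<Longrightarrow> h k \<in> borel_measurable M"
    and pos: "0 \<le> C" "\<And>k. k \<in> K \<Longrightarrow> 0 \<le> a k" "\<And>k. k \<in> K \<Longrightarrow> 0 \<le> b k"
    and bound: "\<And>k. k \<in> K \<Longrightarrow> (\<integral>\<^sup>+x. h k x ^ 2 \<partial>M) \<le> ennreal (C * (a k * b k))"
  shows "(\<integral>\<^sup>+x. (\<Sum>k\<in>K. h k x)^2 \<partial>M) \<le> ennreal (C * ((\<Sum>k\<in>K. a k) * (\<Sum>k\<in>K. b k)))"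
proof -
  define s where "s k = sqrt (a k) * sqrt (b k)" for k
  have s0: "0 \<le> s k" if "k \<in> K" for k using pos that by (simp add: s_def)
  have "(\<integral>\<^sup>+x. (\<Sum>k\<in>K. h k x)^2 \<partial>M) = (\<Sum>k\<in>K. \<Sum>l\<in>K. \<integral>\<^sup>+x. h k x * h l x \<partial>M)"
    by (simp add: power2_eq_square sum_product nn_integral_sum)
  also have "... \<le> (\<Sum>k\<in>K. \<Sum>l\<in>K. ennreal (C * (s k * s l)))"
  proof (intro sum_mono)
    fix k l assume kl: "k \<in> K" "l \<in> K"
    have eq: "C * (a i * b i) = (sqrt C * s i)^2" if "i \<in> K" for i
      using pos that by (simp add: s_def power_mult_distrib)
    have "(\<integral>\<^sup>+x. h k x * h l x \<partial>M) \<le> ennreal ((sqrt C * s k) * (sqrt C * s l))"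
      using kl bound[OF kl(1)] bound[OF kl(2)] pos s0[OF kl(1)] s0[OF kl(2)]
      by (intro nn_integral_Cauchy_Schwarz) (auto simp only: eq intro!: mult_nonneg_nonneg, auto)
    also have "(sqrt C * s k) * (sqrt C * s l) = C * (s k * s l)"
      using pos by (simp add: algebra_simps)
    finally show "(\<integral>\<^sup>+x. h k x * h l x \<partial>M) \<le> ennreal (C * (s k * s l))" .
  qed
  also have "... = (\<Sum>k\<in>K. ennreal (\<Sum>l\<in>K. C * (s k * s l)))"
    by (intro sum.cong refl sum_ennreal) (use pos s0 in auto)
  also have "... = ennreal (\<Sum>k\<in>K. \<Sum>l\<in>K. C * (s k * s l))"
    by (intro sum_ennreal sum_nonneg) (use pos s0 in auto)
  also have "(\<Sum>k\<in>K. \<Sum>l\<in>K. C * (s k * s l)) = C * (\<Sum>k\<in>K. s k)^2"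
    unfolding power2_eq_square sum_product by (simp only: sum_distrib_left)
  also have "... \<le> C * ((\<Sum>k\<in>K. a k) * (\<Sum>k\<in>K. b k))"
  proof (intro mult_left_mono pos)
    have "(\<Sum>k\<in>K. s k)^2 \<le> (\<Sum>k\<in>K. (sqrt (a k))^2) * (\<Sum>k\<in>K. (sqrt (b k))^2)"
      unfolding s_def by (rule Cauchy_Schwarz_ineq_sum)
    then show "(\<Sum>k\<in>K. s k)^2 \<le> (\<Sum>k\<in>K. a k) * (\<Sum>k\<in>K. b k)"
      using pos by (simp cong: sum.cong)
  qed
  finally show ?thesis by (simp add: ennreal_leI)
qed

text \<open>With values in \<open>ennreal\<close>, squares can be expanded and integrals exchanged
  without integrability conditions; it is applied to moduli.\<close>

definition econv :: "('a::euclidean_space \<Rightarrow> ennreal) \<Rightarrow> ('a \<Rightarrow> ennreal) \<Rightarrow> 'a \<Rightarrow> ennreal" where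
  "econv f g \<eta> = (\<integral>\<^sup>+\<zeta>. f \<zeta> * g (\<eta> - \<zeta>) \<partial>lborel)"

lemma econv_measurable [measurable]:
  assumes [measurable]: "f \<in> borel_measurable borel" "g \<in> borel_measurable borel"
  shows "econv f g \<in> borel_measurable borel"
  unfolding econv_def[abs_def] by measurable

text \<open>Cauchy-Schwarz against the indicator of the set of \<zeta> where the integrand can be
  nonzero. The measure of this set is at most \<open>C\<close> for every \<eta>, and Tonelli with
  translation invariance factors what remains.\<close>

lemma econv_square_bound:
  fixes f g :: "'a::euclidean_space \<Rightarrow> ennreal"
  assumes [measurable]: "f \<in> borel_measurable borel" "g \<in> borel_measurable borel"
    and S [measurable]: "S \<in> sets borel" "T \<in> sets borel"
    and supp: "\<And>\<zeta>. \<zeta> \<notin> S \<Longrightarrow> f \<zeta> = 0" "\<And>\<zeta>. \<zeta> \<notin> T \<Longrightarrow> g \<zeta> = 0"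
    and meas: "\<And>\<eta>. emeasure lborel {\<zeta>. \<zeta> \<in> S \<and> \<eta> - \<zeta> \<in> T} \<le> C"
  shows "(\<integral>\<^sup>+\<eta>. (econv f g \<eta>)^2 \<partial>lborel) \<le> C * ((\<integral>\<^sup>+\<zeta>. f \<zeta> ^ 2 \<partial>lborel) * (\<integral>\<^sup>+\<zeta>. g \<zeta> ^ 2 \<partial>lborel))"
proof -
  have "(\<integral>\<^sup>+\<eta>. (econv f g \<eta>)^2 \<partial>lborel) \<le> (\<integral>\<^sup>+\<eta>. C * (\<integral>\<^sup>+\<zeta>. f \<zeta> ^ 2 * g (\<eta> - \<zeta>) ^ 2 \<partial>lborel) \<partial>lborel)"
  proof (rule nn_integral_mono)
    fix \<eta>
    let ?E = "{\<zeta>. \<zeta> \<in> S \<and> \<eta> - \<zeta> \<in> T}"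
    have E [measurable]: "?E \<in> sets borel" by measurable
    have "econv f g \<eta> = (\<integral>\<^sup>+\<zeta>. indicator ?E \<zeta> * (f \<zeta> * g (\<eta> - \<zeta>)) \<partial>lborel)"
      unfolding econv_def using supp by (intro nn_integral_cong) (auto split: split_indicator)
    also have "...^2 \<le> (\<integral>\<^sup>+\<zeta>. (indicator ?E \<zeta>)^2 \<partial>lborel) * (\<integral>\<^sup>+\<zeta>. (f \<zeta> * g (\<eta> - \<zeta>))^2 \<partial>lborel)"
      by (rule nn_integral_Cauchy_Schwarz_square) measurable
    also have "(\<integral>\<^sup>+\<zeta>. (indicator ?E \<zeta> :: ennreal)^2 \<partial>lborel) = (\<integral>\<^sup>+\<zeta>. indicator ?E \<zeta> \<partial>lborel)"
      by (intro nn_integral_cong) (auto split: split_indicator)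
    also have "... = emeasure lborel ?E" by simp
    also have "... \<le> C" by (rule meas)
    finally show "(econv f g \<eta>)^2 \<le> C * (\<integral>\<^sup>+\<zeta>. f \<zeta> ^ 2 * g (\<eta> - \<zeta>) ^ 2 \<partial>lborel)"
      by (simp add: power_mult_distrib mult_right_mono)
  qed
  also have "... = C * (\<integral>\<^sup>+\<eta>. \<integral>\<^sup>+\<zeta>. f \<zeta> ^ 2 * g (\<eta> - \<zeta>) ^ 2 \<partial>lborel \<partial>lborel)"
    by (rule nn_integral_cmult) measurable
  also have "(\<integral>\<^sup>+\<eta>. \<integral>\<^sup>+\<zeta>. f \<zeta> ^ 2 * g (\<eta> - \<zeta>) ^ 2 \<partial>lborel \<partial>lborel) = (\<integral>\<^sup>+\<zeta>. \<integral>\<^sup>+\<eta>. f \<zeta> ^ 2 * g (\<eta> - \<zeta>) ^ 2 \<partial>lborel \<partial>lborel)"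
    by (rule lborel_pair.Fubini') measurable
  also have "... = (\<integral>\<^sup>+\<zeta>. f \<zeta> ^ 2 * (\<integral>\<^sup>+\<eta>. g \<eta> ^ 2 \<partial>lborel) \<partial>lborel)"
  proof (rule nn_integral_cong)
    fix \<zeta>
    have "(\<integral>\<^sup>+\<eta>. g (- \<zeta> + \<eta>) ^ 2 \<partial>lborel) = (\<integral>\<^sup>+\<eta>. g \<eta> ^ 2 \<partial>lborel)"
      by (rule nn_integral_lborel_plus[of "\<lambda>\<eta>. g \<eta> ^ 2"]) measurable
    then show "(\<integral>\<^sup>+\<eta>. f \<zeta> ^ 2 * g (\<eta> - \<zeta>) ^ 2 \<partial>lborel) = f \<zeta> ^ 2 * (\<integral>\<^sup>+\<eta>. g \<eta> ^ 2 \<partial>lborel)"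
      by (simp add: nn_integral_cmult)
  qed
  also have "... = (\<integral>\<^sup>+\<zeta>. f \<zeta> ^ 2 \<partial>lborel) * (\<integral>\<^sup>+\<zeta>. g \<zeta> ^ 2 \<partial>lborel)"
    by (rule nn_integral_multc) measurable
  finally show ?thesis .
qed

text \<open>The square integral sees \<open>g\<close> only through its autocorrelation; this form is
  prepared for the invariance under reflection.\<close>

lemma nn_integral_econv_square:
  fixes f g :: "'a::euclidean_space \<Rightarrow> ennreal"
  assumes [measurable]: "f \<in> borel_measurable borel" "g \<in> borel_measurable borel"
  shows "(\<integral>\<^sup>+\<eta>. (econv f g \<eta>)^2 \<partial>lborel) = (\<integral>\<^sup>+\<zeta>. \<integral>\<^sup>+\<xi>. f \<zeta> * f \<xi> * (\<integral>\<^sup>+\<eta>. g (\<eta> - \<zeta>) * g (\<eta> - \<xi>) \<partial>lborel) \<partial>lborel \<partial>lborel)"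
proof -
  have "(\<integral>\<^sup>+\<eta>. (econv f g \<eta>)^2 \<partial>lborel) = (\<integral>\<^sup>+\<eta>. \<integral>\<^sup>+\<zeta>. \<integral>\<^sup>+\<xi>. f \<zeta> * f \<xi> * (g (\<eta> - \<zeta>) * g (\<eta> - \<xi>)) \<partial>lborel \<partial>lborel \<partial>lborel)"
  proof (rule nn_integral_cong)
    fix \<eta>
    have "(econv f g \<eta>)^2 = (\<integral>\<^sup>+\<zeta>. f \<zeta> * g (\<eta> - \<zeta>) * econv f g \<eta> \<partial>lborel)"
      unfolding power2_eq_square econv_def[of f g] by (rule nn_integral_multc[symmetric]) measurable
    also have "... = (\<integral>\<^sup>+\<zeta>. \<integral>\<^sup>+\<xi>. f \<zeta> * g (\<eta> - \<zeta>) * (f \<xi> * g (\<eta> - \<xi>)) \<partial>lborel \<partial>lborel)"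
      unfolding econv_def by (intro nn_integral_cong nn_integral_cmult[symmetric]) measurable
    finally show "(econv f g \<eta>)^2 = (\<integral>\<^sup>+\<zeta>. \<integral>\<^sup>+\<xi>. f \<zeta> * f \<xi> * (g (\<eta> - \<zeta>) * g (\<eta> - \<xi>)) \<partial>lborel \<partial>lborel)"
      by (simp add: mult_ac)
  qed
  also have "... = (\<integral>\<^sup>+\<zeta>. \<integral>\<^sup>+\<eta>. \<integral>\<^sup>+\<xi>. f \<zeta> * f \<xi> * (g (\<eta> - \<zeta>) * g (\<eta> - \<xi>)) \<partial>lborel \<partial>lborel \<partial>lborel)"
    by (rule lborel_pair.Fubini') measurable
  also have "... = (\<integral>\<^sup>+\<zeta>. \<integral>\<^sup>+\<xi>. \<integral>\<^sup>+\<eta>. f \<zeta> * f \<xi> * (g (\<eta> - \<zeta>) * g (\<eta> - \<xi>)) \<partial>lborel \<partial>lborel \<partial>lborel)"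
    by (intro nn_integral_cong lborel_pair.Fubini') measurable
  also have "... = (\<integral>\<^sup>+\<zeta>. \<integral>\<^sup>+\<xi>. f \<zeta> * f \<xi> * (\<integral>\<^sup>+\<eta>. g (\<eta> - \<zeta>) * g (\<eta> - \<xi>) \<partial>lborel) \<partial>lborel \<partial>lborel)"
    by (intro nn_integral_cong nn_integral_cmult) measurable
  finally show ?thesis .
qed

text \<open>
  The counterpart on the Fourier side of \<open>\<parallel>u\<^sub>1 u\<^sub>2\<parallel> = \<parallel>u\<^sub>1 \<cdot> cnj u\<^sub>2\<parallel>\<close>: reflecting one factor
  exchanges the two sheets of the cone, so that only equal signs need to be considered.
\<close>

lemma nn_integral_econv_square_reflect:
  fixes f g :: "'a::euclidean_space \<Rightarrow> ennreal"
  assumes [measurable]: "f \<in> borel_measurable borel" "g \<in> borel_measurable borel"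
  shows "(\<integral>\<^sup>+\<eta>. (econv f (\<lambda>\<zeta>. g (- \<zeta>)) \<eta>)^2 \<partial>lborel) = (\<integral>\<^sup>+\<eta>. (econv f g \<eta>)^2 \<partial>lborel)"
proof -
  have "(\<integral>\<^sup>+\<eta>. g (- (\<eta> - \<zeta>)) * g (- (\<eta> - \<xi>)) \<partial>lborel) = (\<integral>\<^sup>+\<eta>. g (\<eta> - \<zeta>) * g (\<eta> - \<xi>) \<partial>lborel)" for \<zeta> \<xi>
    \<comment> \<open>The substitution \<open>\<eta> \<mapsto> \<zeta> + \<xi> - \<eta>\<close>
      exchanges the two factors.\<close>
    using nn_integral_lborel_diff[of "\<lambda>\<eta>. g (- (\<eta> - \<zeta>)) * g (- (\<eta> - \<xi>))" "\<zeta> + \<xi>"]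
    by (simp add: algebra_simps)
  then show ?thesis by (simp add: nn_integral_econv_square)
qed

section \<open>The Fourier transform of a product\<close>

lemma integrable_conv_pair:
  fixes f g :: "'a::euclidean_space \<Rightarrow> complex"
  assumes f: "integrable lborel f" and g: "integrable lborel g"
  shows "integrable (lborel \<Otimes>\<^sub>M lborel) (\<lambda>(\<eta>, \<zeta>). f \<zeta> * g (\<eta> - \<zeta>))"
proof (rule integrableI_bounded)
  have [measurable]: "f \<in> borel_measurable borel" "g \<in> borel_measurable borel"
    using f g by (auto dest: borel_measurable_integrable)
  show "(\<lambda>(\<eta>, \<zeta>). f \<zeta> * g (\<eta> - \<zeta>)) \<in> borel_measurable (lborel \<Otimes>\<^sub>M lborel)" by measurable
  have "(\<integral>\<^sup>+z. ennreal (norm (case z of (\<eta>, \<zeta>) \<Rightarrow> f \<zeta> * g (\<eta> - \<zeta>))) \<partial>(lborel \<Otimes>\<^sub>M lborel))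
     = (\<integral>\<^sup>+\<zeta>. \<integral>\<^sup>+\<eta>. ennreal (norm (f \<zeta>)) * ennreal (norm (g (- \<zeta> + \<eta>))) \<partial>lborel \<partial>lborel)"
    by (subst lborel_pair.nn_integral_snd[symmetric]) (auto simp: norm_mult ennreal_mult)
  also have "... = (\<integral>\<^sup>+\<zeta>. ennreal (norm (f \<zeta>)) * (\<integral>\<^sup>+\<eta>. ennreal (norm (g (- \<zeta> + \<eta>))) \<partial>lborel) \<partial>lborel)"
    by (intro nn_integral_cong nn_integral_cmult) measurable
  also have "... = (\<integral>\<^sup>+\<zeta>. ennreal (norm (f \<zeta>)) * (\<integral>\<^sup>+\<eta>. ennreal (norm (g \<eta>)) \<partial>lborel) \<partial>lborel)"
    by (intro nn_integral_cong arg_cong2[where f="(*)"] refl nn_integral_lborel_plus[of "\<lambda>\<eta>. ennreal (norm (g \<eta>))"]) measurable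
  also have "... = (\<integral>\<^sup>+\<zeta>. ennreal (norm (f \<zeta>)) \<partial>lborel) * (\<integral>\<^sup>+\<eta>. ennreal (norm (g \<eta>)) \<partial>lborel)"
    by (rule nn_integral_multc) measurable
  also have "... < \<infinity>"
    using f g by (auto simp: integrable_iff_bounded ennreal_mult_less_top)
  finally show "(\<integral>\<^sup>+z. ennreal (norm (case z of (\<eta>, \<zeta>) \<Rightarrow> f \<zeta> * g (\<eta> - \<zeta>))) \<partial>(lborel \<Otimes>\<^sub>M lborel)) < \<infinity>" .
qed

definition conv :: "('a::euclidean_space \<Rightarrow> complex) \<Rightarrow> ('a \<Rightarrow> complex) \<Rightarrow> 'a \<Rightarrow> complex" where
  "conv f g \<eta> = (\<integral>\<zeta>. f \<zeta> * g (\<eta> - \<zeta>) \<partial>lborel)"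

lemma conv_measurable [measurable]:
  assumes [measurable]: "f \<in> borel_measurable borel" "g \<in> borel_measurable borel"
  shows "conv f g \<in> borel_measurable borel"
  unfolding conv_def[abs_def] by measurable

lemma norm_conv_le:
  "ennreal (norm (conv f g \<eta>)) \<le> econv (\<lambda>\<zeta>. ennreal (norm (f \<zeta>))) (\<lambda>\<zeta>. ennreal (norm (g \<zeta>))) \<eta>"
  unfolding conv_def econv_def
  using norm_integral_le_nn_integral[where M=lborel and f="\<lambda>\<zeta>. f \<zeta> * g (\<eta> - \<zeta>)"] by (simp add: norm_mult ennreal_mult)

lemma integrable_conv:
  assumes "integrable lborel f" "integrable lborel g"
  shows "integrable lborel (conv f g)"
  using lborel_pair.integrable_fst'[OF integrable_conv_pair[OF assms]]
  by (simp add: conv_def[abs_def])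

lemma fourier_integral_conv:
  fixes f g :: "'a::euclidean_space \<Rightarrow> complex"
  assumes f: "integrable lborel f" and g: "integrable lborel g"
  shows "fourier_integral (conv f g) z = fourier_integral f z * fourier_integral g z"
proof -
  have [measurable]: "f \<in> borel_measurable borel" "g \<in> borel_measurable borel"
    using f g by (auto dest: borel_measurable_integrable)
  let ?e = "\<lambda>\<zeta>. exp (- \<i> * complex_of_real (\<zeta> \<bullet> z))"
  have int: "integrable (lborel \<Otimes>\<^sub>M lborel) (\<lambda>(\<eta>, \<zeta>). ?e \<eta> * (f \<zeta> * g (\<eta> - \<zeta>)))"
    by (rule Bochner_Integration.integrable_bound[OF integrable_conv_pair[OF f g]])
       (auto simp: norm_mult split_beta)
  have "fourier_integral (conv f g) z = (\<integral>\<eta>. \<integral>\<zeta>. ?e \<eta> * (f \<zeta> * g (\<eta> - \<zeta>)) \<partial>lborel \<partial>lborel)"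
    unfolding fourier_integral_def conv_def by (subst integral_mult_right_zero[symmetric]) simp
  also have "... = (\<integral>\<zeta>. \<integral>\<eta>. ?e \<eta> * (f \<zeta> * g (\<eta> - \<zeta>)) \<partial>lborel \<partial>lborel)"
    by (rule lborel_pair.Fubini_integral[OF int, symmetric])
  also have "... = (\<integral>\<zeta>. ?e \<zeta> * f \<zeta> * fourier_integral g z \<partial>lborel)"
  proof (rule Bochner_Integration.integral_cong[OF refl])
    fix \<zeta>
    have "(\<integral>\<eta>. ?e \<eta> * (f \<zeta> * g (\<eta> - \<zeta>)) \<partial>lborel) = (\<integral>\<eta>. ?e (\<zeta> + \<eta>) * (f \<zeta> * g ((\<zeta> + \<eta>) - \<zeta>)) \<partial>lborel)"
      by (rule integral_lborel_plus[symmetric]) measurable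
    also have "... = (\<integral>\<eta>. ?e \<zeta> * f \<zeta> * (?e \<eta> * g \<eta>) \<partial>lborel)"
      by (simp add: inner_add_left exp_add[symmetric] algebra_simps)
    also have "... = ?e \<zeta> * f \<zeta> * fourier_integral g z"
      unfolding fourier_integral_def by (rule integral_mult_right_zero)
    finally show "(\<integral>\<eta>. ?e \<eta> * (f \<zeta> * g (\<eta> - \<zeta>)) \<partial>lborel) = ?e \<zeta> * f \<zeta> * fourier_integral g z" .
  qed
  also have "... = fourier_integral f z * fourier_integral g z"
    unfolding fourier_integral_def[of f] by (rule integral_mult_left_zero)
  finally show ?thesis .
qed

text \<open>A product of square integrable functions is in general only integrable, so its
  membership in L2 has to come from the Fourier side, through \<open>conv q1 q2\<close>. The
  integrable representatives make both factors inverse Fourier integrals almost everywhere, and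
  their product is that of the convolution; one of the two normalising factors survives.\<close>

lemma has_fourier_L2_mult:
  fixes u1 u2 v1 v2 :: "'a::euclidean_space \<Rightarrow> complex"
  assumes 1: "has_fourier_L2 u1 v1" "AE \<zeta> in lborel. v1 \<zeta> = q1 \<zeta>" "integrable lborel q1" "q1 \<in> L2"
    and 2: "has_fourier_L2 u2 v2" "AE \<zeta> in lborel. v2 \<zeta> = q2 \<zeta>" "integrable lborel q2" "q2 \<in> L2"
    and conv: "conv q1 q2 \<in> L2"
  shows "has_fourier_L2 (\<lambda>z. u1 z * u2 z) (\<lambda>\<zeta>. (1 / (2 * pi) ^ DIM('a)) * conv q1 q2 \<zeta>)"
proof -
  let ?c = "1 / (2 * pi) ^ DIM('a) :: complex"
  have int: "integrable lborel (conv q1 q2)" by (intro integrable_conv 1 2)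
  have [measurable]: "u1 \<in> borel_measurable borel" "u2 \<in> borel_measurable borel"
    using 1 2 by (auto simp: has_fourier_L2_iff L2_iff)
  have [measurable]: "conv q1 q2 \<in> borel_measurable borel" using conv by (simp add: L2_iff)
  have ae: "AE z in lborel. u1 z * u2 z = ?c^2 * fourier_integral (conv q1 q2) (- z)"
    using fourier_inversion[OF 1(1,3,4,2)] fourier_inversion[OF 2(1,3,4,2)]
    by eventually_elim (simp add: fourier_integral_conv[OF 1(3) 2(3)] power2_eq_square)
  have F: "has_fourier_L2 (\<lambda>z. ?c^2 * fourier_integral (conv q1 q2) (- z)) (\<lambda>\<zeta>. ?c^2 * ((2 * pi) ^ DIM('a) * conv q1 q2 \<zeta>))"
    by (intro has_fourier_L2_cmult has_fourier_L2_inverse_integral int conv)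
  show ?thesis
    by (rule has_fourier_L2_cong_AE[OF F]) (use ae in \<open>auto simp: power2_eq_square elim!: eventually_mono\<close>)
qed

text \<open>In particular the choice in the definition of \<^const>\<open>fourier_proj\<close> is not vacuous.\<close>

lemma fourier_proj_bound:
  fixes u h :: "'a::euclidean_space \<Rightarrow> complex"
  assumes uh: "has_fourier_L2 u h" and h: "integrable lborel h" and A [measurable]: "A \<in> sets borel"
  shows "fourier_proj A u \<in> L2"
    and "sq_norm (fourier_proj A u) \<le> ennreal (1 / (2 * pi) ^ DIM('a)) * sq_norm (\<lambda>\<zeta>. indicator A \<zeta> * h \<zeta>)"
proof -
  let ?c = "1 / (2 * pi) ^ DIM('a) :: complex"
  have hL2: "h \<in> L2" using uh by (simp add: has_fourier_L2_iff)
  have [measurable]: "h \<in> borel_measurable borel" using hL2 by (simp add: L2_iff)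
  define r where "r \<zeta> = indicator A \<zeta> * h \<zeta>" for \<zeta>
  have r_meas [measurable]: "r \<in> borel_measurable borel" unfolding r_def[abs_def] by measurable
  have le: "norm (r \<zeta>) \<le> norm (h \<zeta>)" for \<zeta> by (auto simp: r_def split: split_indicator)
  have rL2: "r \<in> L2" by (rule L2_mono[OF hL2 r_meas le])
  have r: "integrable lborel r" by (rule Bochner_Integration.integrable_bound[OF h]) (use le in auto)
  define w0 where "w0 z = ?c * fourier_integral r (- z)" for z
  have "has_fourier_L2 w0 (\<lambda>\<zeta>. ?c * ((2 * pi) ^ DIM('a) * r \<zeta>))"
    unfolding w0_def[abs_def] by (intro has_fourier_L2_cmult has_fourier_L2_inverse_integral r rL2)
  then have w0: "has_fourier_L2 w0 r" by simp
  have u: "AE \<zeta> in lborel. fourier_L2 u \<zeta> = h \<zeta>" by (rule fourier_L2_eq_AE[OF uh])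
  have "w0 \<in> L2 \<and> (AE \<zeta> in lborel. fourier_L2 w0 \<zeta> = indicator A \<zeta> * fourier_L2 u \<zeta>)"
    using w0 fourier_L2_eq_AE[OF w0] u by (auto simp: has_fourier_L2_iff r_def elim!: eventually_elim2)
  then have w: "fourier_proj A u \<in> L2 \<and> (AE \<zeta> in lborel. fourier_L2 (fourier_proj A u) \<zeta> = indicator A \<zeta> * fourier_L2 u \<zeta>)"
    unfolding fourier_proj_def
    by (rule someI[where P="\<lambda>w. w \<in> L2 \<and> (AE \<zeta> in lborel. fourier_L2 w \<zeta> = indicator A \<zeta> * fourier_L2 u \<zeta>)"])
  then show wL2: "fourier_proj A u \<in> L2" by blast
  \<comment> \<open>Every admissible choice has this transform, so the estimate does not depend on
    which one \<open>SOME\<close> picks.\<close>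
  from w u have "AE \<zeta> in lborel. fourier_L2 (fourier_proj A u) \<zeta> = r \<zeta>"
    by (auto simp: r_def elim!: eventually_elim2)
  then show "sq_norm (fourier_proj A u) \<le> ennreal (1 / (2 * pi) ^ DIM('a)) * sq_norm (\<lambda>\<zeta>. indicator A \<zeta> * h \<zeta>)"
    using sq_norm_le_fourier[OF has_fourier_L2_fourier_L2[OF wL2] r rL2] by (simp add: r_def[abs_def])
qed

section \<open>The estimate on strips\<close>

lemma closed_thick_cone: "closed (thick_cone M s N L)"
proof -
  have "thick_cone M s N L = {z. N / M \<le> norm (snd z) \<and> norm (snd z) \<le> M * N \<and> \<bar>fst z - s * norm (snd z)\<bar> \<le> M * L}"
    by (auto simp: thick_cone_def)
  also have "closed ..."
    by (intro closed_Collect_conj closed_Collect_le continuous_intros)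
  finally show ?thesis .
qed

lemma bounded_thick_cone:
  assumes s: "s = 1 \<or> s = -1"
  shows "bounded (thick_cone M s N L)"
proof (rule boundedI)
  fix z assume "z \<in> thick_cone M s N L"
  then have z: "norm (snd z) \<le> M * N" "\<bar>fst z - s * norm (snd z)\<bar> \<le> M * L"
    by (auto simp: thick_cone_def)
  have "\<bar>s * norm (snd z)\<bar> = norm (snd z)" using s by auto
  then have "\<bar>fst z\<bar> \<le> M * L + M * N" using z by linarith
  moreover have "norm z \<le> \<bar>fst z\<bar> + norm (snd z)"
    using norm_Pair_le[of "fst z" "snd z"] by simp
  ultimately show "norm z \<le> M * L + M * N + M * N" using z by linarith
qed

lemma uminus_thick_cone: "- z \<in> thick_cone M s N L \<longleftrightarrow> z \<in> thick_cone M (- s) N L"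
proof -
  have "\<bar>- fst z - s * norm (snd z)\<bar> = \<bar>fst z + s * norm (snd z)\<bar>" by linarith
  then show ?thesis by (cases z) (simp add: thick_cone_def)
qed

text \<open>Divided by \<open>d\<close>, the condition places \<open>k\<close> within distance 1 of
  \<open>(a - p) / d\<close>, and an interval of length 2 contains at most three integers.\<close>

lemma card_overlapping_strips:
  fixes K :: "int set" and a d p :: real
  assumes d: "0 < d"
  shows "card {k \<in> K. a - (of_int k + 1) * d \<le> p \<and> p \<le> a + d - of_int k * d} \<le> 3"
proof -
  let ?x = "(a - p) / d"
  have "{k \<in> K. a - (of_int k + 1) * d \<le> p \<and> p \<le> a + d - of_int k * d} \<subseteq> {\<lfloor>?x\<rfloor> - 1..\<lfloor>?x\<rfloor> + 1}"
  proof
    fix k assume "k \<in> {k \<in> K. a - (of_int k + 1) * d \<le> p \<and> p \<le> a + d - of_int k * d}"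
    then have "?x \<le> of_int k + 1" "of_int k - 1 \<le> ?x"
      using d by (auto simp: field_simps)
    then show "k \<in> {\<lfloor>?x\<rfloor> - 1..\<lfloor>?x\<rfloor> + 1}" by auto linarith+
  qed
  from card_mono[OF _ this] show ?thesis by simp
qed

text \<open>
  If the output frequency lies in a strip of width \<^term>\<open>d\<close>, the interaction is almost diagonal with
  respect to the decomposition of both inputs into parallel strips of width comparable to \<^term>\<open>d\<close>.
\<close>

lemma cone_econv_bound:
  fixes f g :: "spacetime \<Rightarrow> ennreal" and \<omega> :: "real^2"
  assumes [measurable]: "f \<in> borel_measurable borel" "g \<in> borel_measurable borel"
    and M: "1 \<le> M" and N: "0 < N1" "0 < N2" and L: "0 < La" "0 < Lb"
    and s: "s1 = 1 \<or> s1 = -1" "s2 = 1 \<or> s2 = -1"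
    and w: "norm \<omega> = 1" and \<alpha>: "0 < \<alpha>" "\<alpha> \<le> 1" and d: "0 < d"
    and f0: "\<And>\<zeta>. f \<zeta> \<noteq> 0 \<Longrightarrow> \<zeta> \<in> thick_cone M s1 N1 La \<and> \<bar>snd \<zeta> \<bullet> perp \<omega>\<bar> \<le> (1 - \<alpha>^2/4) * norm (snd \<zeta>)"
    and g0: "\<And>\<zeta>. g \<zeta> \<noteq> 0 \<Longrightarrow> \<zeta> \<in> thick_cone M s2 N2 Lb"
    and F: "(\<integral>\<^sup>+\<zeta>. f \<zeta> ^ 2 \<partial>lborel) = ennreal F" "0 \<le> F" and G: "(\<integral>\<^sup>+\<zeta>. g \<zeta> ^ 2 \<partial>lborel) = ennreal G" "0 \<le> G"
  shows "(\<integral>\<^sup>+\<eta>. (indicator {\<eta>. a \<le> snd \<eta> \<bullet> \<omega> \<and> snd \<eta> \<bullet> \<omega> \<le> a + d} \<eta> * econv f g \<eta>)^2 \<partial>lborel)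
    \<le> ennreal (3 * (128 * M^4 * d * sqrt (min N1 N2) * (La * Lb) powr (3/4) / \<alpha>) * (F * G))"
proof -
  define D where "D = 128 * M^4 * d * sqrt (min N1 N2) * (La * Lb) powr (3/4) / \<alpha>"
  have D: "0 \<le> D" using M N d \<alpha> by (simp add: D_def)
  define p where "p \<zeta> = snd \<zeta> \<bullet> \<omega>" for \<zeta> :: spacetime
  have [measurable]: "p \<in> borel_measurable borel"
    unfolding p_def[abs_def] by (intro borel_measurable_continuous_onI continuous_intros)
  \<comment> \<open>Half-open, so that the strips partition the space and each \<zeta> is counted
    once.\<close>
  define J where "J k = {\<zeta>. of_int k * d \<le> p \<zeta> \<and> p \<zeta> < (of_int k + 1) * d}" for k :: int
  \<comment> \<open>The range of \<open>\<eta> - \<zeta>\<close> when \<zeta> lies in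
    \<open>J k\<close> and \<open>p \<eta>\<close> between \<open>a\<close> and
    \<open>a + d\<close>: a strip of width \<open>2 * d\<close>.\<close>
  define I where "I k = {\<zeta>. a - (of_int k + 1) * d \<le> p \<zeta> \<and> p \<zeta> \<le> a + d - of_int k * d}" for k :: int
  have [measurable]: "J k \<in> sets borel" "I k \<in> sets borel" for k
    unfolding J_def I_def by measurable
  define fk where "fk k \<zeta> = indicator (J k) \<zeta> * f \<zeta>" for k \<zeta>
  define gk where "gk k \<zeta> = indicator (I k) \<zeta> * g \<zeta>" for k \<zeta>
  have [measurable]: "fk k \<in> borel_measurable borel" "gk k \<in> borel_measurable borel" for k
    unfolding fk_def[abs_def] gk_def[abs_def] by measurable
  \<comment> \<open>Finitely many indices suffice, since \<open>|p \<zeta>|\<close> is at most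
    \<open>M * N1\<close> wherever \<open>f\<close> is nonzero.\<close>
  define K where "K = {\<lfloor>- (M * N1) / d\<rfloor>..\<lfloor>M * N1 / d\<rfloor>}"
  have finK: "finite K" by (simp add: K_def)
  define A where "A = {\<eta>. a \<le> p \<eta> \<and> p \<eta> \<le> a + d}"

  have decomp: "indicator A \<eta> * econv f g \<eta> \<le> (\<Sum>k\<in>K. econv (fk k) (gk k) \<eta>)" for \<eta>
  proof (cases "\<eta> \<in> A")
    case True
    have "econv f g \<eta> \<le> (\<integral>\<^sup>+\<zeta>. (\<Sum>k\<in>K. fk k \<zeta> * gk k (\<eta> - \<zeta>)) \<partial>lborel)"
      unfolding econv_def
    proof (rule nn_integral_mono)
      fix \<zeta>
      show "f \<zeta> * g (\<eta> - \<zeta>) \<le> (\<Sum>k\<in>K. fk k \<zeta> * gk k (\<eta> - \<zeta>))"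
      proof (cases "f \<zeta> = 0")
        case False
        define k where "k = \<lfloor>p \<zeta> / d\<rfloor>"
        have "of_int k \<le> p \<zeta> / d" "p \<zeta> / d < of_int k + 1" unfolding k_def by linarith+
        then have k: "of_int k * d \<le> p \<zeta>" "p \<zeta> < (of_int k + 1) * d" using d by (simp_all add: field_simps)
        have "\<bar>p \<zeta>\<bar> \<le> norm (snd \<zeta>) * norm \<omega>" unfolding p_def by (rule Cauchy_Schwarz_ineq2)
        also have "... \<le> M * N1" using f0[OF False] w by (auto simp: thick_cone_def split_beta)
        finally have "- (M * N1) \<le> p \<zeta>" "p \<zeta> \<le> M * N1" by linarith+
        then have "- (M * N1) / d \<le> p \<zeta> / d" "p \<zeta> / d \<le> M * N1 / d"
          using d by (intro divide_right_mono; simp)+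
        then have "k \<in> K" unfolding K_def k_def by (auto intro: floor_mono)
        have "p (\<eta> - \<zeta>) = p \<eta> - p \<zeta>" by (simp add: p_def inner_diff_left)
        then have "\<eta> - \<zeta> \<in> I k" "\<zeta> \<in> J k"
          using k True by (auto simp: I_def J_def A_def algebra_simps)
        then have "f \<zeta> * g (\<eta> - \<zeta>) = fk k \<zeta> * gk k (\<eta> - \<zeta>)" by (simp add: fk_def gk_def)
        also have "... \<le> (\<Sum>k\<in>K. fk k \<zeta> * gk k (\<eta> - \<zeta>))"
          using \<open>k \<in> K\<close> finK by (intro member_le_sum) auto
        finally show ?thesis .
      qed simp
    qed
    also have "... = (\<Sum>k\<in>K. econv (fk k) (gk k) \<eta>)"
      unfolding econv_def by (rule nn_integral_sum) measurable
    finally show ?thesis using True by simp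
  qed simp

  define ak where "ak k = enn2real (\<integral>\<^sup>+\<zeta>. fk k \<zeta> ^ 2 \<partial>lborel)" for k
  define bk where "bk k = enn2real (\<integral>\<^sup>+\<zeta>. gk k \<zeta> ^ 2 \<partial>lborel)" for k
  have leF: "(\<integral>\<^sup>+\<zeta>. fk k \<zeta> ^ 2 \<partial>lborel) \<le> ennreal F" for k
    unfolding F(1)[symmetric] by (intro nn_integral_mono) (auto simp: fk_def split: split_indicator)
  have ak: "(\<integral>\<^sup>+\<zeta>. fk k \<zeta> ^ 2 \<partial>lborel) = ennreal (ak k)" for k
    using le_less_trans[OF leF[of k] ennreal_less_top] by (simp add: ak_def)
  have leG: "(\<integral>\<^sup>+\<zeta>. gk k \<zeta> ^ 2 \<partial>lborel) \<le> ennreal G" for k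
    unfolding G(1)[symmetric] by (intro nn_integral_mono) (auto simp: gk_def split: split_indicator)
  have bk: "(\<integral>\<^sup>+\<zeta>. gk k \<zeta> ^ 2 \<partial>lborel) = ennreal (bk k)" for k
    using le_less_trans[OF leG[of k] ennreal_less_top] by (simp add: bk_def)
  have pos: "0 \<le> ak k" "0 \<le> bk k" for k by (simp_all add: ak_def bk_def)

  have sum_a: "(\<Sum>k\<in>K. ak k) \<le> F"
  proof -
    have "ennreal (\<Sum>k\<in>K. ak k) = (\<Sum>k\<in>K. \<integral>\<^sup>+\<zeta>. fk k \<zeta> ^ 2 \<partial>lborel)"
      by (simp add: ak pos)
    also have "... = (\<integral>\<^sup>+\<zeta>. (\<Sum>k\<in>K. fk k \<zeta> ^ 2) \<partial>lborel)"
      by (rule nn_integral_sum[symmetric]) measurable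
    also have "... \<le> (\<integral>\<^sup>+\<zeta>. f \<zeta> ^ 2 \<partial>lborel)"
    proof (rule nn_integral_mono)
      fix \<zeta>
      have "fk k \<zeta> ^ 2 = (if k = \<lfloor>p \<zeta> / d\<rfloor> then f \<zeta> ^ 2 else 0)" for k
      proof -
        have "\<zeta> \<in> J k \<longleftrightarrow> k = \<lfloor>p \<zeta> / d\<rfloor>"
          by (simp add: J_def pos_le_divide_eq[OF d] pos_divide_less_eq[OF d] floor_eq_iff eq_commute[of k])
        then show ?thesis by (auto simp: fk_def)
      qed
      then show "(\<Sum>k\<in>K. fk k \<zeta> ^ 2) \<le> f \<zeta> ^ 2"
        using finK by (simp add: sum.delta')
    qed
    finally show ?thesis using F by (simp add: ennreal_le_iff)
  qed
  have sum_b: "(\<Sum>k\<in>K. bk k) \<le> 3 * G"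
  proof -
    have "ennreal (\<Sum>k\<in>K. bk k) = (\<Sum>k\<in>K. \<integral>\<^sup>+\<zeta>. gk k \<zeta> ^ 2 \<partial>lborel)"
      by (simp add: bk pos)
    also have "... = (\<integral>\<^sup>+\<zeta>. (\<Sum>k\<in>K. gk k \<zeta> ^ 2) \<partial>lborel)"
      by (rule nn_integral_sum[symmetric]) measurable
    also have "... \<le> (\<integral>\<^sup>+\<zeta>. 3 * g \<zeta> ^ 2 \<partial>lborel)"
    proof (rule nn_integral_mono)
      fix \<zeta>
      have "(\<Sum>k\<in>K. gk k \<zeta> ^ 2) = (\<Sum>k\<in>{k \<in> K. \<zeta> \<in> I k}. g \<zeta> ^ 2)"
        using finK by (subst sum.inter_filter) (auto intro!: sum.cong simp: gk_def)
      also have "... = of_nat (card {k \<in> K. \<zeta> \<in> I k}) * g \<zeta> ^ 2" by simp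
      also have "... \<le> of_nat 3 * g \<zeta> ^ 2"
        using card_overlapping_strips[OF d, of K a "p \<zeta>"]
        by (intro mult_right_mono of_nat_mono) (auto simp: I_def)
      finally show "(\<Sum>k\<in>K. gk k \<zeta> ^ 2) \<le> 3 * g \<zeta> ^ 2" by simp
    qed
    also have "... = 3 * ennreal G" by (simp add: nn_integral_cmult G)
    also have "... = ennreal (3 * G)" using G by (simp add: ennreal_mult)
    finally show ?thesis using G by (simp add: ennreal_le_iff)
  qed

  have strip: "(\<integral>\<^sup>+\<eta>. (econv (fk k) (gk k) \<eta>)^2 \<partial>lborel) \<le> ennreal (D * (ak k * bk k))" for k
  proof -
    \<comment> \<open>Reflection brings the second factor to the sheet \<open>s1\<close>. It is
      admissible at this stage because the output cut-off has been replaced by the strips and the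
      integral over \<eta> is unrestricted.\<close>
    define gs where "gs = (if s2 = s1 then gk k else (\<lambda>\<zeta>. gk k (- \<zeta>)))"
    have [measurable]: "gs \<in> borel_measurable borel" unfolding gs_def by simp
    have gs_sq: "(\<integral>\<^sup>+\<zeta>. gs \<zeta> ^ 2 \<partial>lborel) = ennreal (bk k)"
      using nn_integral_lborel_uminus[of "\<lambda>\<zeta>. gk k \<zeta> ^ 2"] by (simp add: gs_def bk)
    have gs_econv: "(\<integral>\<^sup>+\<eta>. (econv (fk k) (gk k) \<eta>)^2 \<partial>lborel) = (\<integral>\<^sup>+\<eta>. (econv (fk k) gs \<eta>)^2 \<partial>lborel)"
      by (simp add: gs_def nn_integral_econv_square_reflect)
    have gs0: "gs \<zeta> = 0" if "\<zeta> \<notin> thick_cone M s1 N2 Lb" for \<zeta>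
    proof (cases "s2 = s1")
      case True
      then show ?thesis using that g0[of \<zeta>] by (auto simp: gs_def gk_def)
    next
      case False
      then have "- s2 = s1" using s by auto
      then have "- \<zeta> \<notin> thick_cone M s2 N2 Lb" using that by (simp add: uminus_thick_cone)
      then show ?thesis using False g0[of "- \<zeta>"] by (auto simp: gs_def gk_def)
    qed
    let ?c = "of_int k * d"
    \<comment> \<open>The half-open strip is enlarged to its closure, which fits
      \<open>thick_cone_overlap\<close> and makes the set closed.\<close>
    define S where "S = {\<zeta>. \<zeta> \<in> thick_cone M s1 N1 La \<and> \<bar>snd \<zeta> \<bullet> perp \<omega>\<bar> \<le> (1 - \<alpha>^2/4) * norm (snd \<zeta>) \<and> snd \<zeta> \<bullet> \<omega> \<in> {?c..?c + d}}"
    have S: "S \<in> sets borel"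
    proof (rule borel_closed)
      have "S = thick_cone M s1 N1 La \<inter> {\<zeta>. \<bar>snd \<zeta> \<bullet> perp \<omega>\<bar> \<le> (1 - \<alpha>^2/4) * norm (snd \<zeta>) \<and> ?c \<le> snd \<zeta> \<bullet> \<omega> \<and> snd \<zeta> \<bullet> \<omega> \<le> ?c + d}"
        by (auto simp: S_def)
      also have "closed ..."
        by (intro closed_Int closed_thick_cone closed_Collect_conj closed_Collect_le continuous_intros)
      finally show "closed S" .
    qed
    have "(\<integral>\<^sup>+\<eta>. (econv (fk k) gs \<eta>)^2 \<partial>lborel) \<le> ennreal D * ((\<integral>\<^sup>+\<zeta>. fk k \<zeta> ^ 2 \<partial>lborel) * (\<integral>\<^sup>+\<zeta>. gs \<zeta> ^ 2 \<partial>lborel))"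
    proof (rule econv_square_bound[of _ _ S "thick_cone M s1 N2 Lb"])
      show "fk k \<zeta> = 0" if "\<zeta> \<notin> S" for \<zeta>
        using that f0[of \<zeta>] by (auto simp: fk_def S_def J_def p_def algebra_simps split: split_indicator)
      show "emeasure lborel {\<zeta>. \<zeta> \<in> S \<and> \<eta> - \<zeta> \<in> thick_cone M s1 N2 Lb} \<le> ennreal D" for \<eta>
        unfolding D_def S_def
        using thick_cone_overlap[OF M N L s(1) w \<alpha> less_imp_le[OF d], of ?c \<eta>] by (simp add: conj_assoc)
    qed (use gs0 S closed_thick_cone in \<open>auto intro: borel_closed\<close>)
    also have "... = ennreal (D * (ak k * bk k))"
      using D pos by (simp add: ak gs_sq ennreal_mult)
    finally show ?thesis by (simp only: gs_econv)
  qed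

  have "(\<integral>\<^sup>+\<eta>. (indicator A \<eta> * econv f g \<eta>)^2 \<partial>lborel) \<le> (\<integral>\<^sup>+\<eta>. (\<Sum>k\<in>K. econv (fk k) (gk k) \<eta>)^2 \<partial>lborel)"
    by (intro nn_integral_mono power_mono decomp) simp
  also have "... \<le> ennreal (D * ((\<Sum>k\<in>K. ak k) * (\<Sum>k\<in>K. bk k)))"
    by (rule nn_integral_Minkowski_sum) (use D pos strip in auto)
  also have "... \<le> ennreal (D * (F * (3 * G)))"
    using D pos sum_a sum_b F by (intro ennreal_leI mult_left_mono mult_mono sum_nonneg) auto
  also have "D * (F * (3 * G)) = 3 * D * (F * G)" by simp
  finally show ?thesis unfolding A_def p_def D_def .
qed

section \<open>The product estimate with an explicit constant\<close>

lemma product_strip_estimate: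
  fixes \<omega> :: "real^2" and u1 u2 :: "spacetime \<Rightarrow> complex"
  assumes M: "1 \<le> M" and N: "0 < N1" "0 < N2" and L: "0 < La" "0 < Lb"
    and s: "s1 \<in> {1, -1}" "s2 \<in> {1, -1}"
    and w: "norm \<omega> = 1" and ab: "a \<le> b" and \<alpha>: "0 < \<alpha>" "\<alpha> \<le> 1"
    and u: "u1 \<in> L2" "u2 \<in> L2"
    and supp1: "ess_support (fourier_L2 u1) \<subseteq> thick_cone M s1 N1 La"
    and supp2: "ess_support (fourier_L2 u2) \<subseteq> thick_cone M s2 N2 Lb"
    and angle: "ess_support (fourier_L2 u1) \<subseteq> {(\<tau>, \<xi>). \<alpha> \<le> line_angle \<xi> (orthogonal_comp {\<omega>})}"
  shows "(\<lambda>z. u1 z * u2 z) \<in> L2"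
    and "fourier_proj {(\<tau>, \<xi>). \<xi> \<bullet> \<omega> \<in> {a..b}} (\<lambda>z. u1 z * u2 z) \<in> L2"
    and "L2_norm (fourier_proj {(\<tau>, \<xi>). \<xi> \<bullet> \<omega> \<in> {a..b}} (\<lambda>z. u1 z * u2 z))
      \<le> 40 * M^2 * sqrt ((b - a) * sqrt (min N1 N2) * (La * Lb) powr (3/4) / \<alpha>) * L2_norm u1 * L2_norm u2"
proof -
  have s': "s1 = 1 \<or> s1 = -1" "s2 = 1 \<or> s2 = -1" using s by auto
  let ?E = "(2 * pi) ^ DIM(spacetime)"
  have E: "1 \<le> ?E" using pi_gt3 by (intro one_le_power) simp
  have E0: "0 < ?E" by simp
  note has = has_fourier_L2_fourier_L2[OF u(1)] has_fourier_L2_fourier_L2[OF u(2)]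
  define S1 where "S1 = thick_cone M s1 N1 La \<inter> {\<zeta>. \<bar>snd \<zeta> \<bullet> perp \<omega>\<bar> \<le> (1 - \<alpha>^2/4) * norm (snd \<zeta>)}"
  define S2 where "S2 = thick_cone M s2 N2 Lb"
  have "closed S1" unfolding S1_def
    by (intro closed_Int closed_thick_cone closed_Collect_le continuous_intros)
  then have S1 [measurable]: "S1 \<in> sets borel" by (rule borel_closed)
  have S2 [measurable]: "S2 \<in> sets borel" unfolding S2_def by (intro borel_closed closed_thick_cone)
  have "bounded S1" unfolding S1_def by (rule bounded_Int[OF disjI1[OF bounded_thick_cone[OF s'(1)]]])
  moreover have "bounded S2" unfolding S2_def by (rule bounded_thick_cone[OF s'(2)])
  ultimately have fin: "emeasure lborel S1 < \<infinity>" "emeasure lborel S2 < \<infinity>"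
    by (simp_all only: emeasure_bounded_finite)
  have sub: "ess_support (fourier_L2 u1) \<subseteq> S1" "ess_support (fourier_L2 u2) \<subseteq> S2"
    using supp1 supp2 angle line_angle_bound[OF w \<alpha>] by (fastforce simp: S1_def S2_def)+
  \<comment> \<open>Representatives that vanish exactly outside bounded sets are integrable as well
    as square integrable, so their convolution and inverse transforms are covered by the integral
    formulas.\<close>
  define q1 where "q1 \<zeta> = indicator S1 \<zeta> * fourier_L2 u1 \<zeta>" for \<zeta>
  define q2 where "q2 \<zeta> = indicator S2 \<zeta> * fourier_L2 u2 \<zeta>" for \<zeta>
  have vL2: "fourier_L2 u1 \<in> L2" "fourier_L2 u2 \<in> L2" using has by (auto simp: has_fourier_L2_iff)
  then have [measurable]: "fourier_L2 u1 \<in> borel_measurable borel" "fourier_L2 u2 \<in> borel_measurable borel"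
    by (auto simp: L2_iff)
  have [measurable]: "q1 \<in> borel_measurable borel" "q2 \<in> borel_measurable borel"
    unfolding q1_def[abs_def] q2_def[abs_def] by measurable
  have qL2: "q1 \<in> L2" "q2 \<in> L2"
    by (rule L2_mono[OF vL2(1)], simp, simp add: q1_def split: split_indicator,
        rule L2_mono[OF vL2(2)], simp, simp add: q2_def split: split_indicator)
  have qint: "integrable lborel q1" "integrable lborel q2"
    unfolding q1_def[abs_def] q2_def[abs_def]
    by (intro L2_mult_integrable L2_indicator vL2 S1 S2 fin)+
  have ae: "AE \<zeta> in lborel. fourier_L2 u1 \<zeta> = q1 \<zeta>" "AE \<zeta> in lborel. fourier_L2 u2 \<zeta> = q2 \<zeta>"
    using AE_zero_outside_ess_support[of "fourier_L2 u1"] AE_zero_outside_ess_support[of "fourier_L2 u2"]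
    by (eventually_elim, use sub in \<open>auto simp: q1_def q2_def split: split_indicator\<close>)+
  define f where "f \<zeta> = ennreal (norm (q1 \<zeta>))" for \<zeta>
  define g where "g \<zeta> = ennreal (norm (q2 \<zeta>))" for \<zeta>
  have [measurable]: "f \<in> borel_measurable borel" "g \<in> borel_measurable borel"
    unfolding f_def[abs_def] g_def[abs_def] by measurable
  define F where "F = (L2_norm q1)^2"
  define G where "G = (L2_norm q2)^2"
  have fg: "(\<integral>\<^sup>+\<zeta>. f \<zeta> ^ 2 \<partial>lborel) = ennreal F" "(\<integral>\<^sup>+\<zeta>. g \<zeta> ^ 2 \<partial>lborel) = ennreal G"
    using sq_norm_eq_L2_norm[OF qL2(1)] sq_norm_eq_L2_norm[OF qL2(2)]
    by (simp_all add: f_def g_def F_def G_def sq_norm_def ennreal_power)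
  have FG0: "0 \<le> F" "0 \<le> G" by (simp_all add: F_def G_def)
  have FG: "F \<le> 2 * ?E * (L2_norm u1)^2" "G \<le> 2 * ?E * (L2_norm u2)^2"
  proof -
    have "ennreal F \<le> 2 * (ennreal ?E * sq_norm u1)" "ennreal G \<le> 2 * (ennreal ?E * sq_norm u2)"
      using sq_norm_fourier_le[OF has(1)] sq_norm_fourier_le[OF has(2)]
        sq_norm_cong_AE[OF ae(1)] sq_norm_cong_AE[OF ae(2)]
      unfolding F_def G_def sq_norm_eq_L2_norm[OF qL2(1), symmetric] sq_norm_eq_L2_norm[OF qL2(2), symmetric]
      by simp_all
    moreover have "2 * (ennreal ?E * ennreal (x^2)) = ennreal (2 * ?E * x^2)" for x
      by (simp add: ennreal_mult mult.assoc)
    ultimately have "ennreal F \<le> ennreal (2 * ?E * (L2_norm u1)^2)" "ennreal G \<le> ennreal (2 * ?E * (L2_norm u2)^2)"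
      unfolding sq_norm_eq_L2_norm[OF u(1)] sq_norm_eq_L2_norm[OF u(2)] by simp_all
    then show "F \<le> 2 * ?E * (L2_norm u1)^2" "G \<le> 2 * ?E * (L2_norm u2)^2"
      by (simp_all add: ennreal_le_iff)
  qed
  have convL2: "conv q1 q2 \<in> L2"
  proof -
    \<comment> \<open>A qualitative bound: with \<open>UNIV\<close> as the second set the overlap is
      at most the finite measure of \<open>S1\<close>. Only membership in L2 is wanted here.\<close>
    have "sq_norm (conv q1 q2) \<le> (\<integral>\<^sup>+\<eta>. (econv f g \<eta>)^2 \<partial>lborel)"
      unfolding sq_norm_def f_def[abs_def] g_def[abs_def]
      by (intro nn_integral_mono) (subst ennreal_power[symmetric], simp, intro power_mono norm_conv_le, simp)
    also have "... \<le> emeasure lborel S1 * (ennreal F * ennreal G)"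
      unfolding fg[symmetric]
      by (rule econv_square_bound[of _ _ S1 UNIV]) (auto simp: f_def q1_def intro!: emeasure_mono)
    also have "... < \<infinity>" using fin by (auto simp: ennreal_mult_less_top)
    finally show ?thesis by (simp add: L2_iff)
  qed
  define h where "h \<zeta> = (1 / ?E) * conv q1 q2 \<zeta>" for \<zeta>
  have uh: "has_fourier_L2 (\<lambda>z. u1 z * u2 z) h"
    unfolding h_def[abs_def] by (rule has_fourier_L2_mult[OF has(1) ae(1) qint(1) qL2(1) has(2) ae(2) qint(2) qL2(2) convL2])
  then show "(\<lambda>z. u1 z * u2 z) \<in> L2" by (simp add: has_fourier_L2_iff)
  have hint: "integrable lborel h"
    unfolding h_def[abs_def] by (intro integrable_mult_right integrable_conv qint)
  let ?A = "{(\<tau>, \<xi>). \<xi> \<bullet> \<omega> \<in> {a..b}} :: spacetime set"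
  have "?A = {z. a \<le> snd z \<bullet> \<omega> \<and> snd z \<bullet> \<omega> \<le> b}" by auto
  also have "closed ..." by (intro closed_Collect_conj closed_Collect_le continuous_intros)
  finally have A [measurable]: "?A \<in> sets borel" by (rule borel_closed)
  define W where "W = fourier_proj ?A (\<lambda>z. u1 z * u2 z)"
  have W: "W \<in> L2" "sq_norm W \<le> ennreal (1 / ?E) * sq_norm (\<lambda>\<zeta>. indicator ?A \<zeta> * h \<zeta>)"
    unfolding W_def by (rule fourier_proj_bound[OF uh hint A])+
  show "fourier_proj ?A (\<lambda>z. u1 z * u2 z) \<in> L2" using W by (simp add: W_def)
  define X where "X = sqrt (min N1 N2) * (La * Lb) powr (3/4) / \<alpha>"
  have X: "0 \<le> X" using N \<alpha> by (simp add: X_def)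
  \<comment> \<open>The constants multiply to \<open>4 * 3 * 128 = 1536\<close>, rounded up to 1600,
    the square of 40.\<close>
  define Y where "Y = 1600 * M^4 * X * ((L2_norm u1)^2 * (L2_norm u2)^2)"
  have Y: "0 \<le> Y" using X M by (simp add: Y_def)
  have est: "(L2_norm W)^2 \<le> d * Y" if d: "0 < d" "b - a \<le> d" for d
  proof -
    let ?B = "{\<eta>. a \<le> snd \<eta> \<bullet> \<omega> \<and> snd \<eta> \<bullet> \<omega> \<le> a + d} :: spacetime set"
    have conv_le: "sq_norm (\<lambda>\<zeta>. indicator ?A \<zeta> * conv q1 q2 \<zeta>) \<le> (\<integral>\<^sup>+\<eta>. (indicator ?B \<eta> * econv f g \<eta>)^2 \<partial>lborel)"
      unfolding sq_norm_def
    proof (rule nn_integral_mono)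
      fix \<eta>
      have "ennreal (norm (indicator ?A \<eta> * conv q1 q2 \<eta>)) \<le> indicator ?B \<eta> * econv f g \<eta>"
        using norm_conv_le[of q1 q2 \<eta>] d by (auto simp: f_def[abs_def] g_def[abs_def] split: split_indicator)
      then show "ennreal ((norm (indicator ?A \<eta> * conv q1 q2 \<eta>))^2) \<le> (indicator ?B \<eta> * econv f g \<eta>)^2"
        by (subst ennreal_power[symmetric]) (auto intro!: power_mono)
    qed
    also have "... \<le> ennreal (3 * (128 * M^4 * d * sqrt (min N1 N2) * (La * Lb) powr (3/4) / \<alpha>) * (F * G))"
    proof (rule cone_econv_bound[OF _ _ M N L s' w \<alpha> d(1) _ _ fg(1) FG0(1) fg(2) FG0(2)])
      show "\<zeta> \<in> thick_cone M s1 N1 La \<and> \<bar>snd \<zeta> \<bullet> perp \<omega>\<bar> \<le> (1 - \<alpha>^2/4) * norm (snd \<zeta>)" if "f \<zeta> \<noteq> 0" for \<zeta>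
        using that by (auto simp: f_def q1_def S1_def split: split_indicator_asm)
      show "\<zeta> \<in> thick_cone M s2 N2 Lb" if "g \<zeta> \<noteq> 0" for \<zeta>
        using that by (auto simp: g_def q2_def S2_def split: split_indicator_asm)
    qed measurable
    also have "3 * (128 * M^4 * d * sqrt (min N1 N2) * (La * Lb) powr (3/4) / \<alpha>) * (F * G) = 384 * M^4 * d * X * (F * G)"
      by (simp add: X_def)
    finally have conv_le: "sq_norm (\<lambda>\<zeta>. indicator ?A \<zeta> * conv q1 q2 \<zeta>) \<le> ennreal (384 * M^4 * d * X * (F * G))" .
    have "sq_norm (\<lambda>\<zeta>. indicator ?A \<zeta> * h \<zeta>) = sq_norm (\<lambda>\<zeta>. (1 / ?E) * (indicator ?A \<zeta> * conv q1 q2 \<zeta>))"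
      by (simp add: h_def mult_ac)
    also have "... = ennreal ((1 / ?E)^2) * sq_norm (\<lambda>\<zeta>. indicator ?A \<zeta> * conv q1 q2 \<zeta>)"
      by (subst sq_norm_cmult, measurable) (simp add: norm_divide norm_power norm_mult)
    also have "... \<le> ennreal ((1 / ?E)^2) * ennreal (384 * M^4 * d * X * (F * G))"
      by (intro mult_left_mono conv_le) simp
    finally have "ennreal ((L2_norm W)^2) \<le> ennreal (1 / ?E) * (ennreal ((1 / ?E)^2) * ennreal (384 * M^4 * d * X * (F * G)))"
      using W by (simp add: sq_norm_eq_L2_norm[symmetric] order_trans mult_left_mono)
    also have "... = ennreal (1 / ?E * ((1 / ?E)^2 * (384 * M^4 * d * X * (F * G))))"
      by (subst (1) ennreal_mult', simp, subst (1) ennreal_mult', simp, rule refl)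
    finally have "(L2_norm W)^2 \<le> 1 / ?E * ((1 / ?E)^2 * (384 * M^4 * d * X * (F * G)))"
      using X M d FG0 by (subst (asm) ennreal_le_iff) auto
    \<comment> \<open>\<open>F\<close> and \<open>G\<close> contribute a factor
      \<open>2 * ?E\<close> each. These cancel two of the three factors \<open>1 / ?E\<close>; the
      last is dropped below because \<open>1 \<le> ?E\<close>.\<close>
    also have "... \<le> 1 / ?E * ((1 / ?E)^2 * (384 * M^4 * d * X * ((2 * ?E * (L2_norm u1)^2) * (2 * ?E * (L2_norm u2)^2))))"
      using X M d FG FG0 by (intro mult_left_mono mult_mono) auto
    also have "... = 1 / ?E * (1536 * M^4 * d * X * ((L2_norm u1)^2 * (L2_norm u2)^2))"
      using E0 by (simp add: field_simps power2_eq_square)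
    also have "... \<le> 1 * (1600 * M^4 * d * X * ((L2_norm u1)^2 * (L2_norm u2)^2))"
      using E X M d by (intro mult_mono mult_right_mono) auto
    finally show ?thesis by (simp add: Y_def mult_ac)
  qed
  have "(L2_norm W)^2 \<le> (b - a) * Y"
  proof (rule field_le_epsilon)
    fix e :: real assume e: "0 < e"
    \<comment> \<open>Widening by \<open>e / (Y + 1)\<close> costs at most \<open>e\<close>, and the
      quotient is meaningful even when \<open>Y = 0\<close>.\<close>
    have "(L2_norm W)^2 \<le> (b - a + e / (Y + 1)) * Y"
      using e Y ab by (intro est) (auto intro!: add_nonneg_pos)
    also have "... \<le> (b - a) * Y + e"
      using e Y by (simp add: distrib_right divide_le_eq mult_left_mono)
    finally show "(L2_norm W)^2 \<le> (b - a) * Y + e" .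
  qed
  also have "... = (40 * M^2 * sqrt ((b - a) * sqrt (min N1 N2) * (La * Lb) powr (3/4) / \<alpha>) * L2_norm u1 * L2_norm u2)^2"
    using ab X N \<alpha> by (simp add: Y_def X_def power_mult_distrib)
  finally have "(L2_norm W)^2 \<le> ..." .
  then have "L2_norm W \<le> 40 * M^2 * sqrt ((b - a) * sqrt (min N1 N2) * (La * Lb) powr (3/4) / \<alpha>) * L2_norm u1 * L2_norm u2"
    by (rule power2_le_imp_le) (use ab N \<alpha> in \<open>auto intro!: mult_nonneg_nonneg L2_norm_nonneg\<close>)
  then show "L2_norm (fourier_proj ?A (\<lambda>z. u1 z * u2 z))
      \<le> 40 * M^2 * sqrt ((b - a) * sqrt (min N1 N2) * (La * Lb) powr (3/4) / \<alpha>) * L2_norm u1 * L2_norm u2"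
    by (simp add: W_def)
qed

theorem theorem2p2:
  fixes M :: real
  assumes "M \<ge> 1"
  shows "\<exists>c\<^sub>0 C :: real. 0 < c\<^sub>0 \<and> c\<^sub>0 < 1 \<and> 0 < C \<and>
    (\<forall>(N\<^sub>1::real) (N\<^sub>2::real) (L\<^sub>1::real) (L\<^sub>2::real) (s\<^sub>1::real) (s\<^sub>2::real)
      (\<omega>::real^2) (a::real) (b::real) (\<alpha>::real)
      (u\<^sub>1::spacetime \<Rightarrow> complex) (u\<^sub>2::spacetime \<Rightarrow> complex).
      0 < N\<^sub>1 \<and> 0 < N\<^sub>2 \<and> 0 < L\<^sub>1 \<and> 0 < L\<^sub>2 \<and>
      s\<^sub>1 \<in> {1, -1} \<and> s\<^sub>2 \<in> {1, -1} \<and> norm \<omega> = 1 \<and> a \<le> b \<and> 0 < \<alpha> \<and> \<alpha> \<le> c\<^sub>0 \<and>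
      u\<^sub>1 \<in> L2 \<and> u\<^sub>2 \<in> L2 \<and>
      ess_support (fourier_L2 u\<^sub>1) \<subseteq> thick_cone M s\<^sub>1 N\<^sub>1 L\<^sub>1 \<and>
      ess_support (fourier_L2 u\<^sub>2) \<subseteq> thick_cone M s\<^sub>2 N\<^sub>2 L\<^sub>2 \<and>
      ess_support (fourier_L2 u\<^sub>1) \<subseteq> {(\<tau>, \<xi>). line_angle \<xi> (orthogonal_comp {\<omega>}) \<ge> \<alpha>}
      \<longrightarrow>
      (\<lambda>z. u\<^sub>1 z * u\<^sub>2 z) \<in> L2 \<and>
      fourier_proj {(\<tau>\<^sub>0, \<xi>\<^sub>0). \<xi>\<^sub>0 \<bullet> \<omega> \<in> {a..b}} (\<lambda>z. u\<^sub>1 z * u\<^sub>2 z) \<in> L2 \<and>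
      L2_norm (fourier_proj {(\<tau>\<^sub>0, \<xi>\<^sub>0). \<xi>\<^sub>0 \<bullet> \<omega> \<in> {a..b}} (\<lambda>z. u\<^sub>1 z * u\<^sub>2 z))
        \<le> C * sqrt ((b - a) * sqrt (min N\<^sub>1 N\<^sub>2) * (L\<^sub>1 * L\<^sub>2) powr (3/4) / \<alpha>)
            * L2_norm u\<^sub>1 * L2_norm u\<^sub>2)"
  \<comment> \<open>The strip estimate is available for \<alpha> \<le> 1, so any value in (0,1)
    serves as \<open>c\<^sub>0\<close>; the second witness is the constant of that estimate.\<close>
  apply (rule exI[of _ "1/2"], rule exI[of _ "40 * M\<^sup>2"])
  apply (rule conjI, simp, rule conjI, simp, rule conjI)
  subgoal using assms by simp
  apply (intro allI impI)
  subgoal premises prems for N1 N2 La Lb s1 s2 \<omega> a b \<alpha> u1 u2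
    using product_strip_estimate[OF assms, of N1 N2 La Lb s1 s2 \<omega> a b \<alpha> u1 u2] prems by simp
  done

end
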